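(* Let $n\ge 2$ and let $U\subseteq\mathbb{R}^n$ be any nonempty open set. Let $f$ be a compactly supported distribution on $\mathbb{R}^n$, or $f\in L^p(\mathbb{R}^n)$ for some $1\le p<n$, and suppose that $N^0f\in H^{1/2}(\mathbb{R}^n)$. If $f|_U=0$ and there exists a measurable set $E\subset U$ of positive measure such that $(N^0f)|_E=0$, then $f\equiv 0$ in $\mathbb{R}^n$.
   Context: Here $f$ is scalar and $N^0$ is the normal operator $(I^0)^*I^0$ of the ray transform $I^0f(x,\xi)=\int_{-\infty}^\infty f(x+t\xi)\,dt$ ($\xi\in\mathbb{S}^{n-1}$, $\langle x,\xi\rangle=0$), where $((I^0)^*g)(x)=\int_{\mathbb{S}^{n-1}}g(x-\langle x,\xi\rangle\xi,\xi)\,dS_\xi$. Explicitly $N^0f=2f*|\cdot|^{1-n}$, and this formula is used to extend $N^0$ to the class of $f$ in the claim. *)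

theory Defs
  imports "HOL-Analysis.Analysis"
begin

definition pderiv_coord :: "'n::finite \<Rightarrow> (real^'n \<Rightarrow> complex) \<Rightarrow> real^'n \<Rightarrow> complex" where
  "pderiv_coord i \<phi> x = frechet_derivative \<phi> (at x) (axis i 1)"

text \<open>A list of coordinates plays the role of a multi-index; its length is the order.\<close>

definition pderivs :: "'n::finite list \<Rightarrow> (real^'n \<Rightarrow> complex) \<Rightarrow> real^'n \<Rightarrow> complex" where
  "pderivs \<alpha> \<phi> = foldr pderiv_coord \<alpha> \<phi>"

definition smooth :: "(real^'n::finite \<Rightarrow> complex) \<Rightarrow> bool" where
  "smooth \<phi> \<longleftrightarrow> (\<forall>\<alpha> x. pderivs \<alpha> \<phi> differentiable (at x))"

definition fun_support :: "(real^'n::finite \<Rightarrow> complex) \<Rightarrow> (real^'n) set" where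
  "fun_support \<phi> = closure {x. \<phi> x \<noteq> 0}"

definition test_function :: "(real^'n::finite \<Rightarrow> complex) \<Rightarrow> bool" where
  "test_function \<phi> \<longleftrightarrow> smooth \<phi> \<and> compact (fun_support \<phi>)"

definition schwartz :: "(real^'n::finite \<Rightarrow> complex) \<Rightarrow> bool" where
  "schwartz \<phi> \<longleftrightarrow> smooth \<phi> \<and>
     (\<forall>(k::nat) \<alpha>. bounded (range (\<lambda>x. (1 + norm x) ^ k * norm (pderivs \<alpha> \<phi> x))))"

text \<open>Distributions are represented by functionals on all complex functions on the space;
  only their values on the relevant class of functions (test functions for distributions,
  Schwartz functions for tempered distributions) carry information.\<close>

definition linear_functional_on ::
    "((real^'n::finite \<Rightarrow> complex) \<Rightarrow> bool) \<Rightarrow> ((real^'n \<Rightarrow> complex) \<Rightarrow> complex) \<Rightarrow> bool" where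
  "linear_functional_on P u \<longleftrightarrow>
     (\<forall>\<phi> \<psi> a b. P \<phi> \<longrightarrow> P \<psi> \<longrightarrow> u (\<lambda>x. a * \<phi> x + b * \<psi> x) = a * u \<phi> + b * u \<psi>)"

definition distribution :: "((real^'n::finite \<Rightarrow> complex) \<Rightarrow> complex) \<Rightarrow> bool" where
  "distribution u \<longleftrightarrow> linear_functional_on test_function u \<and>
     (\<forall>K. compact K \<longrightarrow> (\<exists>(C::real) (N::nat). \<forall>\<phi>. test_function \<phi> \<longrightarrow> fun_support \<phi> \<subseteq> K \<longrightarrow>
        norm (u \<phi>) \<le> C * (\<Sum>\<alpha> | length \<alpha> \<le> N. SUP x. norm (pderivs \<alpha> \<phi> x))))"

definition tempered_distribution :: "((real^'n::finite \<Rightarrow> complex) \<Rightarrow> complex) \<Rightarrow> bool" where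
  "tempered_distribution u \<longleftrightarrow> linear_functional_on schwartz u \<and>
     (\<exists>(C::real) (N::nat). \<forall>\<phi>. schwartz \<phi> \<longrightarrow>
        norm (u \<phi>) \<le> C * (\<Sum>\<alpha> | length \<alpha> \<le> N. SUP x. (1 + norm x) ^ N * norm (pderivs \<alpha> \<phi> x)))"

definition dist_zero_on ::
    "((real^'n::finite \<Rightarrow> complex) \<Rightarrow> complex) \<Rightarrow> (real^'n) set \<Rightarrow> bool" where
  "dist_zero_on u V \<longleftrightarrow> (\<forall>\<phi>. test_function \<phi> \<longrightarrow> fun_support \<phi> \<subseteq> V \<longrightarrow> u \<phi> = 0)"

definition dist_support :: "((real^'n::finite \<Rightarrow> complex) \<Rightarrow> complex) \<Rightarrow> (real^'n) set" where
  "dist_support u = - \<Union>{V. open V \<and> dist_zero_on u V}"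

definition compactly_supported_distribution ::
    "((real^'n::finite \<Rightarrow> complex) \<Rightarrow> complex) \<Rightarrow> bool" where
  "compactly_supported_distribution u \<longleftrightarrow> distribution u \<and> compact (dist_support u)"

text \<open>The canonical extension of a compactly supported distribution to all smooth functions:
  multiply by a test function that is 1 near the support. The value at a smooth function does
  not depend on the cutoff.\<close>

definition cutoff_for :: "(real^'n::finite) set \<Rightarrow> (real^'n \<Rightarrow> complex) \<Rightarrow> bool" where
  "cutoff_for K \<eta> \<longleftrightarrow> test_function \<eta> \<and> (\<exists>V. open V \<and> K \<subseteq> V \<and> (\<forall>x\<in>V. \<eta> x = 1))"

definition dist_extend ::
    "((real^'n::finite \<Rightarrow> complex) \<Rightarrow> complex) \<Rightarrow> (real^'n \<Rightarrow> complex) \<Rightarrow> complex" where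
  "dist_extend u \<psi> = u (\<lambda>x. (SOME \<eta>. cutoff_for (dist_support u) \<eta>) x * \<psi> x)"

definition dist_of_fun ::
    "(real^'n::finite \<Rightarrow> complex) \<Rightarrow> (real^'n \<Rightarrow> complex) \<Rightarrow> complex" where
  "dist_of_fun h \<phi> = (LINT x|lebesgue. h x * \<phi> x)"

definition locally_integrable :: "(real^'n::finite \<Rightarrow> complex) \<Rightarrow> bool" where
  "locally_integrable h \<longleftrightarrow> (\<forall>K. compact K \<longrightarrow> set_integrable lebesgue K h)"

text \<open>Restriction to a set that is merely measurable makes sense only for a distribution
  given by a function, which is then unique up to null sets.\<close>

definition dist_ae_zero_on ::
    "((real^'n::finite \<Rightarrow> complex) \<Rightarrow> complex) \<Rightarrow> (real^'n) set \<Rightarrow> bool" where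
  "dist_ae_zero_on u E \<longleftrightarrow> (\<exists>h. locally_integrable h \<and>
     (\<forall>\<phi>. test_function \<phi> \<longrightarrow> u \<phi> = dist_of_fun h \<phi>) \<and>
     (AE x in lebesgue. x \<in> E \<longrightarrow> h x = 0))"

definition in_Lp :: "real \<Rightarrow> (real^'n::finite \<Rightarrow> complex) \<Rightarrow> bool" where
  "in_Lp p f \<longleftrightarrow> f \<in> borel_measurable lebesgue \<and> integrable lebesgue (\<lambda>x. norm (f x) powr p)"

definition fourier :: "(real^'n::finite \<Rightarrow> complex) \<Rightarrow> real^'n \<Rightarrow> complex" where
  "fourier \<phi> \<xi> = (LINT x|lebesgue. cis (- (x \<bullet> \<xi>)) * \<phi> x)"

definition dist_fourier ::
    "((real^'n::finite \<Rightarrow> complex) \<Rightarrow> complex) \<Rightarrow> (real^'n \<Rightarrow> complex) \<Rightarrow> complex" where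
  "dist_fourier u \<phi> = u (fourier \<phi>)"

definition in_Hs :: "real \<Rightarrow> ((real^'n::finite \<Rightarrow> complex) \<Rightarrow> complex) \<Rightarrow> bool" where
  "in_Hs s u \<longleftrightarrow> tempered_distribution u \<and>
     (\<exists>v. v \<in> borel_measurable lebesgue \<and>
        (\<forall>\<phi>. schwartz \<phi> \<longrightarrow> dist_fourier u \<phi> = dist_of_fun v \<phi>) \<and>
        in_Lp 2 (\<lambda>\<xi>. complex_of_real ((1 + (norm \<xi>)\<^sup>2) powr (s / 2)) * v \<xi>))"

definition convol ::
    "(real^'n::finite \<Rightarrow> complex) \<Rightarrow> (real^'n \<Rightarrow> complex) \<Rightarrow> real^'n \<Rightarrow> complex" where
  "convol f g x = (LINT y|lebesgue. f y * g (x - y))"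

definition ray_kernel :: "real^'n::finite \<Rightarrow> complex" where
  "ray_kernel x = complex_of_real (norm x powr (1 - real CARD('n)))"

text \<open>Polar coordinates turn the composition of the ray transform with its adjoint into
  convolution with twice the kernel. The integral converges absolutely almost everywhere
  if \<open>f\<close> is in \<open>L\<^sup>p\<close> and \<open>1 \<le> p < n\<close>.\<close>

definition normal_op :: "(real^'n::finite \<Rightarrow> complex) \<Rightarrow> real^'n \<Rightarrow> complex" where
  "normal_op f x = 2 * convol f ray_kernel x"

text \<open>The same convolution for a compactly supported distribution; the kernel is even, so it
  needs no reflection when moved to the other side of the pairing. The convolution of the
  kernel with a Schwartz function is smooth.\<close>

definition normal_op_dist ::
    "((real^'n::finite \<Rightarrow> complex) \<Rightarrow> complex) \<Rightarrow> (real^'n \<Rightarrow> complex) \<Rightarrow> complex" where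
  "normal_op_dist u \<phi> = 2 * dist_extend u (convol \<phi> ray_kernel)"

end

theory Submission imports Defs begin

text \<open>The proof is local: it looks at a single point at which \<open>N\<^sup>0f\<close> vanishes to infinite order.

  Choose a ball \<open>B\<close> inside \<open>U\<close> that meets \<open>E\<close> in positive measure and stays away from the
  complement of \<open>U\<close>. As \<open>f\<close> vanishes near \<open>B\<close>, the value of \<open>N\<^sup>0f\<close> at \<open>x \<in> B\<close> is the pairing of
  \<open>2 f\<close> with the translate by \<open>x\<close> of the kernel \<open>|w| powr (1 - n)\<close>, whose singularity is harmless
  here. So \<open>N\<^sup>0f\<close> is smooth on \<open>B\<close>, and its derivatives are the pairings with the derivatives of the
  kernel.

  A smooth function that vanishes almost everywhere on a set has first derivatives that vanish
  almost everywhere on that set (\<open>null_zeros_with_nonzero_derivative\<close>), hence so do the derivatives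
  of every order. Positive measure of \<open>E \<inter> B\<close> yields one point \<open>x\<^sub>0\<close> at which they all vanish.

  The derivatives of the kernel span the functions \<open>|w| powr (1 - n)\<close> times a polynomial in the
  inverted variable \<open>z = w / |w|\<^sup>2\<close> (\<open>kern_functionals_vanish\<close> contains the computation). So the
  infinite order of vanishing at \<open>x\<^sub>0\<close> says that \<open>f\<close>, transplanted by inversion about \<open>x\<^sub>0\<close> and
  weighted by a power of the norm, annihilates all polynomials. Because \<open>f\<close> vanishes near \<open>x\<^sub>0\<close>, its
  transplant lives on a bounded set, where polynomials are dense: in the continuous functions by the
  Stone--Weierstrass theorem, which settles \<open>f\<close> in \<open>L\<^sup>p\<close> (\<open>AE_zero_if_moments_zero\<close>), and together
  with all derivatives in the test functions, which settles distributions
  (\<open>distribution_zero_if_moments_zero\<close>). Hence \<open>f = 0\<close>.\<close>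

section \<open>Smooth functions on open sets\<close>

definition smooth_on :: "(real^'n::finite) set \<Rightarrow> (real^'n \<Rightarrow> complex) \<Rightarrow> bool" where
  "smooth_on S \<phi> \<longleftrightarrow> (\<forall>\<alpha>. \<forall>x\<in>S. pderivs \<alpha> \<phi> differentiable (at x))"

lemma smooth_iff_smooth_on: "smooth \<phi> \<longleftrightarrow> smooth_on UNIV \<phi>"
  by (auto simp: smooth_def smooth_on_def)

lemma pderivs_Nil [simp]: "pderivs [] \<phi> = \<phi>"
  by (simp add: pderivs_def)

lemma pderivs_Cons: "pderivs (i # \<alpha>) \<phi> = pderiv_coord i (pderivs \<alpha> \<phi>)"
  by (simp add: pderivs_def)

lemma pderivs_append: "pderivs (\<alpha> @ \<beta>) \<phi> = pderivs \<alpha> (pderivs \<beta> \<phi>)"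
  by (simp add: pderivs_def)

lemma pderivs_snoc: "pderivs (\<alpha> @ [i]) \<phi> = pderivs \<alpha> (pderiv_coord i \<phi>)"
  by (simp add: pderivs_def)

lemma smooth_on_subset: "smooth_on T \<phi> \<Longrightarrow> S \<subseteq> T \<Longrightarrow> smooth_on S \<phi>"
  by (auto simp: smooth_on_def)

lemma smooth_on_pderivs: "smooth_on S \<phi> \<Longrightarrow> smooth_on S (pderivs \<beta> \<phi>)"
  unfolding smooth_on_def by (metis pderivs_append)

lemma smooth_on_pderiv_coord: "smooth_on S \<phi> \<Longrightarrow> smooth_on S (pderiv_coord i \<phi>)"
  using smooth_on_pderivs[of S \<phi> "[i]"] by (simp add: pderivs_Cons)

lemma smooth_on_differentiable: "smooth_on S \<phi> \<Longrightarrow> x \<in> S \<Longrightarrow> \<phi> differentiable (at x)"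
  unfolding smooth_on_def by (metis pderivs_Nil)

lemma smooth_on_continuous: "smooth_on S \<phi> \<Longrightarrow> continuous_on S \<phi>"
  by (meson continuous_at_imp_continuous_on differentiable_imp_continuous_within smooth_on_differentiable)

lemma smooth_on_continuous_pderivs: "smooth_on S \<phi> \<Longrightarrow> continuous_on S (pderivs \<alpha> \<phi>)"
  by (rule smooth_on_continuous[OF smooth_on_pderivs])

lemma pderiv_coord_eq: "(\<phi> has_derivative D) (at x) \<Longrightarrow> pderiv_coord i \<phi> x = D (axis i 1)"
  unfolding pderiv_coord_def by (metis frechet_derivative_at)

lemma frechet_derivative_cong:
  assumes "open S" "x \<in> S" "\<And>y. y \<in> S \<Longrightarrow> \<phi> y = \<psi> y"
  shows "frechet_derivative \<phi> (at x) = frechet_derivative \<psi> (at x)"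
proof -
  have "(\<phi> has_derivative D) (at x) \<longleftrightarrow> (\<psi> has_derivative D) (at x)" for D
    using assms has_derivative_transform_within_open[of \<phi> D x UNIV S \<psi>]
      has_derivative_transform_within_open[of \<psi> D x UNIV S \<phi>] by auto
  then show ?thesis unfolding frechet_derivative_def by simp
qed

lemma pderivs_cong:
  assumes "open S" "x \<in> S" "\<And>y. y \<in> S \<Longrightarrow> \<phi> y = \<psi> y"
  shows "pderivs \<alpha> \<phi> x = pderivs \<alpha> \<psi> x"
  using assms(2)
proof (induction \<alpha> arbitrary: x)
  case Nil
  then show ?case using assms(3) by simp
next
  case (Cons i \<alpha>)
  have "frechet_derivative (pderivs \<alpha> \<phi>) (at x) = frechet_derivative (pderivs \<alpha> \<psi>) (at x)"
    by (rule frechet_derivative_cong[OF assms(1) Cons.prems Cons.IH])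
  then show ?case by (simp add: pderivs_Cons pderiv_coord_def)
qed

lemma pderiv_coord_cong:
  assumes "open S" "x \<in> S" "\<And>y. y \<in> S \<Longrightarrow> \<phi> y = \<psi> y"
  shows "pderiv_coord i \<phi> x = pderiv_coord i \<psi> x"
  using pderivs_cong[OF assms, where \<alpha>="[i]"] by (simp add: pderivs_Cons)

lemma differentiable_cong_open:
  assumes "open S" "x \<in> S" "\<And>y. y \<in> S \<Longrightarrow> \<phi> y = \<psi> y" "\<psi> differentiable (at x)"
  shows "\<phi> differentiable (at x)"
  using assms has_derivative_transform_within_open[of \<psi> _ x UNIV S \<phi>]
  unfolding differentiable_def by auto

lemma smooth_on_cong:
  assumes "open S" "\<And>y. y \<in> S \<Longrightarrow> \<phi> y = \<psi> y" "smooth_on S \<psi>"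
  shows "smooth_on S \<phi>"
  unfolding smooth_on_def
proof (intro allI ballI)
  fix \<alpha> x assume x: "x \<in> S"
  show "pderivs \<alpha> \<phi> differentiable (at x)"
  proof (rule differentiable_cong_open[OF assms(1) x])
    show "pderivs \<alpha> \<phi> y = pderivs \<alpha> \<psi> y" if "y \<in> S" for y
      by (rule pderivs_cong[OF assms(1) that assms(2)])
    show "pderivs \<alpha> \<psi> differentiable (at x)" using assms(3) x by (simp add: smooth_on_def)
  qed
qed

lemma smooth_on_Un: "smooth_on S \<phi> \<Longrightarrow> smooth_on T \<phi> \<Longrightarrow> smooth_on (S \<union> T) \<phi>"
  by (auto simp: smooth_on_def)

lemma has_derivative_pderivs:
  assumes "\<phi> differentiable (at x)"
  shows "(\<phi> has_derivative (\<lambda>v. \<Sum>i\<in>UNIV. of_real (v $ i) * pderiv_coord i \<phi> x)) (at x)"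
proof -
  obtain D where D: "(\<phi> has_derivative D) (at x)" using assms unfolding differentiable_def by auto
  interpret D: linear D using D has_derivative_linear by blast
  have "D v = (\<Sum>i\<in>UNIV. of_real (v $ i) * pderiv_coord i \<phi> x)" for v
  proof -
    have "v = (\<Sum>i\<in>UNIV. v $ i *\<^sub>R axis i 1)"
      using basis_expansion[of v] by (simp add: scalar_mult_eq_scaleR)
    then have "D v = D (\<Sum>i\<in>UNIV. v $ i *\<^sub>R axis i 1)" by simp
    also have "\<dots> = (\<Sum>i\<in>UNIV. of_real (v $ i) * pderiv_coord i \<phi> x)"
      unfolding D.sum D.scaleR pderiv_coord_eq[OF D] by (simp only: scaleR_conv_of_real)
    finally show ?thesis .
  qed
  then have "D = (\<lambda>v. \<Sum>i\<in>UNIV. of_real (v $ i) * pderiv_coord i \<phi> x)" by (rule ext)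
  then show ?thesis using D by simp
qed

text \<open>By induction on the order every iterated derivative coincides on \<open>S\<close> with a member of the family.
  This replaces explicit formulas for iterated derivatives in all closure properties.\<close>

lemma smooth_on_family:
  assumes S: "open S"
    and diff: "\<And>g x. g \<in> F \<Longrightarrow> x \<in> S \<Longrightarrow> g differentiable (at x)"
    and closed: "\<And>g i. g \<in> F \<Longrightarrow> \<exists>g'\<in>F. \<forall>x\<in>S. pderiv_coord i g x = g' x"
    and g: "g \<in> F"
  shows "smooth_on S g"
proof -
  have ex: "\<exists>g'\<in>F. \<forall>x\<in>S. pderivs \<alpha> g x = g' x" for \<alpha>
  proof (induction \<alpha>)
    case (Cons i \<alpha>)
    then obtain h where h: "h \<in> F" "\<forall>x\<in>S. pderivs \<alpha> g x = h x" by auto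
    obtain h' where h': "h' \<in> F" "\<forall>x\<in>S. pderiv_coord i h x = h' x" using closed[OF h(1)] by blast
    have "\<forall>x\<in>S. pderivs (i # \<alpha>) g x = h' x"
      using h' h(2) pderiv_coord_cong[OF S, of _ "pderivs \<alpha> g" h i] by (auto simp: pderivs_Cons)
    then show ?case using h' by blast
  qed (use g in auto)
  show ?thesis unfolding smooth_on_def
  proof (intro allI ballI)
    fix \<alpha> x assume "x \<in> S"
    moreover obtain h where "h \<in> F" "\<forall>x\<in>S. pderivs \<alpha> g x = h x" using ex by blast
    ultimately show "pderivs \<alpha> g differentiable (at x)"
      using diff differentiable_cong_open[OF S] by metis
  qed
qed

inductive_set algebra_gen :: "('a \<Rightarrow> complex) set \<Rightarrow> ('a \<Rightarrow> complex) set" for G where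
  gen: "g \<in> G \<Longrightarrow> g \<in> algebra_gen G"
| const: "(\<lambda>x. c) \<in> algebra_gen G"
| add: "f \<in> algebra_gen G \<Longrightarrow> g \<in> algebra_gen G \<Longrightarrow> (\<lambda>x. f x + g x) \<in> algebra_gen G"
| mult: "f \<in> algebra_gen G \<Longrightarrow> g \<in> algebra_gen G \<Longrightarrow> (\<lambda>x. f x * g x) \<in> algebra_gen G"

lemma algebra_gen_mono:
  assumes "G \<subseteq> H" "f \<in> algebra_gen G" shows "f \<in> algebra_gen H"
  using assms(2)
proof induction
  case (gen g)
  then show ?case using assms(1) algebra_gen.gen by blast
qed (rule algebra_gen.const algebra_gen.add algebra_gen.mult; assumption)+

lemma algebra_gen_sum:
  "finite I \<Longrightarrow> (\<And>i. i \<in> I \<Longrightarrow> f i \<in> algebra_gen G) \<Longrightarrow> (\<lambda>x. \<Sum>i\<in>I. f i x) \<in> algebra_gen G"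
  by (induction I rule: finite_induct) (auto intro!: algebra_gen.const algebra_gen.add)

lemma pderiv_coord_const: "pderiv_coord i (\<lambda>x. c) x = 0"
  by (subst pderiv_coord_eq[where D = "\<lambda>_. 0"]) auto

lemma pderiv_coord_add:
  assumes "f differentiable (at x)" "g differentiable (at x)"
  shows "pderiv_coord i (\<lambda>x. f x + g x) x = pderiv_coord i f x + pderiv_coord i g x"
proof -
  obtain D D' where D: "(f has_derivative D) (at x)" "(g has_derivative D') (at x)"
    using assms unfolding differentiable_def by auto
  show ?thesis using pderiv_coord_eq[OF has_derivative_add[OF D]] D by (simp add: pderiv_coord_eq)
qed

lemma pderiv_coord_mult:
  fixes f g :: "real^'n::finite \<Rightarrow> complex"
  assumes "f differentiable (at x)" "g differentiable (at x)"
  shows "pderiv_coord i (\<lambda>x. f x * g x) x = pderiv_coord i f x * g x + f x * pderiv_coord i g x"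
proof -
  obtain D D' where D: "(f has_derivative D) (at x)" "(g has_derivative D') (at x)"
    using assms unfolding differentiable_def by auto
  show ?thesis using pderiv_coord_eq[OF has_derivative_mult[OF D]] D by (simp add: pderiv_coord_eq)
qed

text \<open>By the sum and product rules it is enough to differentiate the generators. The closure properties
  of smooth functions and the smoothness of the concrete functions below are all instances.\<close>

lemma algebra_gen_smooth_on:
  fixes G :: "(real^'n::finite \<Rightarrow> complex) set"
  assumes S: "open S"
    and diff: "\<And>g x. g \<in> G \<Longrightarrow> x \<in> S \<Longrightarrow> g differentiable (at x)"
    and closed: "\<And>g i. g \<in> G \<Longrightarrow> \<exists>g'\<in>algebra_gen G. \<forall>x\<in>S. pderiv_coord i g x = g' x"
    and g: "g \<in> algebra_gen G"
  shows "smooth_on S g"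
proof -
  have 1: "\<forall>x\<in>S. g differentiable (at x)" if "g \<in> algebra_gen G" for g
    using that by (induction) (use diff in \<open>auto intro: differentiable_add differentiable_mult\<close>)
  have 2: "\<exists>g'\<in>algebra_gen G. \<forall>x\<in>S. pderiv_coord i g x = g' x" if "g \<in> algebra_gen G" for g i
    using that
  proof (induction)
    case (const c)
    then show ?case by (intro bexI[of _ "\<lambda>x. 0"]) (auto simp: pderiv_coord_const algebra_gen.const)
  next
    case (add f g)
    then obtain f' g' where "f' \<in> algebra_gen G" "g' \<in> algebra_gen G"
      "\<forall>x\<in>S. pderiv_coord i f x = f' x" "\<forall>x\<in>S. pderiv_coord i g x = g' x" by auto
    then show ?case using add 1
      by (intro bexI[of _ "\<lambda>x. f' x + g' x"]) (auto simp: pderiv_coord_add algebra_gen.add)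
  next
    case (mult f g)
    then obtain f' g' where "f' \<in> algebra_gen G" "g' \<in> algebra_gen G"
      "\<forall>x\<in>S. pderiv_coord i f x = f' x" "\<forall>x\<in>S. pderiv_coord i g x = g' x" by auto
    then show ?case using mult 1
      by (intro bexI[of _ "\<lambda>x. f' x * g x + f x * g' x"])
        (auto simp: pderiv_coord_mult intro!: algebra_gen.add algebra_gen.mult)
  qed (use closed in auto)
  show ?thesis by (rule smooth_on_family[OF S _ _ g]) (use 1 2 in auto)
qed

text \<open>The iterated derivatives of the generators generate an algebra that is closed under
  differentiation.\<close>

lemma smooth_on_algebra_gen:
  fixes G :: "(real^'n::finite \<Rightarrow> complex) set"
  assumes "open S" "\<And>g. g \<in> G \<Longrightarrow> smooth_on S g" "f \<in> algebra_gen G"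
  shows "smooth_on S f"
proof -
  define H where "H = {pderivs \<alpha> g | \<alpha> g. g \<in> G}"
  have "G \<subseteq> H"
  proof
    fix g assume "g \<in> G"
    moreover have "g = pderivs [] g" by simp
    ultimately show "g \<in> H" unfolding H_def by blast
  qed
  then have "f \<in> algebra_gen H" using assms(3) by (rule algebra_gen_mono)
  then show ?thesis
  proof (rule algebra_gen_smooth_on[OF assms(1), rotated 2])
    show "g differentiable (at x)" if "g \<in> H" "x \<in> S" for g x
      using that assms(2) unfolding H_def smooth_on_def by auto
    show "\<exists>g'\<in>algebra_gen H. \<forall>x\<in>S. pderiv_coord i g x = g' x" if gH: "g \<in> H" for g i
    proof -
      obtain \<alpha> g0 where "g = pderivs \<alpha> g0" "g0 \<in> G" using gH unfolding H_def by auto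
      then have "pderiv_coord i g \<in> H" unfolding H_def using pderivs_Cons[of i \<alpha> g0]
        by (metis (mono_tags, lifting) mem_Collect_eq)
      then show ?thesis using algebra_gen.gen by blast
    qed
  qed
qed

lemma smooth_on_const: "open S \<Longrightarrow> smooth_on S (\<lambda>x. c)"
  by (rule smooth_on_algebra_gen[where G = "{}"]) (auto intro!: algebra_gen.const)

lemma smooth_on_add: "open S \<Longrightarrow> smooth_on S f \<Longrightarrow> smooth_on S g \<Longrightarrow> smooth_on S (\<lambda>x. f x + g x)"
  by (rule smooth_on_algebra_gen[where G = "{f, g}"])
     (auto intro: algebra_gen.add[OF algebra_gen.gen algebra_gen.gen, of f "{f, g}" g, simplified])

lemma smooth_on_mult: "open S \<Longrightarrow> smooth_on S f \<Longrightarrow> smooth_on S g \<Longrightarrow> smooth_on S (\<lambda>x. f x * g x)"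
  by (rule smooth_on_algebra_gen[where G = "{f, g}"])
     (auto intro: algebra_gen.mult[OF algebra_gen.gen algebra_gen.gen, of f "{f, g}" g, simplified])

lemma smooth_on_sum:
  "open S \<Longrightarrow> finite I \<Longrightarrow> (\<And>i. i \<in> I \<Longrightarrow> smooth_on S (f i)) \<Longrightarrow> smooth_on S (\<lambda>x. \<Sum>i\<in>I. f i x)"
  by (rule smooth_on_algebra_gen[where G = "f ` I"])
     (auto intro!: algebra_gen_sum intro: algebra_gen.gen)

lemma pderivs_add:
  assumes "open S" "smooth_on S f" "smooth_on S g" "x \<in> S"
  shows "pderivs \<alpha> (\<lambda>x. f x + g x) x = pderivs \<alpha> f x + pderivs \<alpha> g x"
  using assms(4)
proof (induction \<alpha> arbitrary: x)
  case (Cons i \<alpha>)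
  have "pderivs (i # \<alpha>) (\<lambda>x. f x + g x) x = pderiv_coord i (\<lambda>x. pderivs \<alpha> f x + pderivs \<alpha> g x) x"
    unfolding pderivs_Cons by (rule pderiv_coord_cong[OF assms(1) Cons.prems]) (rule Cons.IH)
  also have "\<dots> = pderivs (i # \<alpha>) f x + pderivs (i # \<alpha>) g x"
    unfolding pderivs_Cons using assms(2,3) Cons.prems
    by (intro pderiv_coord_add) (auto simp: smooth_on_def)
  finally show ?case .
qed simp

lemma pderivs_cmult:
  assumes "open S" "smooth_on S f" "x \<in> S"
  shows "pderivs \<alpha> (\<lambda>x. c * f x) x = c * pderivs \<alpha> f x"
  using assms(3)
proof (induction \<alpha> arbitrary: x)
  case (Cons i \<alpha>)
  have "pderivs (i # \<alpha>) (\<lambda>x. c * f x) x = pderiv_coord i (\<lambda>x. c * pderivs \<alpha> f x) x"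
    unfolding pderivs_Cons by (rule pderiv_coord_cong[OF assms(1) Cons.prems]) (rule Cons.IH)
  also have "\<dots> = c * pderivs (i # \<alpha>) f x"
    unfolding pderivs_Cons using assms(2) Cons.prems
    by (subst pderiv_coord_mult) (auto simp: smooth_on_def pderiv_coord_const)
  finally show ?case .
qed simp

lemma pderivs_diff:
  assumes "open S" "smooth_on S f" "smooth_on S g" "x \<in> S"
  shows "pderivs \<alpha> (\<lambda>x. f x - g x) x = pderivs \<alpha> f x - pderivs \<alpha> g x"
  using pderivs_add[OF assms(1,2) smooth_on_mult[OF assms(1) smooth_on_const[OF assms(1), of "-1"] assms(3)] assms(4)]
    pderivs_cmult[OF assms(1,3,4), of \<alpha> "-1"] by simp

lemma frechet_derivative_shift:
  "frechet_derivative (\<lambda>x. \<phi> (x - a)) (at x) = frechet_derivative \<phi> (at (x - a))"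
proof -
  have "((\<lambda>x. \<phi> (x - a)) has_derivative D) (at x) \<longleftrightarrow> (\<phi> has_derivative D) (at (x - a))" for D
  proof
    assume "((\<lambda>x. \<phi> (x - a)) has_derivative D) (at x)"
    then have A: "((\<lambda>x. \<phi> (x - a)) has_derivative D) (at ((\<lambda>z. z + a) (x - a)))" by simp
    have "((\<lambda>z. z + a) has_derivative (\<lambda>z. z)) (at (x - a))" by (auto intro!: derivative_eq_intros)
    from diff_chain_at[OF this A] show "(\<phi> has_derivative D) (at (x - a))" by (simp add: o_def)
  next
    assume "(\<phi> has_derivative D) (at (x - a))"
    then have A: "(\<phi> has_derivative D) (at ((\<lambda>z. z - a) x))" by simp
    have "((\<lambda>z. z - a) has_derivative (\<lambda>z. z)) (at x)" by (auto intro!: derivative_eq_intros)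
    from diff_chain_at[OF this A] show "((\<lambda>x. \<phi> (x - a)) has_derivative D) (at x)" by (simp add: o_def)
  qed
  then show ?thesis unfolding frechet_derivative_def by simp
qed

lemma pderivs_shift: "pderivs \<alpha> (\<lambda>x. \<phi> (x - a)) = (\<lambda>x. pderivs \<alpha> \<phi> (x - a))"
  by (induction \<alpha>) (auto simp: pderivs_Cons pderiv_coord_def frechet_derivative_shift)

lemma smooth_on_shift: "smooth_on S \<phi> \<Longrightarrow> smooth_on ((+) a ` S) (\<lambda>x. \<phi> (x - a))"
  unfolding smooth_on_def pderivs_shift
proof (intro allI ballI)
  fix \<alpha> x assume A: "\<forall>\<alpha>. \<forall>x\<in>S. pderivs \<alpha> \<phi> differentiable at x" "x \<in> (+) a ` S"
  then have "pderivs \<alpha> \<phi> differentiable at (x - a)" by auto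
  then show "(\<lambda>x. pderivs \<alpha> \<phi> (x - a)) differentiable at x"
    using differentiable_chain_at[of "\<lambda>x. x - a" x "pderivs \<alpha> \<phi>"]
    by (auto simp: o_def intro!: derivative_intros)
qed

lemma bounded_linear_nth_complex: "bounded_linear (\<lambda>x::real^'n::finite. complex_of_real (x $ i))"
  by (rule bounded_linear_compose[OF bounded_linear_of_real bounded_linear_vec_nth])

lemma smooth_on_coord: "open S \<Longrightarrow> smooth_on S (\<lambda>x. complex_of_real (x $ i))"
proof (rule algebra_gen_smooth_on[where G = "{\<lambda>x. complex_of_real (x $ i)}"])
  show "\<exists>g'\<in>algebra_gen {\<lambda>x. complex_of_real (x $ i)}. \<forall>x\<in>S. pderiv_coord j g x = g' x"
    if "g \<in> {\<lambda>x. complex_of_real (x $ i)}" for g j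
    using that
    by (intro bexI[of _ "\<lambda>x. complex_of_real (axis j 1 $ i)"])
       (auto intro!: pderiv_coord_eq algebra_gen.const
         bounded_linear.has_derivative[OF bounded_linear_nth_complex, of "\<lambda>x. x" "\<lambda>x. x", simplified])
qed (auto intro: algebra_gen.gen bounded_linear_imp_differentiable bounded_linear_nth_complex)

text \<open>The chain rule in coordinates. The components of the inner map are complex valued, so that
  \<open>pderivs\<close> and \<open>smooth_on\<close> apply to them.\<close>

lemma pderiv_coord_compose:
  fixes h :: "real^'n::finite \<Rightarrow> real^'m::finite" and \<zeta> :: "real^'m \<Rightarrow> complex"
  assumes h: "\<And>k. (\<lambda>x. complex_of_real (h x $ k)) differentiable (at x)"
    and \<zeta>: "\<zeta> differentiable (at (h x))"
  shows "(\<lambda>x. \<zeta> (h x)) differentiable (at x)"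
    and "pderiv_coord i (\<lambda>x. \<zeta> (h x)) x
      = (\<Sum>k\<in>UNIV. pderiv_coord k \<zeta> (h x) * pderiv_coord i (\<lambda>x. complex_of_real (h x $ k)) x)"
proof -
  obtain D where D: "\<And>k. ((\<lambda>x. complex_of_real (h x $ k)) has_derivative D k) (at x)"
    using h unfolding differentiable_def by metis
  have "((\<lambda>x. h x $ k) has_derivative (\<lambda>v. Re (D k v))) (at x)" for k
    using bounded_linear.has_derivative[OF bounded_linear_Re D[of k]] by simp
  then have hd: "(h has_derivative (\<lambda>v. \<chi> k. Re (D k v))) (at x)"
    by (subst has_derivative_componentwise_within)
      (auto simp: Basis_vec_def inner_axis)
  have c: "((\<lambda>x. \<zeta> (h x)) has_derivative
     (\<lambda>v. \<Sum>k\<in>UNIV. of_real ((\<chi> k. Re (D k v)) $ k) * pderiv_coord k \<zeta> (h x))) (at x)"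
    using has_derivative_compose[OF hd has_derivative_pderivs[OF \<zeta>]] .
  then show "(\<lambda>x. \<zeta> (h x)) differentiable (at x)" unfolding differentiable_def by blast
  have "((\<lambda>x. complex_of_real (h x $ k)) has_derivative (\<lambda>v. of_real (Re (D k v)))) (at x)" for k
    using bounded_linear.has_derivative[OF bounded_linear_of_real
       bounded_linear.has_derivative[OF bounded_linear_Re D[of k]]] by simp
  then have "complex_of_real (Re (D k (axis i 1))) = pderiv_coord i (\<lambda>x. complex_of_real (h x $ k)) x" for k
    by (metis pderiv_coord_eq)
  then show "pderiv_coord i (\<lambda>x. \<zeta> (h x)) x
      = (\<Sum>k\<in>UNIV. pderiv_coord k \<zeta> (h x) * pderiv_coord i (\<lambda>x. complex_of_real (h x $ k)) x)"
    unfolding pderiv_coord_eq[OF c] by (simp add: mult.commute)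
qed

text \<open>By the chain rule the functions \<open>pderivs \<beta> \<zeta> \<circ> h\<close>, together with the derivatives of the components
  of \<open>h\<close>, generate an algebra that is closed under differentiation.\<close>

lemma smooth_on_compose:
  fixes h :: "real^'n::finite \<Rightarrow> real^'m::finite" and \<zeta> :: "real^'m \<Rightarrow> complex"
  assumes S: "open S" and h: "\<And>k. smooth_on S (\<lambda>x. complex_of_real (h x $ k))"
    and \<zeta>: "smooth_on T \<zeta>" and ST: "h ` S \<subseteq> T"
  shows "smooth_on S (\<lambda>x. \<zeta> (h x))"
proof -
  define A where "A = {\<lambda>x. pderivs \<beta> \<zeta> (h x) | \<beta>. True}"
  define B where "B = {pderivs \<beta> (\<lambda>x. complex_of_real (h x $ k)) | \<beta> k. True}"
  have 1: "(\<lambda>x. pderivs \<beta> \<zeta> (h x)) \<in> algebra_gen (A \<union> B)" for \<beta>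
    by (rule algebra_gen.gen) (auto simp: A_def)
  have 2: "pderivs \<beta> (\<lambda>x. complex_of_real (h x $ k)) \<in> algebra_gen (A \<union> B)" for \<beta> k
    by (rule algebra_gen.gen) (auto simp: B_def)
  have hd: "\<And>k x. x \<in> S \<Longrightarrow> (\<lambda>x. complex_of_real (h x $ k)) differentiable (at x)"
    using h smooth_on_differentiable by blast
  have cd: "\<And>\<beta> x. x \<in> S \<Longrightarrow> pderivs \<beta> \<zeta> differentiable (at (h x))"
    using \<zeta> ST unfolding smooth_on_def by auto
  show ?thesis
  proof (rule algebra_gen_smooth_on[OF S, of "A \<union> B"])
    show "g differentiable (at x)" if "g \<in> A \<union> B" "x \<in> S" for g x
      using that h pderiv_coord_compose(1)[OF hd cd] unfolding A_def B_def smooth_on_def by auto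
    show "\<exists>g'\<in>algebra_gen (A \<union> B). \<forall>x\<in>S. pderiv_coord i g x = g' x" if gAB: "g \<in> A \<union> B" for g i
    proof (cases "g \<in> B")
      case True
      then obtain \<beta> k where "g = pderivs \<beta> (\<lambda>x. complex_of_real (h x $ k))" unfolding B_def by auto
      then show ?thesis using 2[of "i # \<beta>" k] by (auto simp: pderivs_Cons)
    next
      case False
      then obtain \<beta> where g: "g = (\<lambda>x. pderivs \<beta> \<zeta> (h x))" using gAB unfolding A_def by auto
      show ?thesis
      proof (intro bexI ballI)
        show "pderiv_coord i g x = (\<Sum>k\<in>UNIV. pderivs (k # \<beta>) \<zeta> (h x)
           * pderivs [i] (\<lambda>x. complex_of_real (h x $ k)) x)" if "x \<in> S" for x
          unfolding g pderivs_Cons using pderiv_coord_compose(2)[OF hd[OF that] cd[OF that]] by simp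
        show "(\<lambda>x. \<Sum>k\<in>UNIV. pderivs (k # \<beta>) \<zeta> (h x)
           * pderivs [i] (\<lambda>x. complex_of_real (h x $ k)) x) \<in> algebra_gen (A \<union> B)"
          using 1 2 by (intro algebra_gen_sum algebra_gen.mult) auto
      qed
    qed
    show "(\<lambda>x. \<zeta> (h x)) \<in> algebra_gen (A \<union> B)" using 1[of "[]"] by simp
  qed
qed

lemma has_derivative_norm_powr:
  fixes x :: "real^'n::finite"
  assumes "x \<noteq> 0"
  shows "((\<lambda>x. complex_of_real (norm x powr a)) has_derivative
    (\<lambda>v. complex_of_real (a * norm x powr (a - 2) * (x \<bullet> v)))) (at x)"
proof -
  have nd: "(norm has_derivative (\<lambda>v. (x \<bullet> v) / norm x)) (at x)"
    using has_derivative_norm[OF assms] by (simp add: sgn_div_norm inner_commute divide_inverse_commute)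
  have e: "norm x powr (a - 1) / norm x = norm x powr (a - 2)"
    using assms by (simp add: powr_diff powr_numeral power2_eq_square)
  have "((\<lambda>z. z powr a) has_real_derivative a * norm x powr (a - 1)) (at (norm x))"
    using assms by (intro has_real_derivative_powr) auto
  then have "((\<lambda>z. z powr a) has_derivative (\<lambda>v. a * norm x powr (a - 1) * v)) (at (norm x))"
    by (simp add: has_field_derivative_def)
  from diff_chain_at[OF nd this]
  have "((\<lambda>x. norm x powr a) has_derivative (\<lambda>v. a * norm x powr (a - 1) * ((x \<bullet> v) / norm x))) (at x)"
    by (simp add: o_def)
  moreover have "(\<lambda>v. a * norm x powr (a - 1) * ((x \<bullet> v) / norm x)) = (\<lambda>v. a * norm x powr (a - 2) * (x \<bullet> v))"
    unfolding e[symmetric] by (simp add: field_simps)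
  ultimately have "((\<lambda>x. norm x powr a) has_derivative (\<lambda>v. a * norm x powr (a - 2) * (x \<bullet> v))) (at x)"
    by simp
  then show ?thesis by (rule bounded_linear.has_derivative[OF bounded_linear_of_real])
qed

lemma pderiv_coord_norm_powr:
  fixes x :: "real^'n::finite"
  assumes "x \<noteq> 0"
  shows "pderiv_coord i (\<lambda>x. complex_of_real (norm x powr a)) x
     = of_real a * of_real (norm x powr (a - 2)) * of_real (x $ i)"
  using pderiv_coord_eq[OF has_derivative_norm_powr[OF assms]] by (simp add: inner_axis)

text \<open>A derivative of a power of the norm is a multiple of another power times a coordinate, so that the
  powers with all exponents and the coordinates are treated simultaneously.\<close>

lemma smooth_on_norm_powr: "smooth_on (- {0}) (\<lambda>x::real^'n::finite. complex_of_real (norm x powr a))"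
proof -
  define G where "G = {\<lambda>x::real^'n. complex_of_real (norm x powr a) | a. True} \<union> {\<lambda>x. complex_of_real (x $ i) | i. True}"
  have n: "(\<lambda>x. complex_of_real (norm x powr a)) \<in> algebra_gen G" for a
    by (rule algebra_gen.gen) (auto simp: G_def)
  have c: "(\<lambda>x. complex_of_real (x $ i)) \<in> algebra_gen G" for i
    by (rule algebra_gen.gen) (auto simp: G_def)
  show ?thesis
  proof (rule algebra_gen_smooth_on[of _ G])
    show "g differentiable (at x)" if "g \<in> G" "x \<in> - {0}" for g x
      using that has_derivative_norm_powr[of x] bounded_linear_imp_differentiable[OF bounded_linear_nth_complex]
      unfolding G_def differentiable_def by auto
    show "\<exists>g'\<in>algebra_gen G. \<forall>x\<in>- {0}. pderiv_coord i g x = g' x" if g: "g \<in> G" for g i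
    proof (cases "g \<in> {\<lambda>x::real^'n. complex_of_real (norm x powr a) | a. True}")
      case True
      then obtain a where "g = (\<lambda>x. complex_of_real (norm x powr a))" by auto
      then show ?thesis
        by (intro bexI[of _ "\<lambda>x. of_real a * of_real (norm x powr (a - 2)) * of_real (x $ i)"])
           (auto simp: pderiv_coord_norm_powr intro!: algebra_gen.mult n c algebra_gen.const)
    next
      case False
      then obtain k where "g = (\<lambda>x. complex_of_real (x $ k))" using g G_def by auto
      then show ?thesis
        by (intro bexI[of _ "\<lambda>x. complex_of_real (axis i 1 $ k)"])
           (auto intro!: pderiv_coord_eq algebra_gen.const
            bounded_linear.has_derivative[OF bounded_linear_nth_complex, of "\<lambda>x. x" "\<lambda>x. x", simplified])
    qed
  qed (use n in auto)
qed

section \<open>Convergence of all derivatives up to a given order\<close>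

text \<open>For all \<open>N\<close> together, this is the convergence that distributions respect for functions supported in
  \<open>K\<close>. The set \<open>K\<close> may have empty
  interior; the derivatives are those of the functions on the whole space.\<close>

definition Ck_limit ::
    "nat \<Rightarrow> (real^'n::finite) set \<Rightarrow> ('b \<Rightarrow> real^'n \<Rightarrow> complex) \<Rightarrow> (real^'n \<Rightarrow> complex) \<Rightarrow> 'b filter \<Rightarrow> bool" where
  "Ck_limit N K f g F \<longleftrightarrow>
     (\<forall>\<alpha>. length \<alpha> \<le> N \<longrightarrow> uniform_limit K (\<lambda>m. pderivs \<alpha> (f m)) (pderivs \<alpha> g) F)"

text \<open>Splitting off the derivative that is applied first reduces the product and the chain rule for
  limits to the rules for a single derivative, by induction on \<open>N\<close>.\<close>

lemma Ck_limit_Suc: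
  "Ck_limit (Suc N) K f g F \<longleftrightarrow> uniform_limit K f g F \<and>
     (\<forall>i. Ck_limit N K (\<lambda>m. pderiv_coord i (f m)) (pderiv_coord i g) F)" (is "?L \<longleftrightarrow> ?R")
proof
  assume L: ?L
  have "uniform_limit K (\<lambda>m. pderivs \<alpha> (pderiv_coord i (f m))) (pderivs \<alpha> (pderiv_coord i g)) F"
    if "length \<alpha> \<le> N" for \<alpha> i
    using L that unfolding Ck_limit_def pderivs_snoc[symmetric] by simp
  moreover have "uniform_limit K (\<lambda>m. pderivs [] (f m)) (pderivs [] g) F"
    using L unfolding Ck_limit_def by (rule allE[of _ "[]"]) simp
  ultimately show ?R unfolding Ck_limit_def by simp
next
  assume R: ?R
  show ?L unfolding Ck_limit_def
  proof (intro allI impI)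
    fix \<alpha> :: "'a list" assume "length \<alpha> \<le> Suc N"
    then show "uniform_limit K (\<lambda>m. pderivs \<alpha> (f m)) (pderivs \<alpha> g) F"
      using R unfolding Ck_limit_def by (cases \<alpha> rule: rev_cases) (auto simp: pderivs_snoc)
  qed
qed

lemma Ck_limit_0: "Ck_limit 0 K f g F \<longleftrightarrow> uniform_limit K f g F"
  by (auto simp: Ck_limit_def)

lemma Ck_limit_imp_uniform: "Ck_limit N K f g F \<Longrightarrow> uniform_limit K f g F"
  unfolding Ck_limit_def by (drule spec[of _ "[]"]) simp

lemma Ck_limit_SucD: "Ck_limit (Suc N) K f g F \<Longrightarrow> Ck_limit N K f g F"
  by (auto simp: Ck_limit_def)

lemma Ck_limit_cong:
  assumes "open S" "K \<subseteq> S" "\<And>m x. x \<in> S \<Longrightarrow> f m x = f' m x" "\<And>x. x \<in> S \<Longrightarrow> g x = g' x"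
    "Ck_limit N K f' g' F"
  shows "Ck_limit N K f g F"
  unfolding Ck_limit_def
proof (intro allI impI)
  fix \<alpha> :: "'a list" assume "length \<alpha> \<le> N"
  then have "uniform_limit K (\<lambda>m. pderivs \<alpha> (f' m)) (pderivs \<alpha> g') F"
    using assms(5) by (auto simp: Ck_limit_def)
  moreover have "pderivs \<alpha> (f m) x = pderivs \<alpha> (f' m) x" "pderivs \<alpha> g x = pderivs \<alpha> g' x" if "x \<in> K" for m x
    using that assms(2) pderivs_cong[OF assms(1) _ assms(3)] pderivs_cong[OF assms(1) _ assms(4)] by auto
  ultimately show "uniform_limit K (\<lambda>m. pderivs \<alpha> (f m)) (pderivs \<alpha> g) F"
    by (subst uniform_limit_cong') auto
qed

lemma Ck_limit_const: "Ck_limit N K (\<lambda>m. g) g F"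
  by (auto simp: Ck_limit_def uniform_limit_const)

lemma Ck_limit_add:
  assumes "open S" "K \<subseteq> S" "\<And>m. smooth_on S (f m)" "\<And>m. smooth_on S (f' m)" "smooth_on S g" "smooth_on S g'"
    "Ck_limit N K f g F" "Ck_limit N K f' g' F"
  shows "Ck_limit N K (\<lambda>m x. f m x + f' m x) (\<lambda>x. g x + g' x) F"
  unfolding Ck_limit_def
proof (intro allI impI)
  fix \<alpha> :: "'a list" assume "length \<alpha> \<le> N"
  then have "uniform_limit K (\<lambda>m x. pderivs \<alpha> (f m) x + pderivs \<alpha> (f' m) x) (\<lambda>x. pderivs \<alpha> g x + pderivs \<alpha> g' x) F"
    using assms(7,8) by (auto simp: Ck_limit_def intro!: uniform_limit_add)
  then show "uniform_limit K (\<lambda>m. pderivs \<alpha> (\<lambda>x. f m x + f' m x)) (pderivs \<alpha> (\<lambda>x. g x + g' x)) F"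
    by (rule uniform_limit_cong'[THEN iffD1, rotated 2])
       (use assms in \<open>auto simp: pderivs_add[OF assms(1) _ _ subsetD[OF assms(2)]]\<close>)
qed

lemma Ck_limit_sum:
  assumes "open S" "K \<subseteq> S" "finite I" "\<And>i m. i \<in> I \<Longrightarrow> smooth_on S (f i m)" "\<And>i. i \<in> I \<Longrightarrow> smooth_on S (g i)"
    "\<And>i. i \<in> I \<Longrightarrow> Ck_limit N K (f i) (g i) F"
  shows "Ck_limit N K (\<lambda>m x. \<Sum>i\<in>I. f i m x) (\<lambda>x. \<Sum>i\<in>I. g i x) F"
  using assms(3-6)
proof (induction I rule: finite_induct)
  case (insert i I)
  have "Ck_limit N K (\<lambda>m x. f i m x + (\<Sum>i\<in>I. f i m x)) (\<lambda>x. g i x + (\<Sum>i\<in>I. g i x)) F"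
    by (intro Ck_limit_add[OF assms(1,2)] smooth_on_sum[OF assms(1) insert(1)] insert) (use insert in auto)
  then show ?case using insert(1,2) by simp
qed (auto simp: Ck_limit_const)

lemma Ck_limit_mult:
  fixes f f' :: "'b \<Rightarrow> real^'n::finite \<Rightarrow> complex"
  assumes "open S" "K \<subseteq> S" "compact K"
    and "\<And>m. smooth_on S (f m)" "\<And>m. smooth_on S (f' m)" "smooth_on S g" "smooth_on S g'"
    and "Ck_limit N K f g F" "Ck_limit N K f' g' F"
  shows "Ck_limit N K (\<lambda>m x. f m x * f' m x) (\<lambda>x. g x * g' x) F"
proof -
  have bounded: "bounded (g ` K)" if "smooth_on S g" for g :: "real^'n \<Rightarrow> complex"
    using that assms(2,3) compact_continuous_image compact_imp_bounded continuous_on_subset smooth_on_continuous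
    by metis
  have unif: "uniform_limit K (\<lambda>m x. f m x * f' m x) (\<lambda>x. g x * g' x) F"
    if "smooth_on S g" "smooth_on S g'" "uniform_limit K f g F" "uniform_limit K f' g' F"
    for f f' :: "'b \<Rightarrow> real^'n \<Rightarrow> complex" and g g'
    using that bounded by (intro uniform_lim_mult) auto
  show ?thesis using assms(4-9)
  proof (induction N arbitrary: f f' g g')
    case 0
    then show ?case using unif by (simp add: Ck_limit_0)
  next
    case (Suc N)
    note sm = Suc.prems(1-4) and lim = Suc.prems(5,6)
    have 1: "Ck_limit N K (\<lambda>m. pderiv_coord i (f m)) (pderiv_coord i g) F"
      "Ck_limit N K (\<lambda>m. pderiv_coord i (f' m)) (pderiv_coord i g') F" for i
      using lim by (auto simp: Ck_limit_Suc)
    have 2: "Ck_limit N K (\<lambda>m x. pderiv_coord i (f m) x * f' m x + f m x * pderiv_coord i (f' m) x)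
       (\<lambda>x. pderiv_coord i g x * g' x + g x * pderiv_coord i g' x) F" for i
      by (intro Ck_limit_add[OF assms(1,2)] Suc.IH smooth_on_mult[OF assms(1)] smooth_on_pderiv_coord sm 1
          lim[THEN Ck_limit_SucD])
    have "Ck_limit N K (\<lambda>m. pderiv_coord i (\<lambda>x. f m x * f' m x)) (pderiv_coord i (\<lambda>x. g x * g' x)) F" for i
      by (rule Ck_limit_cong[OF assms(1,2) _ _ 2[of i]])
         (intro pderiv_coord_mult smooth_on_differentiable[of S] sm, assumption+)+
    then show ?case
      unfolding Ck_limit_Suc using unif[OF sm(3,4) lim[THEN Ck_limit_imp_uniform]] by blast
  qed
qed

lemma Ck_limit_compose:
  fixes h :: "real^'n::finite \<Rightarrow> real^'m::finite" and f :: "'b \<Rightarrow> real^'m \<Rightarrow> complex"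
  assumes S: "open S" "K \<subseteq> S" "compact K" and h: "\<And>k. smooth_on S (\<lambda>x. complex_of_real (h x $ k))"
    and T: "h ` S \<subseteq> T" and L: "h ` K \<subseteq> L"
  shows "(\<And>m. smooth_on T (f m)) \<Longrightarrow> smooth_on T g \<Longrightarrow> Ck_limit N L f g F \<Longrightarrow>
    Ck_limit N K (\<lambda>m x. f m (h x)) (\<lambda>x. g (h x)) F"
proof (induction N arbitrary: f g)
  case 0
  then show ?case using L by (auto simp: Ck_limit_0 uniform_limit_iff elim!: all_forward eventually_mono)
next
  case (Suc N)
  have sm: "smooth_on T (f m)" "smooth_on T g" for m using Suc.prems by auto
  have hd: "(\<lambda>x. complex_of_real (h x $ k)) differentiable (at x)" if "x \<in> S" for k x
    using h smooth_on_differentiable that by blast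
  have cd: "f m differentiable (at (h x))" "g differentiable (at (h x))" if "x \<in> S" for m x
    using sm smooth_on_differentiable that T by blast+
  have 2: "Ck_limit N K (\<lambda>m x. \<Sum>k\<in>UNIV. pderiv_coord k (f m) (h x) * pderiv_coord i (\<lambda>x. complex_of_real (h x $ k)) x)
    (\<lambda>x. \<Sum>k\<in>UNIV. pderiv_coord k g (h x) * pderiv_coord i (\<lambda>x. complex_of_real (h x $ k)) x) F" for i
    using Suc.prems(3)
    by (intro Ck_limit_sum[OF S(1,2)] Ck_limit_mult[OF S] Suc.IH smooth_on_mult[OF S(1)] smooth_on_pderiv_coord h sm
         Ck_limit_const smooth_on_compose[OF S(1) h _ T]) (auto simp: Ck_limit_Suc)
  have "Ck_limit N K (\<lambda>m. pderiv_coord i (\<lambda>x. f m (h x))) (pderiv_coord i (\<lambda>x. g (h x))) F" for i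
    by (rule Ck_limit_cong[OF S(1,2) _ _ 2[of i]]) (intro pderiv_coord_compose(2) hd cd, assumption+)+
  moreover have "uniform_limit K (\<lambda>m x. f m (h x)) (\<lambda>x. g (h x)) F"
    using Ck_limit_imp_uniform[OF Suc.prems(3)] L
    by (auto simp: uniform_limit_iff elim!: all_forward eventually_mono)
  ultimately show ?case by (simp add: Ck_limit_Suc)
qed

section \<open>Test functions and distributions\<close>

lemma fun_support_zero: "x \<notin> fun_support \<phi> \<Longrightarrow> \<phi> x = 0"
  using closure_subset[of "{x. \<phi> x \<noteq> 0}"] unfolding fun_support_def by auto

lemma fun_support_subset: "closed K \<Longrightarrow> (\<And>x. x \<notin> K \<Longrightarrow> \<phi> x = 0) \<Longrightarrow> fun_support \<phi> \<subseteq> K"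
  unfolding fun_support_def by (rule closure_minimal) auto

lemma closed_fun_support: "closed (fun_support \<phi>)"
  by (simp add: fun_support_def)

lemma test_functionI: "smooth \<phi> \<Longrightarrow> compact K \<Longrightarrow> (\<And>x. x \<notin> K \<Longrightarrow> \<phi> x = 0) \<Longrightarrow> test_function \<phi>"
proof -
  assume A: "smooth \<phi>" "compact K" "\<And>x. x \<notin> K \<Longrightarrow> \<phi> x = 0"
  have "fun_support \<phi> \<subseteq> K" by (rule fun_support_subset[OF compact_imp_closed[OF A(2)] A(3)])
  then have "fun_support \<phi> = K \<inter> fun_support \<phi>" by blast
  then have "compact (fun_support \<phi>)"
    using compact_Int_closed[OF A(2) closed_fun_support[of \<phi>]] by simp
  then show "test_function \<phi>" using A(1) by (simp add: test_function_def)
qed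

lemma test_function_smooth_on: "test_function \<phi> \<Longrightarrow> open S \<Longrightarrow> smooth_on S \<phi>"
  using smooth_on_subset[of UNIV \<phi> S] by (simp add: test_function_def smooth_iff_smooth_on)

lemma test_function_compact: "test_function \<phi> \<Longrightarrow> compact (fun_support \<phi>)"
  by (simp add: test_function_def)

lemma pderivs_zero_outside:
  assumes "closed K" "\<And>x. x \<notin> K \<Longrightarrow> \<phi> x = 0" "x \<notin> K"
  shows "pderivs \<alpha> \<phi> x = 0"
proof -
  have "pderivs \<alpha> \<phi> x = pderivs \<alpha> (\<lambda>x. 0 * 0) x"
    by (rule pderivs_cong[of "- K"]) (use assms in auto)
  also have "\<dots> = 0 * pderivs \<alpha> (\<lambda>x. 0) x"
    by (rule pderivs_cmult[of UNIV]) (auto intro: smooth_on_const)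
  finally show ?thesis by simp
qed

lemma test_function_pderivs:
  assumes "test_function \<phi>" shows "test_function (pderivs \<alpha> \<phi>)"
proof (rule test_functionI[where K = "fun_support \<phi>"])
  show "smooth (pderivs \<alpha> \<phi>)"
    using assms by (simp add: test_function_def smooth_iff_smooth_on smooth_on_pderivs)
  show "pderivs \<alpha> \<phi> x = 0" if "x \<notin> fun_support \<phi>" for x
    by (rule pderivs_zero_outside[OF closed_fun_support fun_support_zero that])
qed (rule test_function_compact[OF assms])

lemma test_function_bounded:
  assumes "test_function \<phi>"
  obtains B where "\<And>x. norm (\<phi> x) \<le> B" "B \<ge> 0"
proof -
  have "compact (\<phi> ` fun_support \<phi>)"
    using assms smooth_on_continuous[of UNIV \<phi>] test_function_smooth_on[of \<phi> UNIV]
    by (intro compact_continuous_image) (auto simp: test_function_compact intro: continuous_on_subset)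
  then obtain B where B: "\<And>y. y \<in> \<phi> ` fun_support \<phi> \<Longrightarrow> norm y \<le> B"
    using compact_imp_bounded bounded_iff by metis
  have "norm (\<phi> x) \<le> max B 0" for x
    using B[of "\<phi> x"] fun_support_zero[of x \<phi>] by (cases "x \<in> fun_support \<phi>") auto
  then show ?thesis using that[of "max B 0"] by simp
qed

lemma test_function_lin:
  assumes "test_function \<phi>" "test_function \<psi>"
  shows "test_function (\<lambda>x. a * \<phi> x + b * \<psi> x)"
proof (rule test_functionI[where K = "fun_support \<phi> \<union> fun_support \<psi>"])
  show "smooth (\<lambda>x. a * \<phi> x + b * \<psi> x)"
    using assms unfolding smooth_iff_smooth_on
    by (intro smooth_on_add smooth_on_mult smooth_on_const) (auto intro: test_function_smooth_on)
qed (use assms in \<open>auto simp: test_function_compact fun_support_zero\<close>)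

lemma test_function_mult:
  assumes "test_function \<eta>" "open S" "fun_support \<eta> \<subseteq> S" "smooth_on S \<psi>"
  shows "test_function (\<lambda>x. \<eta> x * \<psi> x)"
proof (rule test_functionI[where K = "fun_support \<eta>"])
  have "smooth_on S (\<lambda>x. \<eta> x * \<psi> x)" by (rule smooth_on_mult[OF assms(2) test_function_smooth_on[OF assms(1,2)] assms(4)])
  moreover have "smooth_on (- fun_support \<eta>) (\<lambda>x. \<eta> x * \<psi> x)"
    by (rule smooth_on_cong[where \<psi> = "\<lambda>x. 0"])
       (auto intro: smooth_on_const simp: fun_support_zero closed_fun_support open_Compl)
  ultimately have "smooth_on (S \<union> - fun_support \<eta>) (\<lambda>x. \<eta> x * \<psi> x)" by (rule smooth_on_Un)
  then show "smooth (\<lambda>x. \<eta> x * \<psi> x)" unfolding smooth_iff_smooth_on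
    by (rule smooth_on_subset) (use assms in auto)
qed (use assms in \<open>auto simp: test_function_compact fun_support_zero\<close>)

lemma test_function_zero: "test_function (\<lambda>x. 0)"
  by (rule test_functionI[where K = "{}"]) (auto simp: smooth_iff_smooth_on smooth_on_const)

lemma distribution_lin:
  "distribution u \<Longrightarrow> test_function \<phi> \<Longrightarrow> test_function \<psi> \<Longrightarrow>
    u (\<lambda>x. a * \<phi> x + b * \<psi> x) = a * u \<phi> + b * u \<psi>"
  by (auto simp: distribution_def linear_functional_on_def)

lemma distribution_zero: "distribution u \<Longrightarrow> u (\<lambda>x. 0) = 0"
proof -
  assume "distribution u"
  from distribution_lin[OF this test_function_zero test_function_zero, of 0 0] show ?thesis by simp
qed

lemma distribution_sum:
  assumes "distribution u" "finite I" "\<And>i. i \<in> I \<Longrightarrow> test_function (f i)"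
  shows "test_function (\<lambda>x. \<Sum>i\<in>I. c i * f i x)" "u (\<lambda>x. \<Sum>i\<in>I. c i * f i x) = (\<Sum>i\<in>I. c i * u (f i))"
proof -
  have "test_function (\<lambda>x. \<Sum>i\<in>I. c i * f i x) \<and> u (\<lambda>x. \<Sum>i\<in>I. c i * f i x) = (\<Sum>i\<in>I. c i * u (f i))"
    using assms(2,3)
  proof (induction I rule: finite_induct)
    case empty
    then show ?case using distribution_zero[OF assms(1)] test_function_zero by simp
  next
    case (insert i I)
    then show ?case
      using distribution_lin[OF assms(1), of "f i" "\<lambda>x. \<Sum>i\<in>I. c i * f i x" "c i" 1]
        test_function_lin[of "f i" "\<lambda>x. \<Sum>i\<in>I. c i * f i x" "c i" 1] by simp
  qed
  then show "test_function (\<lambda>x. \<Sum>i\<in>I. c i * f i x)" "u (\<lambda>x. \<Sum>i\<in>I. c i * f i x) = (\<Sum>i\<in>I. c i * u (f i))"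
    by auto
qed

text \<open>All functions are supported in one compact set, so that the estimate in the definition of a
  distribution holds for their differences with one constant and one order.\<close>

lemma distribution_tendsto:
  fixes f :: "'b \<Rightarrow> real^'n::finite \<Rightarrow> complex"
  assumes u: "distribution u" and K: "compact K"
    and f: "\<And>m. test_function (f m)" "\<And>m. fun_support (f m) \<subseteq> K"
    and g: "test_function g" "fun_support g \<subseteq> K"
    and lim: "\<And>N. Ck_limit N K f g F"
  shows "((\<lambda>m. u (f m)) \<longlongrightarrow> u g) F"
proof -
  obtain C N where CN: "\<And>\<phi>. test_function \<phi> \<Longrightarrow> fun_support \<phi> \<subseteq> K \<Longrightarrow>
        norm (u \<phi>) \<le> C * (\<Sum>\<alpha> | length \<alpha> \<le> N. SUP x. norm (pderivs \<alpha> \<phi> x))"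
    using u K unfolding distribution_def by blast
  define A where "A = {\<alpha> :: 'n list. length \<alpha> \<le> N}"
  have A: "finite A" unfolding A_def using finite_lists_length_le[of "UNIV :: 'n set" N] by simp
  show ?thesis
  proof (rule tendstoI)
    fix e :: real assume e: "e > 0"
    \<comment> \<open>The summands 1 keep the denominator positive; the factor 2 makes the final estimate strict.\<close>
    define d where "d = e / (2 * (\<bar>C\<bar> + 1) * (real (card A) + 1))"
    have d: "d > 0" using e by (auto simp: d_def)
    have de: "2 * ((\<bar>C\<bar> + 1) * ((real (card A) + 1) * d)) = e"
    proof -
      have "2 * (c * (k * (e / (2 * c * k)))) = e" if "c \<noteq> 0" "k \<noteq> 0" for c k :: real
        using that by simp
      from this[of "\<bar>C\<bar> + 1" "real (card A) + 1"] show ?thesis unfolding d_def by linarith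
    qed
    have "\<forall>\<^sub>F m in F. \<forall>\<alpha>\<in>A. \<forall>x\<in>K. dist (pderivs \<alpha> (f m) x) (pderivs \<alpha> g x) < d"
    proof (rule eventually_ball_finite[OF A], intro ballI)
      fix \<alpha> assume "\<alpha> \<in> A"
      then have "uniform_limit K (\<lambda>m. pderivs \<alpha> (f m)) (pderivs \<alpha> g) F"
        using lim[of N] by (simp add: Ck_limit_def A_def)
      then show "\<forall>\<^sub>F m in F. \<forall>x\<in>K. dist (pderivs \<alpha> (f m) x) (pderivs \<alpha> g x) < d"
        using d by (simp add: uniform_limit_iff)
    qed
    then show "\<forall>\<^sub>F m in F. dist (u (f m)) (u g) < e"
    proof eventually_elim
      case (elim m)
      define w where "w = (\<lambda>x. 1 * f m x + (-1) * g x)"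
      have w: "test_function w" unfolding w_def by (rule test_function_lin[OF f(1) g(1)])
      have wz: "w x = 0" if "x \<notin> K" for x
      proof -
        have "x \<notin> fun_support (f m)" "x \<notin> fun_support g" using that f(2)[of m] g(2) by blast+
        then show ?thesis by (simp add: w_def fun_support_zero)
      qed
      have wK: "fun_support w \<subseteq> K" by (rule fun_support_subset[OF compact_imp_closed[OF K] wz])
      have sup: "(SUP x. norm (pderivs \<alpha> w x)) \<le> d" if "\<alpha> \<in> A" for \<alpha>
      proof (rule cSUP_least)
        fix x
        show "norm (pderivs \<alpha> w x) \<le> d"
        proof (cases "x \<in> K")
          case True
          have "w = (\<lambda>x. f m x - g x)" by (auto simp: w_def)
          then have "pderivs \<alpha> w x = pderivs \<alpha> (f m) x - pderivs \<alpha> g x"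
            using pderivs_diff[of UNIV "f m" g x \<alpha>] f(1) g(1) by (auto intro: test_function_smooth_on)
          then show ?thesis using elim that True by (auto simp: dist_norm less_imp_le)
        next
          case False
          then show ?thesis using pderivs_zero_outside[OF compact_imp_closed[OF K] wz] d by simp
        qed
      qed simp
      have sup0: "(SUP x. norm (pderivs \<alpha> w x)) \<ge> 0" for \<alpha>
      proof -
        obtain B where B: "\<And>x. norm (pderivs \<alpha> w x) \<le> B"
          using test_function_bounded[OF test_function_pderivs[OF w]] by blast
        show ?thesis by (rule order_trans[OF norm_ge_zero cSUP_upper[of 0]]) (auto intro!: bdd_aboveI2 B)
      qed
      have "u w = 1 * u (f m) + (-1) * u g" unfolding w_def by (rule distribution_lin[OF u f(1) g(1)])
      then have "dist (u (f m)) (u g) = norm (u w)" by (simp add: dist_norm)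
      also have "\<dots> \<le> C * (\<Sum>\<alpha>\<in>A. SUP x. norm (pderivs \<alpha> w x))"
        using CN[OF w wK] by (simp add: A_def)
      also have "\<dots> \<le> (\<bar>C\<bar> + 1) * (\<Sum>\<alpha>\<in>A. d)"
        by (intro mult_mono sum_mono sup sum_nonneg sup0) auto
      also have "\<dots> = (\<bar>C\<bar> + 1) * (real (card A) * d)" by simp
      also have "\<dots> \<le> (\<bar>C\<bar> + 1) * ((real (card A) + 1) * d)"
        using d by (intro mult_left_mono mult_right_mono) auto
      also have "\<dots> < e" using de e by linarith
      finally show ?case .
    qed
  qed
qed

section \<open>Differentiation under the integral sign\<close>

text \<open>The mean value inequality bounds the difference quotients by a multiple of \<open>D\<close>, so that dominated
  convergence applies along every sequence tending to \<open>z0\<close>.\<close>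

lemma has_derivative_integral:
  fixes F :: "'b \<Rightarrow> real^'n::finite \<Rightarrow> complex"
  assumes e: "e > 0"
    and diff: "\<And>x z. x \<in> space M \<Longrightarrow> z \<in> ball z0 e \<Longrightarrow> F x differentiable (at z)"
    and int: "\<And>z. z \<in> ball z0 e \<Longrightarrow> integrable M (\<lambda>x. F x z)"
    and meas: "\<And>i. (\<lambda>x. pderiv_coord i (F x) z0) \<in> borel_measurable M"
    and bound: "\<And>x z i. x \<in> space M \<Longrightarrow> z \<in> ball z0 e \<Longrightarrow> norm (pderiv_coord i (F x) z) \<le> D x"
    and D: "integrable M D"
  shows "((\<lambda>z. \<integral>x. F x z \<partial>M) has_derivative
    (\<lambda>v. \<Sum>i\<in>UNIV. of_real (v $ i) * (\<integral>x. pderiv_coord i (F x) z0 \<partial>M))) (at z0)"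
proof -
  define L where "L x v = (\<Sum>i\<in>UNIV. of_real (v $ i) * pderiv_coord i (F x) z0)" for x and v :: "real^'n"
  define C where "C = real CARD('n)"
  have z0: "z0 \<in> ball z0 e" using e by simp
  have intp: "integrable M (\<lambda>x. pderiv_coord i (F x) z0)" for i
    by (rule Bochner_Integration.integrable_bound[OF D meas]) 
       (auto intro!: AE_I2 order_trans[OF bound[OF _ z0]])
  have D0: "D x \<ge> 0" if "x \<in> space M" for x using bound[OF that z0] norm_ge_zero order_trans by blast
  have nL: "norm (\<Sum>i\<in>UNIV. of_real (v $ i) * pderiv_coord i (F x) z) \<le> C * D x * norm v"
    if "x \<in> space M" "z \<in> ball z0 e" for x z and v :: "real^'n"
  proof -
    have "norm (\<Sum>i\<in>UNIV. of_real (v $ i) * pderiv_coord i (F x) z)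
        \<le> (\<Sum>i\<in>(UNIV::'n set). norm v * D x)"
      using component_le_norm_cart[of v] bound[OF that]
      by (intro sum_norm_le) (auto simp: norm_mult intro!: mult_mono)
    then show ?thesis by (simp add: C_def mult_ac)
  qed
  have lip: "norm (F x y - F x z0) \<le> C * D x * norm (y - z0)" if x: "x \<in> space M" and y: "y \<in> ball z0 e" for x y
  proof (rule differentiable_bound[OF convex_ball _ _ y z0])
    show "(F x has_derivative (\<lambda>v. \<Sum>i\<in>UNIV. of_real (v $ i) * pderiv_coord i (F x) z)) (at z within ball z0 e)"
      if "z \<in> ball z0 e" for z
      by (rule has_derivative_at_withinI[OF has_derivative_pderivs[OF diff[OF x that]]])
    show "onorm (\<lambda>v. \<Sum>i\<in>UNIV. of_real (v $ i) * pderiv_coord i (F x) z) \<le> C * D x" if "z \<in> ball z0 e" for z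
      by (rule onorm_bound[OF _ nL[OF x that]]) (simp add: C_def D0[OF x])
  qed
  have intL: "integrable M (\<lambda>x. L x v)" for v unfolding L_def using intp by (intro Bochner_Integration.integrable_sum) auto
  have LL: "(\<Sum>i\<in>UNIV. of_real (v $ i) * (\<integral>x. pderiv_coord i (F x) z0 \<partial>M)) = (\<integral>x. L x v \<partial>M)" for v
    unfolding L_def by (subst Bochner_Integration.integral_sum) (auto simp: intp)
  have "bounded_linear (\<lambda>v::real^'n. \<Sum>i\<in>UNIV. of_real (v $ i) * (\<integral>x. pderiv_coord i (F x) z0 \<partial>M))"
    by (intro bounded_linear_sum bounded_linear_mult_const bounded_linear_nth_complex)
  moreover have "((\<lambda>y. norm (((\<integral>x. F x y \<partial>M) - (\<integral>x. F x z0 \<partial>M)) - (\<integral>x. L x (y - z0) \<partial>M)) / norm (y - z0)) \<longlongrightarrow> 0) (at z0)"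
    unfolding tendsto_at_iff_sequentially comp_def
  proof (intro allI impI)
    fix X assume X: "\<forall>i. X i \<in> UNIV - {z0}" "X \<longlonglongrightarrow> z0"
    have "\<forall>\<^sub>F n in sequentially. X n \<in> ball z0 e"
      using X(2) e by (auto simp: tendsto_iff dist_commute)
    then obtain n0 where n0: "\<And>n. n \<ge> n0 \<Longrightarrow> X n \<in> ball z0 e" by (auto simp: eventually_sequentially)
    define Y where "Y n = X (n + n0)" for n
    have Y: "Y n \<in> ball z0 e" "Y n \<noteq> z0" for n using n0 X(1) by (auto simp: Y_def)
    have Ylim: "Y \<longlonglongrightarrow> z0" unfolding Y_def using X(2) by (rule LIMSEQ_ignore_initial_segment)
    define s where "s n x = (F x (Y n) - F x z0 - L x (Y n - z0)) /\<^sub>R norm (Y n - z0)" for n x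
    have "(\<lambda>n. \<integral>x. s n x \<partial>M) \<longlonglongrightarrow> (LINT x|M. 0)"
    proof (rule integral_dominated_convergence[where w = "\<lambda>x. 2 * C * D x"])
      show "s n \<in> borel_measurable M" for n
        unfolding s_def using int[OF Y(1)[of n]] int[OF z0] intL by (intro borel_measurable_scaleR) auto
      show "integrable M (\<lambda>x. 2 * C * D x)" using D by auto
      show "AE x in M. (\<lambda>n. s n x) \<longlonglongrightarrow> 0"
      proof (rule AE_I2)
        fix x assume x: "x \<in> space M"
        have "((\<lambda>y. norm ((F x y - F x z0) - L x (y - z0)) / norm (y - z0)) \<longlongrightarrow> 0) (at z0)"
          using has_derivative_pderivs[OF diff[OF x z0]] unfolding has_derivative_iff_norm L_def by blast
        then have "(\<lambda>n. norm ((F x (Y n) - F x z0) - L x (Y n - z0)) / norm (Y n - z0)) \<longlonglongrightarrow> 0"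
          unfolding tendsto_at_iff_sequentially comp_def using Y(2) Ylim by auto
        then have "(\<lambda>n. norm (s n x)) \<longlonglongrightarrow> 0"
          by (simp add: s_def divide_inverse mult.commute)
        then show "(\<lambda>n. s n x) \<longlonglongrightarrow> 0" by (rule tendsto_norm_zero_cancel)
      qed
      show "AE x in M. norm (s n x) \<le> 2 * C * D x" for n
      proof (rule AE_I2)
        fix x assume x: "x \<in> space M"
        have "norm (F x (Y n) - F x z0 - L x (Y n - z0)) \<le> norm (F x (Y n) - F x z0) + norm (L x (Y n - z0))"
          by (rule norm_triangle_ineq4)
        also have "\<dots> \<le> 2 * C * D x * norm (Y n - z0)"
          using lip[OF x Y(1)[of n]] nL[OF x z0, of "Y n - z0"] by (simp add: L_def)
        finally show "norm (s n x) \<le> 2 * C * D x"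
          using Y(2)[of n] by (simp add: s_def divide_simps mult_ac)
      qed
    qed simp
    then have "(\<lambda>n. norm (\<integral>x. s n x \<partial>M)) \<longlonglongrightarrow> norm (LINT x|M. (0::complex))" by (rule tendsto_norm)
    moreover have "norm (\<integral>x. s n x \<partial>M) = norm (((\<integral>x. F x (Y n) \<partial>M) - (\<integral>x. F x z0 \<partial>M)) - (\<integral>x. L x (Y n - z0) \<partial>M)) / norm (Y n - z0)" for n
    proof -
      have "(\<integral>x. s n x \<partial>M) = (((\<integral>x. F x (Y n) \<partial>M) - (\<integral>x. F x z0 \<partial>M)) - (\<integral>x. L x (Y n - z0) \<partial>M)) /\<^sub>R norm (Y n - z0)"
        unfolding s_def using int[OF Y(1)[of n]] int[OF z0] intL
        by (subst integral_scaleR_right) (auto simp: Bochner_Integration.integral_diff)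
      then show ?thesis by (simp add: divide_inverse mult.commute)
    qed
    ultimately have "(\<lambda>n. norm (((\<integral>x. F x (Y n) \<partial>M) - (\<integral>x. F x z0 \<partial>M)) - (\<integral>x. L x (Y n - z0) \<partial>M)) / norm (Y n - z0)) \<longlonglongrightarrow> 0"
      by simp
    then show "(\<lambda>n. norm (((\<integral>x. F x (X n) \<partial>M) - (\<integral>x. F x z0 \<partial>M)) - (\<integral>x. L x (X n - z0) \<partial>M)) / norm (X n - z0)) \<longlonglongrightarrow> 0"
      unfolding Y_def by (rule LIMSEQ_offset)
  qed
  ultimately show ?thesis unfolding has_derivative_iff_norm LL by simp
qed

text \<open>The dominating functions may depend on the order of the derivative and need to work only near each
  point: on a smaller ball the finitely many dominating functions of the next order have an
  integrable sum.\<close>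

lemma pderivs_integral:
  fixes F :: "'b \<Rightarrow> real^'n::finite \<Rightarrow> complex"
  assumes S: "open S" and sm: "\<And>x. x \<in> space M \<Longrightarrow> smooth_on S (F x)"
    and meas: "\<And>\<alpha> z. z \<in> S \<Longrightarrow> (\<lambda>x. pderivs \<alpha> (F x) z) \<in> borel_measurable M"
    and dom: "\<And>\<alpha> z0. z0 \<in> S \<Longrightarrow> \<exists>e>0. \<exists>D. integrable M D \<and>
       (\<forall>x\<in>space M. \<forall>z\<in>ball z0 e. norm (pderivs \<alpha> (F x) z) \<le> D x)"
  shows "smooth_on S (\<lambda>z. \<integral>x. F x z \<partial>M)"
    and "z \<in> S \<Longrightarrow> pderivs \<alpha> (\<lambda>z. \<integral>x. F x z \<partial>M) z = (\<integral>x. pderivs \<alpha> (F x) z \<partial>M)"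
proof -
  have int: "integrable M (\<lambda>x. pderivs \<alpha> (F x) z)" if z: "z \<in> S" for \<alpha> z
  proof -
    obtain e D where "e > 0" "integrable M D" "\<And>x y. x \<in> space M \<Longrightarrow> y \<in> ball z e \<Longrightarrow> norm (pderivs \<alpha> (F x) y) \<le> D x"
      using dom[OF z, of \<alpha>] by blast
    then have "norm (pderivs \<alpha> (F x) z) \<le> norm (D x)" if "x \<in> space M" for x
      using that by (metis abs_ge_self centre_in_ball order_trans real_norm_def)
    with \<open>integrable M D\<close> show ?thesis
      by (intro Bochner_Integration.integrable_bound[OF _ meas[OF z]]) (auto intro!: AE_I2)
  qed
  have der: "((\<lambda>z. \<integral>x. pderivs \<alpha> (F x) z \<partial>M) has_derivative
    (\<lambda>v. \<Sum>i\<in>UNIV. of_real (v $ i) * (\<integral>x. pderivs (i # \<alpha>) (F x) z0 \<partial>M))) (at z0)" if z0: "z0 \<in> S" for \<alpha> z0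
  proof -
    have "\<forall>i. \<exists>e>0. \<exists>D. integrable M D \<and> (\<forall>x\<in>space M. \<forall>z\<in>ball z0 e. norm (pderivs (i # \<alpha>) (F x) z) \<le> D x)"
      using dom[OF z0] by blast
    then obtain e D where eD: "\<And>i::'n. e i > 0" "\<And>i. integrable M (D i)"
      "\<And>i x z. x \<in> space M \<Longrightarrow> z \<in> ball z0 (e i) \<Longrightarrow> norm (pderivs (i # \<alpha>) (F x) z) \<le> D i x" by metis
    obtain r where r: "r > 0" "ball z0 r \<subseteq> S" using S z0 openE by blast
    define d where "d = min r (Min (range e))"
    have d: "d > 0" "d \<le> r" "\<And>i. d \<le> e i" using eD(1) r(1) by (auto simp: d_def intro: min.coboundedI2)
    have D0: "D i x \<ge> 0" if "x \<in> space M" for i x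
      using eD(3)[OF that, of z0 i] eD(1)[of i] norm_ge_zero order_trans by (metis centre_in_ball)
    show ?thesis unfolding pderivs_Cons
    proof (rule has_derivative_integral[OF d(1), where D = "\<lambda>x. \<Sum>i\<in>UNIV. D i x"])
      show "integrable M (\<lambda>x. \<Sum>i\<in>UNIV. D i x)" using eD(2) by auto
      show "pderivs \<alpha> (F x) differentiable (at z)" if "x \<in> space M" "z \<in> ball z0 d" for x z
        using sm[OF that(1)] r d that(2) unfolding smooth_on_def by (meson subset_ball subsetD)
      show "integrable M (\<lambda>x. pderivs \<alpha> (F x) z)" if "z \<in> ball z0 d" for z
        using int r d that by (meson subset_ball subsetD)
      show "(\<lambda>x. pderiv_coord i (pderivs \<alpha> (F x)) z0) \<in> borel_measurable M" for i
        using meas[OF z0, of "i # \<alpha>"] by (simp add: pderivs_Cons)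
      show "norm (pderiv_coord i (pderivs \<alpha> (F x)) z) \<le> (\<Sum>i\<in>UNIV. D i x)" if "x \<in> space M" "z \<in> ball z0 d" for x z i
      proof -
        have "z \<in> ball z0 (e i)" using that(2) d(3)[of i] by auto
        from eD(3)[OF that(1) this] have "norm (pderiv_coord i (pderivs \<alpha> (F x)) z) \<le> D i x"
          by (simp add: pderivs_Cons)
        also have "\<dots> \<le> (\<Sum>i\<in>UNIV. D i x)" by (rule member_le_sum) (auto simp: D0[OF that(1)])
        finally show ?thesis .
      qed
    qed
  qed
  have eq: "\<forall>z\<in>S. pderivs \<alpha> (\<lambda>z. \<integral>x. F x z \<partial>M) z = (\<integral>x. pderivs \<alpha> (F x) z \<partial>M)" for \<alpha>
  proof (induction \<alpha>)
    case (Cons i \<alpha>)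
    show ?case
    proof
      fix z assume z: "z \<in> S"
      have "pderivs (i # \<alpha>) (\<lambda>z. \<integral>x. F x z \<partial>M) z = pderiv_coord i (\<lambda>z. \<integral>x. pderivs \<alpha> (F x) z \<partial>M) z"
        unfolding pderivs_Cons by (rule pderiv_coord_cong[OF S z]) (use Cons in auto)
      also have "\<dots> = (\<integral>x. pderivs (i # \<alpha>) (F x) z \<partial>M)"
        unfolding pderiv_coord_eq[OF der[OF z]] by (simp add: axis_def if_distrib if_distribR cong: if_cong)
      finally show "pderivs (i # \<alpha>) (\<lambda>z. \<integral>x. F x z \<partial>M) z = (\<integral>x. pderivs (i # \<alpha>) (F x) z \<partial>M)" .
    qed
  qed simp
  show "z \<in> S \<Longrightarrow> pderivs \<alpha> (\<lambda>z. \<integral>x. F x z \<partial>M) z = (\<integral>x. pderivs \<alpha> (F x) z \<partial>M)" using eq by blast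
  show "smooth_on S (\<lambda>z. \<integral>x. F x z \<partial>M)" unfolding smooth_on_def
  proof (intro allI ballI)
    fix \<alpha> z assume z: "z \<in> S"
    have "(\<lambda>z. \<integral>x. pderivs \<alpha> (F x) z \<partial>M) differentiable (at z)"
      using der[OF z] differentiableI by blast
    then show "pderivs \<alpha> (\<lambda>z. \<integral>x. F x z \<partial>M) differentiable (at z)"
      by (rule differentiable_cong_open[OF S z, rotated]) (use eq in blast)
  qed
qed

section \<open>Convolution with a test function\<close>

lemma integral_reflect:
  fixes f :: "real^'n::finite \<Rightarrow> complex"
  assumes [measurable]: "f \<in> borel_measurable borel"
  shows "(LINT y|lebesgue. f (z - y)) = (LINT y|lebesgue. f y)"
proof -
  have "(LINT y|lborel. f y) = (LINT y|density (distr lborel borel (\<lambda>x. z + (-1) *\<^sub>R x)) (\<lambda>_. \<bar>- 1::real\<bar> ^ DIM(real^'n)). f y)"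
    using lborel_affine[of "-1::real" z] by simp
  also have "\<dots> = (LINT y|distr lborel borel (\<lambda>x. z - x). f y)"
    by (subst integral_density) auto
  also have "\<dots> = (LINT y|lborel. f (z - y))" by (subst integral_distr) auto
  finally show ?thesis by (simp add: integral_completion)
qed

lemma test_function_borel: "test_function \<phi> \<Longrightarrow> \<phi> \<in> borel_measurable borel"
  using smooth_on_continuous[OF test_function_smooth_on[OF _ open_UNIV]] borel_measurable_continuous_onI by blast

lemma borel_measurable_lebesgueI: "f \<in> borel_measurable borel \<Longrightarrow> f \<in> borel_measurable lebesgue"
  for f :: "real^'n::finite \<Rightarrow> 'a::topological_space"
  by (simp add: measurable_completion)

lemma convol_commute:
  assumes [measurable]: "\<phi> \<in> borel_measurable borel" "g \<in> borel_measurable borel"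
  shows "convol \<phi> g z = (LINT v|lebesgue. \<phi> (z - v) * g v)"
  using integral_reflect[of "\<lambda>y. \<phi> y * g (z - y)" z] by (simp add: convol_def)

lemma fun_support_pderivs: "fun_support (pderivs \<alpha> \<phi>) \<subseteq> fun_support \<phi>"
proof (rule fun_support_subset[OF closed_fun_support])
  show "pderivs \<alpha> \<phi> x = 0" if "x \<notin> fun_support \<phi>" for x
    by (rule pderivs_zero_outside[OF closed_fun_support fun_support_zero that])
qed

lemma test_function_shift_zero:
  assumes "fun_support \<phi> \<subseteq> cball 0 R" "norm (z - z0) < 1" "norm (z0::real^'n::finite) + R + 1 < norm v"
  shows "\<phi> (z - v) = 0"
proof (rule fun_support_zero)
  have "norm v \<le> norm (z - v) + norm (z - z0) + norm z0"
    using norm_triangle_ineq[of "v - z" "z"] norm_triangle_ineq[of "z - z0" z0] by (simp add: norm_minus_commute)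
  then have "norm (z - v) > R" using assms(2,3) by linarith
  then show "z - v \<notin> fun_support \<phi>" using assms(1) by (auto simp: subset_iff)
qed

text \<open>All derivatives are put on the test function, because \<open>g\<close> is to be the kernel, which is only locally
  integrable.\<close>

lemma pderivs_convol:
  fixes \<phi> g :: "real^'n::finite \<Rightarrow> complex"
  assumes \<phi>: "test_function \<phi>" and g[measurable]: "g \<in> borel_measurable borel"
    and gi: "\<And>R. set_integrable lebesgue (cball 0 R) g"
  shows "smooth (convol \<phi> g)"
    and "pderivs \<alpha> (convol \<phi> g) z = (LINT v|lebesgue. pderivs \<alpha> \<phi> (z - v) * g v)"
proof -
  obtain R where "\<forall>x\<in>fun_support \<phi>. norm x \<le> R"
    using compact_imp_bounded[OF test_function_compact[OF \<phi>]] unfolding bounded_iff by (rule exE)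
  then have R: "fun_support \<phi> \<subseteq> cball 0 R" by auto
  define F where "F v z = g v * \<phi> (z - v)" for v z :: "real^'n"
  have F: "convol \<phi> g = (\<lambda>z. LINT v|lebesgue. F v z)"
    using convol_commute[OF test_function_borel[OF \<phi>] g] by (auto simp: F_def mult.commute)
  have shift: "smooth_on UNIV (\<lambda>z. \<phi> (z - v))" for v
    using smooth_on_shift[OF test_function_smooth_on[OF \<phi> open_UNIV], of v]
    by (simp add: surj_plus)
  have dF: "pderivs \<alpha> (F v) z = g v * pderivs \<alpha> \<phi> (z - v)" for \<alpha> v z
    unfolding F_def using pderivs_cmult[OF open_UNIV shift UNIV_I, of \<alpha> "g v" v z] by (simp add: pderivs_shift)
  have supp: "fun_support (pderivs \<alpha> \<phi>) \<subseteq> cball 0 R" for \<alpha>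
    using fun_support_pderivs R by (rule order_trans)
  have sF: "smooth_on UNIV (F v)" for v
    unfolding F_def by (intro smooth_on_mult smooth_on_const shift open_UNIV)
  have meas: "(\<lambda>v. pderivs \<alpha> (F v) z) \<in> borel_measurable lebesgue" for \<alpha> z
  proof -
    have [measurable]: "pderivs \<alpha> \<phi> \<in> borel_measurable borel"
      by (rule test_function_borel[OF test_function_pderivs[OF \<phi>]])
    show ?thesis unfolding dF by (rule borel_measurable_lebesgueI) measurable
  qed
  have dom: "\<exists>e>0. \<exists>D. integrable lebesgue D \<and>
       (\<forall>v\<in>space lebesgue. \<forall>z\<in>ball z0 e. norm (pderivs \<alpha> (F v) z) \<le> D v)" for \<alpha> z0
  proof -
    obtain B where B: "\<And>x. norm (pderivs \<alpha> \<phi> x) \<le> B" "B \<ge> 0"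
      using test_function_bounded[OF test_function_pderivs[OF \<phi>]] by blast
    define D where "D v = B * (indicator (cball 0 (norm z0 + R + 1)) v * norm (g v))" for v
    have "integrable lebesgue D" unfolding D_def
      using integrable_norm[OF gi[of "norm z0 + R + 1", unfolded set_integrable_def]]
      by (intro integrable_mult_right) simp
    moreover have "norm (pderivs \<alpha> (F v) z) \<le> D v" if "z \<in> ball z0 1" for v z
    proof (cases "norm v \<le> norm z0 + R + 1")
      case True
      then have "D v = B * norm (g v)" by (simp add: D_def)
      then show ?thesis using mult_left_mono[OF B(1)[of "z - v"] norm_ge_zero[of "g v"]]
        by (simp add: dF norm_mult mult.commute)
    next
      case False
      then have "pderivs \<alpha> \<phi> (z - v) = 0"
        using that by (intro test_function_shift_zero[OF supp, of _ z0]) (auto simp: dist_norm norm_minus_commute)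
      then show ?thesis by (simp add: dF D_def B)
    qed
    ultimately show ?thesis by (intro exI[of _ 1]) auto
  qed
  have "smooth_on UNIV (\<lambda>z. LINT v|lebesgue. F v z)"
    by (rule pderivs_integral(1)[OF open_UNIV sF meas dom])
  then show "smooth (convol \<phi> g)" by (simp add: F smooth_iff_smooth_on)
  have "pderivs \<alpha> (\<lambda>z. LINT v|lebesgue. F v z) z = (LINT v|lebesgue. pderivs \<alpha> (F v) z)"
    by (rule pderivs_integral(2)[OF open_UNIV sF meas dom UNIV_I])
  then show "pderivs \<alpha> (convol \<phi> g) z = (LINT v|lebesgue. pderivs \<alpha> \<phi> (z - v) * g v)"
    by (simp add: F dF mult.commute)
qed

section \<open>Cutoff functions and supports\<close>

text \<open>For \<open>k = 0\<close> this is the standard smooth function that is zero on the negative half-line. The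
  factor \<open>inverse t ^ k\<close> closes the family under differentiation, also at the origin.\<close>

definition exp_recip :: "nat \<Rightarrow> real \<Rightarrow> real" where
  "exp_recip k t = (if t \<le> 0 then 0 else inverse t ^ k * exp (- inverse t))"

lemma exp_recip_nonneg: "exp_recip k t \<ge> 0"
  by (simp add: exp_recip_def)

lemma exp_recip_tendsto_0: "(exp_recip k \<longlongrightarrow> 0) (at 0)"
proof -
  have "((\<lambda>x. inverse x ^ k / exp (inverse x)) \<longlongrightarrow> (0::real)) (at_right 0)"
    by (rule filterlim_compose[OF tendsto_power_div_exp_0 filterlim_inverse_at_top_right])
  then have "(exp_recip k \<longlongrightarrow> 0) (at_right 0)"
    by (rule Lim_transform_eventually)
       (auto simp: eventually_at_filter exp_recip_def exp_minus divide_inverse)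
  moreover have "((\<lambda>x. 0) \<longlongrightarrow> (0::real)) (at_left 0)" by simp
  then have "(exp_recip k \<longlongrightarrow> 0) (at_left 0)"
    by (rule Lim_transform_eventually) (auto simp: eventually_at_filter exp_recip_def)
  ultimately show ?thesis by (simp add: filterlim_at_split)
qed

lemma exp_recip_deriv:
  "(exp_recip k has_real_derivative (- real k * exp_recip (Suc k) t + exp_recip (Suc (Suc k)) t)) (at t)"
proof -
  consider "t > 0" | "t < 0" | "t = 0" by linarith
  then show ?thesis
  proof cases
    case 1
    have "((\<lambda>t. inverse t ^ k * exp (- inverse t)) has_real_derivative
        (- real k * (inverse t ^ Suc k * exp (- inverse t)) + inverse t ^ Suc (Suc k) * exp (- inverse t))) (at t)"
    proof -
      have i: "(inverse has_real_derivative - (inverse t ^ Suc (Suc 0))) (at t)"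
        using DERIV_inverse[of t UNIV] 1 by simp
      have x: "((\<lambda>t. exp (- inverse t)) has_real_derivative exp (- inverse t) * inverse t ^ Suc (Suc 0)) (at t)"
        using DERIV_fun_exp[OF DERIV_minus[OF i]] by simp
      have "((\<lambda>t. inverse t ^ k) has_real_derivative - (real k * inverse t ^ Suc k)) (at t)"
      proof (cases k)
        case (Suc l)
        then show ?thesis using DERIV_power_Suc[OF i, of l] by (simp add: algebra_simps)
      qed simp
      from DERIV_mult[OF this x] show ?thesis by (simp add: algebra_simps)
    qed
    moreover have "\<forall>\<^sub>F s in nhds t. s > 0" using 1 by (rule order_tendstoD(1)[OF filterlim_ident])
    then have "\<forall>\<^sub>F s in nhds t. exp_recip k s = inverse s ^ k * exp (- inverse s)"
      by eventually_elim (simp add: exp_recip_def)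
    ultimately show ?thesis using 1
      by (subst DERIV_cong_ev[OF refl _ refl, where g = "\<lambda>t. inverse t ^ k * exp (- inverse t)"])
         (auto simp: exp_recip_def)
  next
    case 2
    have "\<forall>\<^sub>F s in nhds t. s < 0" using 2 by (rule order_tendstoD(2)[OF filterlim_ident])
    then have "\<forall>\<^sub>F s in nhds t. exp_recip k s = 0"
      by eventually_elim (simp add: exp_recip_def)
    then show ?thesis using 2
      by (subst DERIV_cong_ev[OF refl _ refl, where g = "\<lambda>t. 0"]) (auto simp: exp_recip_def)
  next
    case 3
    have "\<forall>h. h \<noteq> 0 \<longrightarrow> (exp_recip k (0 + h) - exp_recip k 0) / h = exp_recip (Suc k) h"
      by (auto simp: exp_recip_def divide_inverse)
    then have "((\<lambda>h. (exp_recip k (0 + h) - exp_recip k 0) / h) \<longlongrightarrow> 0) (at 0)"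
      by (intro Lim_transform_eventually[OF exp_recip_tendsto_0[of "Suc k"]]) (auto simp: eventually_at_filter)
    then show ?thesis using 3 by (simp add: DERIV_def exp_recip_def)
  qed
qed

text \<open>The squared norm makes \<open>bump\<close> smooth at the origin.\<close>

definition bump :: "real \<Rightarrow> real^'n::finite \<Rightarrow> complex" where
  "bump r y = complex_of_real (exp_recip 0 (r\<^sup>2 - y \<bullet> y))"

lemma bump_eq_0_iff: "r > 0 \<Longrightarrow> bump r y = 0 \<longleftrightarrow> norm y \<ge> r"
proof -
  assume r: "r > 0"
  have "bump r y = 0 \<longleftrightarrow> r\<^sup>2 \<le> (norm y)\<^sup>2"
    by (simp add: bump_def exp_recip_def dot_square_norm)
  also have "\<dots> \<longleftrightarrow> r \<le> norm y" using r by (simp add: power_mono_iff)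
  finally show ?thesis .
qed

text \<open>The functions \<open>exp_recip k (r\<^sup>2 - y \<bullet> y)\<close> with all \<open>k\<close> and the coordinates generate an algebra that is
  closed under differentiation.\<close>

lemma smooth_bump: "smooth (bump r :: real^'n::finite \<Rightarrow> complex)"
proof -
  define q where "q k = (\<lambda>y::real^'n. complex_of_real (exp_recip k (r\<^sup>2 - y \<bullet> y)))" for k
  define G where "G = range q \<union> range (\<lambda>i. \<lambda>y::real^'n. complex_of_real (y $ i))"
  have q: "q k \<in> algebra_gen G" and c: "(\<lambda>y. complex_of_real (y $ i)) \<in> algebra_gen G" for k i
    by (auto simp: G_def intro!: algebra_gen.gen)
  have dq: "(q k has_derivative (\<lambda>v. complex_of_real
     ((- real k * exp_recip (Suc k) (r\<^sup>2 - y \<bullet> y) + exp_recip (Suc (Suc k)) (r\<^sup>2 - y \<bullet> y)) * (- 2 * (y \<bullet> v))))) (at y)" for k y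
  proof -
    have 1: "((\<lambda>y. r\<^sup>2 - y \<bullet> y) has_derivative (\<lambda>v. - 2 * (y \<bullet> v))) (at y)"
      by (auto intro!: derivative_eq_intros simp: inner_commute)
    from diff_chain_at[OF 1 exp_recip_deriv[of k "r\<^sup>2 - y \<bullet> y", unfolded has_field_derivative_def]]
    have "((\<lambda>y. exp_recip k (r\<^sup>2 - y \<bullet> y)) has_derivative (\<lambda>v.
     (- real k * exp_recip (Suc k) (r\<^sup>2 - y \<bullet> y) + exp_recip (Suc (Suc k)) (r\<^sup>2 - y \<bullet> y)) * (- 2 * (y \<bullet> v)))) (at y)"
      by (simp only: o_def)
    then show ?thesis unfolding q_def by (rule bounded_linear.has_derivative[OF bounded_linear_of_real])
  qed
  have "smooth_on UNIV (q 0)"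
  proof (rule algebra_gen_smooth_on[OF open_UNIV, of G])
    show "g differentiable (at x)" if "g \<in> G" for g x
      using that dq bounded_linear_imp_differentiable[OF bounded_linear_nth_complex]
      unfolding G_def differentiable_def by blast
    show "\<exists>g'\<in>algebra_gen G. \<forall>x\<in>UNIV. pderiv_coord i g x = g' x" if "g \<in> G" for g i
    proof -
      have "g \<in> range q \<or> g \<in> range (\<lambda>i. \<lambda>y::real^'n. complex_of_real (y $ i))"
        using that unfolding G_def by (rule UnE) simp_all
      then show ?thesis
      proof
        assume "g \<in> range q"
        then obtain k where g: "g = q k" by (rule rangeE)
        show ?thesis
        proof (intro bexI ballI)
          show "pderiv_coord i g y = (of_real (- real k) * q (Suc k) y + q (Suc (Suc k)) y) * (of_real (-2) * of_real (y $ i))" for y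
            unfolding g pderiv_coord_eq[OF dq] by (simp add: q_def inner_axis)
          show "(\<lambda>y. (of_real (- real k) * q (Suc k) y + q (Suc (Suc k)) y) * (of_real (-2) * of_real (y $ i))) \<in> algebra_gen G"
            by (intro algebra_gen.mult algebra_gen.add algebra_gen.const q c)
        qed
      next
        assume "g \<in> range (\<lambda>i. \<lambda>y::real^'n. complex_of_real (y $ i))"
        then obtain k where g: "g = (\<lambda>y. complex_of_real (y $ k))" by (rule rangeE)
        have "pderiv_coord i g y = of_real (axis i 1 $ k)" for y
          unfolding g using pderiv_coord_eq[OF bounded_linear_imp_has_derivative[OF bounded_linear_nth_complex]] .
        then show ?thesis by (intro bexI[of _ "\<lambda>y. of_real (axis i 1 $ k)"]) (auto intro: algebra_gen.const)
      qed
    qed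
  qed (rule q)
  then show ?thesis unfolding smooth_iff_smooth_on q_def bump_def .
qed

lemma test_function_bump: "r > 0 \<Longrightarrow> test_function (bump r)"
  by (rule test_functionI[OF smooth_bump compact_cball[of 0 r]]) (simp add: bump_eq_0_iff)

lemma test_function_integrable:
  fixes \<phi> :: "real^'n::finite \<Rightarrow> complex"
  assumes "test_function \<phi>" shows "integrable lebesgue \<phi>"
proof -
  obtain B where B: "\<And>x. norm (\<phi> x) \<le> B" using test_function_bounded[OF assms] by blast
  have K: "fun_support \<phi> \<in> lmeasurable" by (rule lmeasurable_compact[OF test_function_compact[OF assms]])
  have "integrable lebesgue (\<lambda>x. B * indicator (fun_support \<phi>) x)"
    using K by (intro integrable_mult_right integrable_real_indicator) (auto simp: fmeasurable_def)
  then show ?thesis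
  proof (rule Bochner_Integration.integrable_bound)
    show "\<phi> \<in> borel_measurable lebesgue" by (rule borel_measurable_lebesgueI[OF test_function_borel[OF assms]])
    show "AE x in lebesgue. norm (\<phi> x) \<le> norm (B * indicator (fun_support \<phi>) x)"
      using B fun_support_zero[of _ \<phi>] order_trans[OF B abs_ge_self]
      by (intro AE_I2) (auto simp: indicator_def)
  qed
qed

text \<open>The equation \<open>\<rho> x = of_real (norm (\<rho> x))\<close> says that the values are nonnegative real numbers.\<close>

lemma mollifier_exists:
  assumes "r > 0"
  obtains \<rho> :: "real^'n::finite \<Rightarrow> complex" where "test_function \<rho>"
    "\<And>x. norm x \<ge> r \<Longrightarrow> \<rho> x = 0" "\<And>x. \<rho> x = of_real (norm (\<rho> x))"
    "(LINT x|lebesgue. norm (\<rho> x)) = 1" "(LINT x|lebesgue. \<rho> x) = 1"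
proof -
  define b where "b = (bump r :: real^'n \<Rightarrow> complex)"
  define I where "I = (LINT x|lebesgue. norm (b x))"
  have tb: "test_function b" unfolding b_def by (rule test_function_bump[OF assms])
  have ib: "integrable lebesgue (\<lambda>x. norm (b x))" using test_function_integrable[OF tb] by simp
  have "I \<noteq> 0"
  proof
    assume "I = 0"
    then have "AE x in lebesgue. norm (b x) = 0"
      using integral_nonneg_eq_0_iff_AE[OF ib] unfolding I_def by auto
    then have "AE x in lebesgue. x \<notin> ball (0::real^'n) r"
      by (rule eventually_mono) (use assms in \<open>auto simp: b_def bump_eq_0_iff\<close>)
    then have "negligible (ball (0::real^'n) r)"
      by (simp add: negligible_iff_null_sets AE_iff_null_sets)
    then show False using open_not_negligible[of "ball (0::real^'n) r"] assms by auto
  qed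
  moreover have "I \<ge> 0" unfolding I_def by (intro Bochner_Integration.integral_nonneg) simp
  ultimately have I: "I > 0" by simp
  define \<rho> where "\<rho> x = of_real (1 / I) * b x + 0 * b x" for x
  have nb: "b x = of_real (norm (b x))" for x
    by (simp add: b_def bump_def exp_recip_nonneg)
  have nr: "norm (\<rho> x) = norm (b x) / I" for x using I by (simp add: \<rho>_def norm_mult norm_divide)
  have r: "\<rho> x = of_real (norm (\<rho> x))" for x
    unfolding nr by (subst nb) (simp add: \<rho>_def nb[symmetric])
  have i1: "(LINT x|lebesgue. norm (\<rho> x)) = 1"
    unfolding nr using I ib by (subst integral_divide_zero) (simp add: I_def)
  show ?thesis
  proof
    show "test_function \<rho>" unfolding \<rho>_def by (rule test_function_lin[OF tb tb])
    show "\<rho> x = 0" if "norm x \<ge> r" for x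
      using that assms by (simp add: \<rho>_def b_def bump_eq_0_iff)
    show "\<rho> x = of_real (norm (\<rho> x))" for x by (rule r)
    show "(LINT x|lebesgue. norm (\<rho> x)) = 1" by (rule i1)
    show "(LINT x|lebesgue. \<rho> x) = 1"
    proof -
      have "(LINT x|lebesgue. \<rho> x) = (LINT x|lebesgue. complex_of_real (norm (\<rho> x)))" using r by simp
      also have "\<dots> = 1" unfolding integral_complex_of_real i1 by simp
      finally show ?thesis .
    qed
  qed
qed

text \<open>The cutoff function is the mollified indicator function of a neighbourhood of \<open>K\<close>.\<close>

lemma cutoff_exists:
  fixes K :: "(real^'n::finite) set"
  assumes "compact K" "open W" "K \<subseteq> W"
  obtains \<eta> where "cutoff_for K \<eta>" "fun_support \<eta> \<subseteq> W" "\<And>x. norm (\<eta> x) \<le> 1"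
proof -
  obtain e where e: "e > 0" "(\<Union>x\<in>K. ball x e) \<subseteq> W"
    using compact_subset_open_imp_ball_epsilon_subset[OF assms] by blast
  \<comment> \<open>The indicator function of the \<open>2 r\<close>-neighbourhood of \<open>K\<close>, mollified at scale \<open>r\<close>, is 1 on the \<open>r\<close>-neighbourhood and 0 off the \<open>3 r\<close>-neighbourhood, whose closure lies within the \<open>4 r\<close>-neighbourhood.\<close>
  define r where "r = e / 4"
  have r: "r > 0" using e by (simp add: r_def)
  obtain \<rho> :: "real^'n \<Rightarrow> complex" where \<rho>: "test_function \<rho>"
    "\<And>x. norm x \<ge> r \<Longrightarrow> \<rho> x = 0" "\<And>x. \<rho> x = of_real (norm (\<rho> x))"
    "(LINT x|lebesgue. norm (\<rho> x)) = 1" "(LINT x|lebesgue. \<rho> x) = 1"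
    using mollifier_exists[OF r] by metis
  define A where "A = (\<Union>x\<in>K. ball x (2 * r))"
  define g where "g = (\<lambda>x::real^'n. complex_of_real (indicator A x))"
  have A: "open A" unfolding A_def by auto
  have [measurable]: "A \<in> sets borel" using A by (rule borel_open)
  have gm [measurable]: "g \<in> borel_measurable borel" unfolding g_def by measurable
  have \<rho>m: "\<rho> \<in> borel_measurable borel" by (rule test_function_borel[OF \<rho>(1)])
  have gi: "set_integrable lebesgue (cball 0 R) g" for R
  proof -
    have "integrable lebesgue (indicator (cball (0::real^'n) R) :: real^'n \<Rightarrow> real)"
      by (intro integrable_real_indicator) (auto simp: emeasure_lborel_cball_finite[unfolded infinity_ennreal_def])
    moreover have "(\<lambda>x. indicator (cball 0 R) x *\<^sub>R g x) \<in> borel_measurable lebesgue"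
      by (intro borel_measurable_lebesgueI borel_measurable_scaleR borel_measurable_indicator borel_closed closed_cball gm)
    ultimately show ?thesis unfolding set_integrable_def
      by (rule Bochner_Integration.integrable_bound) (auto simp: g_def indicator_def)
  qed
  define \<eta> where "\<eta> = convol \<rho> g"
  have \<eta>: "\<eta> z = (LINT v|lebesgue. \<rho> (z - v) * g v)" for z
    unfolding \<eta>_def by (rule convol_commute[OF \<rho>m]) simp
  have refl: "(LINT v|lebesgue. \<rho> (z - v)) = 1" "(LINT v|lebesgue. norm (\<rho> (z - v))) = 1" for z
  proof -
    show 1: "(LINT v|lebesgue. \<rho> (z - v)) = 1" using integral_reflect[OF \<rho>m, of z] \<rho>(5) by simp
    have "complex_of_real (LINT v|lebesgue. norm (\<rho> (z - v))) = (LINT v|lebesgue. \<rho> (z - v))"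
      unfolding integral_complex_of_real[symmetric] using \<rho>(3) by simp
    then show "(LINT v|lebesgue. norm (\<rho> (z - v))) = 1" unfolding 1 by (simp only: of_real_eq_1_iff)
  qed
  have int: "integrable lebesgue (\<lambda>v. \<rho> (z - v))" for z
    using refl(1)[of z] not_integrable_integral_eq[of lebesgue "\<lambda>v. \<rho> (z - v)"] by auto
  define C where "C = closure (\<Union>x\<in>K. ball x (3 * r))"
  have zero: "\<eta> z = 0" if "z \<notin> C" for z
  proof -
    have "\<rho> (z - v) * g v = 0" for v
    proof (rule ccontr)
      assume "\<rho> (z - v) * g v \<noteq> 0"
      then have "\<not> norm (z - v) \<ge> r" "v \<in> A" using \<rho>(2)[of "z - v"] by (auto simp: g_def indicator_def split: if_splits)
      then obtain x where "x \<in> K" "dist x v < 2 * r" "dist v z < r"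
        by (auto simp: A_def dist_norm norm_minus_commute)
      then have "z \<in> (\<Union>x\<in>K. ball x (3 * r))"
        using dist_triangle[of x z v] by (intro UN_I[of x]) auto
      then have "z \<in> C" unfolding C_def by (rule subsetD[OF closure_subset])
      then show False using that by simp
    qed
    then have "(\<lambda>v. \<rho> (z - v) * g v) = (\<lambda>v. 0)" by (rule ext)
    then show ?thesis unfolding \<eta> by simp
  qed
  obtain b where "\<forall>x\<in>K. norm x \<le> b" using compact_imp_bounded[OF assms(1)] unfolding bounded_iff by (rule exE)
  then have b: "norm x \<le> b" if "x \<in> K" for x using that by blast
  have "bounded (\<Union>x\<in>K. ball x (3 * r))"
    unfolding bounded_iff
  proof (intro exI[of _ "b + 3 * r"] ballI)
    fix y assume "y \<in> (\<Union>x\<in>K. ball x (3 * r))"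
    then obtain x where "x \<in> K" "dist x y < 3 * r" by auto
    then show "norm y \<le> b + 3 * r" using b[of x] norm_triangle_ineq2[of y x]
      by (simp add: dist_norm norm_minus_commute)
  qed
  then have C: "compact C" unfolding C_def by simp
  have CW: "C \<subseteq> W"
  proof
    fix z assume "z \<in> C"
    then have "\<exists>y\<in>(\<Union>x\<in>K. ball x (3 * r)). dist y z < r"
      using r unfolding C_def closure_approachable by simp
    then obtain y where "y \<in> (\<Union>x\<in>K. ball x (3 * r))" "dist y z < r" by (rule bexE)
    then obtain x where "x \<in> K" "dist x y < 3 * r" by auto
    then have "z \<in> (\<Union>x\<in>K. ball x e)"
      using dist_triangle[of x z y] \<open>dist y z < r\<close> by (intro UN_I[of x]) (auto simp: r_def)
    then show "z \<in> W" using e by blast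
  qed
  have sm: "smooth \<eta>" unfolding \<eta>_def by (rule pderivs_convol(1)[OF \<rho>(1) _ gi]) simp
  show ?thesis
  proof
    have "\<eta> z = 1" if z: "z \<in> (\<Union>x\<in>K. ball x r)" for z
    proof -
      have "\<rho> (z - v) * g v = \<rho> (z - v)" for v
      proof (cases "norm (z - v) \<ge> r")
        case False
        obtain x where "x \<in> K" "dist x z < r" using z by auto
        then have "v \<in> A" unfolding A_def using False dist_triangle[of x v z]
          by (intro UN_I[of x]) (auto simp: dist_norm)
        then show ?thesis by (simp add: g_def)
      qed (use \<rho>(2) in auto)
      then have "(\<lambda>v. \<rho> (z - v) * g v) = (\<lambda>v. \<rho> (z - v))" by (rule ext)
      then show ?thesis unfolding \<eta> using refl(1)[of z] by simp
    qed
    moreover have "open (\<Union>x\<in>K. ball x r)" "K \<subseteq> (\<Union>x\<in>K. ball x r)" using r by auto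
    ultimately have "\<exists>V. open V \<and> K \<subseteq> V \<and> (\<forall>x\<in>V. \<eta> x = 1)" by (intro exI conjI ballI)
    then show "cutoff_for K \<eta>" unfolding cutoff_for_def
      using test_functionI[OF sm C zero] by (intro conjI)
    show "fun_support \<eta> \<subseteq> W" by (rule order_trans[OF fun_support_subset[OF compact_imp_closed[OF C] zero] CW])
    show "norm (\<eta> z) \<le> 1" for z
    proof -
      have "norm (\<eta> z) \<le> (LINT v|lebesgue. norm (\<rho> (z - v) * g v))"
        unfolding \<eta> by (rule integral_norm_bound)
      also have "\<dots> \<le> (LINT v|lebesgue. norm (\<rho> (z - v)))"
        using int[of z] by (intro integral_mono') (auto simp: g_def norm_mult indicator_def)
      finally show ?thesis using refl by simp
    qed
  qed
qed

lemma cutoff_forD: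
  "cutoff_for K \<eta> \<Longrightarrow> test_function \<eta>"
  "cutoff_for K \<eta> \<Longrightarrow> x \<in> K \<Longrightarrow> \<eta> x = 1"
  by (auto simp: cutoff_for_def)

text \<open>Split \<open>\<phi> = b \<phi> + (1 - b) \<phi>\<close> for one \<open>b \<in> I\<close>. The distribution kills the first part, and the second
  part vanishes where \<open>b = 1\<close>, so that the remaining members of \<open>I\<close> serve for it.\<close>

lemma distribution_partition:
  assumes u: "distribution u" and I: "finite I"
    and b: "\<And>b. b \<in> I \<Longrightarrow> test_function b"
       "\<And>b \<phi>. b \<in> I \<Longrightarrow> test_function \<phi> \<Longrightarrow> u (\<lambda>x. b x * \<phi> x) = 0"
    and \<phi>: "test_function \<phi>" "\<And>x. \<phi> x \<noteq> 0 \<Longrightarrow> \<exists>b\<in>I. b x = 1"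
  shows "u \<phi> = 0"
  using I b \<phi>
proof (induction I arbitrary: \<phi> rule: finite_induct)
  case empty
  then have "\<phi> = (\<lambda>x. 0)" by auto
  then show ?case using distribution_zero[OF u] by simp
next
  case (insert b I)
  have tb: "test_function b" and ub: "u (\<lambda>x. b x * \<phi> x) = 0" using insert.prems by auto
  have t1: "test_function (\<lambda>x. b x * \<phi> x)"
    by (rule test_function_mult[OF tb open_UNIV subset_UNIV test_function_smooth_on[OF insert.prems(3) open_UNIV]])
  define \<psi> where "\<psi> x = 1 * \<phi> x + (-1) * (b x * \<phi> x)" for x
  have "test_function \<psi>" unfolding \<psi>_def by (rule test_function_lin[OF insert.prems(3) t1])
  moreover have "\<exists>c\<in>I. c x = 1" if "\<psi> x \<noteq> 0" for x
  proof -
    have "\<phi> x \<noteq> 0" "b x \<noteq> 1" using that by (auto simp: \<psi>_def)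
    then show ?thesis using insert.prems(4)[of x] by auto
  qed
  ultimately have "u \<psi> = 0" using insert.IH insert.prems by auto
  moreover have "u \<psi> = 1 * u \<phi> + (-1) * u (\<lambda>x. b x * \<phi> x)"
    unfolding \<psi>_def by (rule distribution_lin[OF u insert.prems(3) t1])
  ultimately show ?case using ub by simp
qed

text \<open>Around every point off the support there is a cutoff function \<open>b\<close> such that \<open>u\<close> kills all
  multiples of \<open>b\<close>. Finitely many of them suffice for the compact support of \<open>\<phi>\<close>.\<close>

lemma distribution_zero_off_support:
  fixes u :: "(real^'n::finite \<Rightarrow> complex) \<Rightarrow> complex"
  assumes u: "distribution u" and \<phi>: "test_function \<phi>" and disj: "fun_support \<phi> \<inter> dist_support u = {}"
  shows "u \<phi> = 0"
proof -
  have "\<exists>b V. test_function b \<and> open V \<and> x \<in> V \<and> (\<forall>y\<in>V. b y = 1) \<and>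
      (\<forall>\<psi>. test_function \<psi> \<longrightarrow> u (\<lambda>x. b x * \<psi> x) = 0)" if x: "x \<in> fun_support \<phi>" for x
  proof -
    obtain W where W: "open W" "x \<in> W" "dist_zero_on u W"
      using x disj unfolding dist_support_def by blast
    have "compact {x}" "{x} \<subseteq> W" using W by auto
    then have "\<exists>b. cutoff_for {x} b \<and> fun_support b \<subseteq> W"
      by (rule cutoff_exists[OF _ W(1)]) (rule exI conjI | assumption)+
    then obtain b where b: "cutoff_for {x} b" "fun_support b \<subseteq> W" by blast
    obtain V where V: "open V" "x \<in> V" "\<forall>y\<in>V. b y = 1" using b(1) by (auto simp: cutoff_for_def)
    have "u (\<lambda>x. b x * \<psi> x) = 0" if \<psi>: "test_function \<psi>" for \<psi>
    proof -
      have "test_function (\<lambda>x. b x * \<psi> x)"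
        by (rule test_function_mult[OF cutoff_forD(1)[OF b(1)] open_UNIV subset_UNIV test_function_smooth_on[OF \<psi> open_UNIV]])
      moreover have "fun_support (\<lambda>x. b x * \<psi> x) \<subseteq> W"
        using fun_support_subset[OF closed_fun_support, of b "\<lambda>x. b x * \<psi> x"] fun_support_zero[of _ b] b(2) by auto
      ultimately show ?thesis using W(3) by (simp add: dist_zero_on_def)
    qed
    then show ?thesis using V cutoff_forD(1)[OF b(1)] by blast
  qed
  then have "\<forall>x\<in>fun_support \<phi>. \<exists>p. test_function (fst p) \<and> open (snd p) \<and> x \<in> snd p \<and>
      (\<forall>y\<in>snd p. fst p y = 1) \<and> (\<forall>\<psi>. test_function \<psi> \<longrightarrow> u (\<lambda>x. fst p x * \<psi> x) = 0)"
    by simp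
  then obtain p where p: "\<forall>x\<in>fun_support \<phi>. test_function (fst (p x)) \<and> open (snd (p x)) \<and> x \<in> snd (p x) \<and>
      (\<forall>y\<in>snd (p x). fst (p x) y = 1) \<and> (\<forall>\<psi>. test_function \<psi> \<longrightarrow> u (\<lambda>y. fst (p x) y * \<psi> y) = 0)"
    by (rule bchoice[THEN exE])
  define b where "b x = fst (p x)" for x
  define V where "V x = snd (p x)" for x
  have bV: "\<And>x. x \<in> fun_support \<phi> \<Longrightarrow> test_function (b x)"
    "\<And>x. x \<in> fun_support \<phi> \<Longrightarrow> open (V x)" "\<And>x. x \<in> fun_support \<phi> \<Longrightarrow> x \<in> V x"
    "\<And>x y. x \<in> fun_support \<phi> \<Longrightarrow> y \<in> V x \<Longrightarrow> b x y = 1"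
    "\<And>x \<psi>. x \<in> fun_support \<phi> \<Longrightarrow> test_function \<psi> \<Longrightarrow> u (\<lambda>y. b x y * \<psi> y) = 0"
    using p unfolding b_def V_def by auto
  obtain X where X: "X \<subseteq> fun_support \<phi>" "finite X" "fun_support \<phi> \<subseteq> (\<Union>x\<in>X. V x)"
    by (rule compactE_image[OF test_function_compact[OF \<phi>], of "fun_support \<phi>" V]) (use bV(2,3) in auto)
  show ?thesis
  proof (rule distribution_partition[OF u finite_imageI[OF X(2)] _ _ \<phi>])
    show "\<exists>c\<in>b ` X. c x = 1" if "\<phi> x \<noteq> 0" for x
    proof -
      have "x \<in> fun_support \<phi>" using that fun_support_zero[of x \<phi>] by auto
      then obtain z where "z \<in> X" "x \<in> V z" using X(3) by blast
      then show ?thesis using bV(4)[of z x] X(1) by auto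
    qed
  qed (use bV X(1) in auto)
qed

text \<open>This makes \<open>dist_extend\<close> independent of the choice of the cutoff function.\<close>

lemma distribution_eq_near_support:
  assumes u: "distribution u" and \<phi>: "test_function \<phi>" and \<psi>: "test_function \<psi>"
    and V: "open V" "dist_support u \<subseteq> V" "\<And>x. x \<in> V \<Longrightarrow> \<phi> x = \<psi> x"
  shows "u \<phi> = u \<psi>"
proof -
  define w where "w x = 1 * \<phi> x + (-1) * \<psi> x" for x
  have t: "test_function w" unfolding w_def by (rule test_function_lin[OF \<phi> \<psi>])
  have "fun_support w \<subseteq> - V" by (rule fun_support_subset) (use V in \<open>auto simp: w_def\<close>)
  then have "u w = 0" using V by (intro distribution_zero_off_support[OF u t]) auto
  moreover have "u w = 1 * u \<phi> + (-1) * u \<psi>" unfolding w_def by (rule distribution_lin[OF u \<phi> \<psi>])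
  ultimately show ?thesis by simp
qed

section \<open>Zero sets of positive measure\<close>

text \<open>A rational number just to the left of each point, within half the isolation radius, determines
  the point.\<close>

lemma countable_isolated_real:
  fixes Z :: "real set"
  assumes "\<And>t. t \<in> Z \<Longrightarrow> \<exists>d>0. \<forall>s\<in>Z. \<bar>s - t\<bar> < d \<longrightarrow> s = t"
  shows "countable Z"
proof -
  obtain d where d: "\<And>t. t \<in> Z \<Longrightarrow> d t > 0 \<and> (\<forall>s\<in>Z. \<bar>s - t\<bar> < d t \<longrightarrow> s = t)"
    using assms by metis
  have "\<exists>q. q \<in> \<rat> \<and> t - d t / 2 < q \<and> q < t" if "t \<in> Z" for t
    using Rats_dense_in_real[of "t - d t / 2" t] d[OF that] by auto
  then obtain q where q: "\<And>t. t \<in> Z \<Longrightarrow> q t \<in> \<rat> \<and> t - d t / 2 < q t \<and> q t < t" by metis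
  have le: "s \<le> t" if "s \<in> Z" "t \<in> Z" "q s = q t" for s t
  proof (rule ccontr)
    assume "\<not> s \<le> t"
    moreover have "s - d s / 2 < q t" "q t < t" using q[OF that(1)] q[OF that(2)] that(3) by auto
    ultimately have "\<bar>t - s\<bar> < d s" using d[OF that(1)] by linarith
    then show False using d[OF that(1)] that(2) \<open>\<not> s \<le> t\<close> by auto
  qed
  have "inj_on q Z" by (rule inj_onI) (metis le order_antisym)
  moreover have "countable (q ` Z)" using q countable_rat by (meson countable_subset image_subsetI)
  ultimately show ?thesis using countable_image_inj_on by blast
qed

text \<open>On every line in direction \<open>v\<close> the zeros at which the derivative along the line does not vanish
  are isolated, hence countable. By Fubini's theorem, applied to the translates of the set of these
  zeros along \<open>v\<close>, that set is a null set. So a function that vanishes almost everywhere on a set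
  has there almost everywhere vanishing derivatives, whatever the set looks like.\<close>

lemma null_zeros_with_nonzero_derivative:
  fixes G G' :: "real^'n::finite \<Rightarrow> complex"
  assumes B: "open B" and G: "continuous_on B G" and G': "continuous_on B G'"
    and der: "\<And>x. x \<in> B \<Longrightarrow> ((\<lambda>t. G (x + t *\<^sub>R v)) has_vector_derivative G' x) (at 0)"
  shows "AE x in lebesgue. x \<in> B \<and> G x = 0 \<longrightarrow> G' x = 0"
proof -
  define Z where "Z = {x \<in> B. G x = 0 \<and> G' x \<noteq> 0}"
  have Bm[measurable]: "B \<in> sets borel" using B by (rule borel_open)
  have Zm[measurable]: "Z \<in> sets borel"
  proof -
    have [measurable]: "(\<lambda>x. indicator B x *\<^sub>R G x) \<in> borel_measurable borel"
      "(\<lambda>x. indicator B x *\<^sub>R G' x) \<in> borel_measurable borel"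
      using G G' Bm by (auto intro: borel_measurable_continuous_on_indicator)
    have "Z = B \<inter> {x \<in> space borel. indicator B x *\<^sub>R G x = 0} \<inter> {x \<in> space borel. indicator B x *\<^sub>R G' x \<noteq> 0}"
      by (auto simp: Z_def)
    also have "\<dots> \<in> sets borel" by measurable
    finally show ?thesis .
  qed
  define \<tau> where "\<tau> x = {t. x + t *\<^sub>R v \<in> Z}" for x
  have count: "countable (\<tau> x)" for x
  proof (rule countable_isolated_real)
    fix t assume t: "t \<in> \<tau> x"
    define y where "y = x + t *\<^sub>R v"
    have y: "y \<in> B" "G y = 0" "G' y \<noteq> 0" using t by (auto simp: \<tau>_def Z_def y_def)
    define c where "c = norm (G' y)"
    have c: "c > 0" using y by (simp add: c_def)
    have "((\<lambda>h. norm (G (y + (0 + h) *\<^sub>R v) - G (y + 0 *\<^sub>R v) - h *\<^sub>R G' y) / norm h) \<longlongrightarrow> 0) (at 0)"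
      using der[OF y(1)] unfolding has_vector_derivative_def has_derivative_at by (rule conjunct2)
    then have "\<forall>\<^sub>F h in at 0. norm (G (y + (0 + h) *\<^sub>R v) - G (y + 0 *\<^sub>R v) - h *\<^sub>R G' y) / norm h < c"
      using c by (rule order_tendstoD)
    then obtain d where d: "d > 0"
      "\<And>h. h \<noteq> 0 \<Longrightarrow> \<bar>h\<bar> < d \<Longrightarrow> norm (G (y + h *\<^sub>R v) - G y - h *\<^sub>R G' y) / \<bar>h\<bar> < c"
      by (auto simp: eventually_at dist_real_def)
    show "\<exists>d>0. \<forall>s\<in>\<tau> x. \<bar>s - t\<bar> < d \<longrightarrow> s = t"
    proof (intro exI[of _ d] conjI ballI impI)
      fix s assume s: "s \<in> \<tau> x" "\<bar>s - t\<bar> < d"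
      have "y + (s - t) *\<^sub>R v = x + s *\<^sub>R v" by (simp add: y_def algebra_simps)
      then have "G (y + (s - t) *\<^sub>R v) = 0" using s(1) by (simp add: \<tau>_def Z_def)
      then show "s = t" using d(2)[of "s - t"] s(2) y(2) by (auto simp: c_def)
    qed (rule d)
  qed
  have null: "(\<integral>\<^sup>+t. indicator {0..1} t * indicator Z (x + t *\<^sub>R v) \<partial>lborel) = 0" for x
  proof -
    have "AE t in lborel. t \<notin> \<tau> x"
      using countable_imp_null_set_lborel[OF count[of x]] by (rule AE_not_in)
    then have "AE t in lborel. (indicator {0..1} t * indicator Z (x + t *\<^sub>R v) :: ennreal) = 0"
      by (rule eventually_mono) (auto simp: \<tau>_def)
    then show ?thesis by (subst nn_integral_0_iff_AE) auto
  qed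
  have trans: "(\<integral>\<^sup>+x. indicator Z (x + a) \<partial>lborel) = emeasure lborel Z" for a
  proof -
    have "emeasure lborel Z = (\<integral>\<^sup>+x. indicator Z x \<partial>distr lborel borel ((+) a))"
      unfolding lborel_distr_plus by simp
    also have "\<dots> = (\<integral>\<^sup>+x. indicator Z (a + x) \<partial>lborel)"
      by (subst nn_integral_distr) auto
    finally show ?thesis by (simp add: add.commute)
  qed
  have m: "case_prod (\<lambda>(t::real) x. indicator {0..1} t * indicator Z (x + t *\<^sub>R v) :: ennreal) \<in> borel_measurable (lborel \<Otimes>\<^sub>M lborel)"
    by measurable
  \<comment> \<open>Integrated over \<open>x\<close> first, each translate of \<open>Z\<close> contributes the full measure of \<open>Z\<close>; the parameter interval has length 1.\<close>
  have "0 = (\<integral>\<^sup>+x. (\<integral>\<^sup>+t. indicator {0..1} t * indicator Z (x + t *\<^sub>R v) \<partial>lborel) \<partial>lborel)"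
    by (simp add: null)
  also have "\<dots> = (\<integral>\<^sup>+t. (\<integral>\<^sup>+x. indicator {0..1} t * indicator Z (x + t *\<^sub>R v) \<partial>lborel) \<partial>lborel)"
    by (rule lborel_pair.Fubini'[OF m])
  also have "\<dots> = (\<integral>\<^sup>+t. indicator {0..1} t * emeasure lborel Z \<partial>(lborel :: real measure))"
    by (subst nn_integral_cmult) (auto simp: trans)
  also have "\<dots> = emeasure lborel Z"
    by (subst nn_integral_multc) auto
  finally have "Z \<in> null_sets lborel" by auto
  then have "AE x in lebesgue. x \<notin> Z" by (intro AE_completion AE_not_in)
  then show ?thesis by (rule eventually_mono) (auto simp: Z_def)
qed

section \<open>Functions with vanishing integrals over compact sets\<close>

text \<open>Otherwise inner regularity yields a compact set of positive measure on which \<open>g\<close> is positive, and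
  the integral over it is not zero.\<close>

lemma AE_nonpos_if_compact_integrals_0:
  fixes g :: "real^'n::finite \<Rightarrow> real"
  assumes g: "(\<lambda>x. indicator B x *\<^sub>R g x) \<in> borel_measurable lebesgue" and B: "B \<in> sets lebesgue"
    and int: "\<And>C. compact C \<Longrightarrow> C \<subseteq> B \<Longrightarrow> set_integrable lebesgue C g"
    and zero: "\<And>C. compact C \<Longrightarrow> C \<subseteq> B \<Longrightarrow> (LINT x:C|lebesgue. g x) = 0"
  shows "AE x in lebesgue. x \<in> B \<longrightarrow> g x \<le> 0"
proof -
  define P where "P m = {x \<in> B. g x > 0} \<inter> cball 0 (real m)" for m
  have Pm: "P m \<in> sets lebesgue" for m
  proof -
    have "P m = B \<inter> {x \<in> space lebesgue. indicator B x *\<^sub>R g x > 0} \<inter> cball 0 (real m)"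
      by (auto simp: P_def)
    also have "\<dots> \<in> sets lebesgue"
    proof -
      have "{x \<in> space lebesgue. indicator B x *\<^sub>R g x > 0} \<in> sets lebesgue" using g by measurable
      then show ?thesis using B by (intro sets.Int) auto
    qed
    finally show ?thesis .
  qed
  have "emeasure lebesgue (P m) = 0" for m
  proof (rule ccontr)
    assume "emeasure lebesgue (P m) \<noteq> 0"
    moreover have fin: "emeasure lebesgue (P m) < \<infinity>"
    proof -
      have "emeasure lebesgue (P m) \<le> emeasure lebesgue (cball (0::real^'n) (real m))"
        by (rule emeasure_mono) (auto simp: P_def)
      also have "\<dots> < \<infinity>" using emeasure_lborel_cball_finite by simp
      finally show ?thesis .
    qed
    ultimately obtain e where e: "e > 0" "emeasure lebesgue (P m) = ennreal e"
      by (cases "emeasure lebesgue (P m)") (auto simp: less_le)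
    obtain T where T: "closed T" "T \<subseteq> P m" "P m - T \<in> lmeasurable" "emeasure lebesgue (P m - T) < ennreal e"
      using sets_lebesgue_inner_closed[OF Pm e(1)] by metis
    have cT: "compact T" using T(1,2) unfolding P_def compact_eq_bounded_closed
      by (metis bounded_cball bounded_subset inf.boundedE)
    have TB: "T \<subseteq> B" using T(2) by (auto simp: P_def)
    have i: "integrable lebesgue (\<lambda>x. indicator T x *\<^sub>R g x)" using int[OF cT TB] by (simp add: set_integrable_def)
    have "AE x in lebesgue. indicator T x *\<^sub>R g x = 0"
      using zero[OF cT TB] T(2) integral_nonneg_eq_0_iff_AE[OF i]
      by (force simp: set_lebesgue_integral_def P_def indicator_def)
    then have "AE x in lebesgue. x \<notin> T"
      by (rule eventually_mono) (use T(2) in \<open>auto simp: P_def\<close>)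
    moreover have "T \<in> sets lebesgue" using T(1) by simp
    ultimately have T0: "emeasure lebesgue T = 0" using AE_iff_null_sets by blast
    have "P m = (P m - T) \<union> T" using T(2) by auto
    then have "emeasure lebesgue (P m) \<le> emeasure lebesgue (P m - T) + emeasure lebesgue T"
      using emeasure_subadditive[of "P m - T" lebesgue T] T(3) \<open>T \<in> sets lebesgue\<close> by (auto simp: fmeasurable_def)
    then show False using T0 T(4) e(2) by auto
  qed
  then have "P m \<in> null_sets lebesgue" for m using Pm by auto
  then have "(\<Union>m. P m) \<in> null_sets lebesgue" by (rule null_sets_UN)
  then have "AE x in lebesgue. x \<notin> (\<Union>m. P m)" by (rule AE_not_in)
  then show ?thesis
  proof (rule eventually_mono)
    fix x assume x: "x \<notin> (\<Union>m. P m)"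
    obtain m where "norm x \<le> real m" using real_arch_simple by blast
    then show "x \<in> B \<longrightarrow> g x \<le> 0" using x by (auto simp: P_def not_less[symmetric])
  qed
qed

lemma AE_zero_if_compact_integrals_0:
  fixes g :: "real^'n::finite \<Rightarrow> complex"
  assumes g: "(\<lambda>x. indicator B x *\<^sub>R g x) \<in> borel_measurable lebesgue" and B: "B \<in> sets lebesgue"
    and int: "\<And>C. compact C \<Longrightarrow> C \<subseteq> B \<Longrightarrow> set_integrable lebesgue C g"
    and zero: "\<And>C. compact C \<Longrightarrow> C \<subseteq> B \<Longrightarrow> (LINT x:C|lebesgue. g x) = 0"
  shows "AE x in lebesgue. x \<in> B \<longrightarrow> g x = 0"
proof -
  have part: "AE x in lebesgue. x \<in> B \<longrightarrow> L (g x) \<le> 0" if L: "bounded_linear L" for L :: "complex \<Rightarrow> real"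
  proof -
    interpret L: bounded_linear L by (rule L)
    have e: "indicator A x *\<^sub>R L (g x) = L (indicator A x *\<^sub>R g x)" for A x by (simp add: L.scaleR)
    show ?thesis
    proof (rule AE_nonpos_if_compact_integrals_0[OF _ B])
      have "L \<in> borel_measurable borel" by (intro borel_measurable_continuous_onI L.continuous_on continuous_on_id)
      then show "(\<lambda>x. indicator B x *\<^sub>R L (g x)) \<in> borel_measurable lebesgue"
        unfolding e using g by (rule measurable_compose[rotated])
      fix C assume C: "compact C" "C \<subseteq> B"
      show "set_integrable lebesgue C (\<lambda>x. L (g x))"
        using integrable_bounded_linear[OF L int[OF C, unfolded set_integrable_def]] unfolding set_integrable_def e .
      show "(LINT x:C|lebesgue. L (g x)) = 0"
        using integral_bounded_linear[OF L int[OF C, unfolded set_integrable_def]] zero[OF C]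
        unfolding set_lebesgue_integral_def e by (simp only: L.zero)
    qed
  qed
  have "AE x in lebesgue. x \<in> B \<longrightarrow> Re (g x) \<le> 0" "AE x in lebesgue. x \<in> B \<longrightarrow> - Re (g x) \<le> 0"
    "AE x in lebesgue. x \<in> B \<longrightarrow> Im (g x) \<le> 0" "AE x in lebesgue. x \<in> B \<longrightarrow> - Im (g x) \<le> 0"
    by (rule part; intro bounded_linear_minus bounded_linear_Re bounded_linear_Im)+
  then show ?thesis by eventually_elim (auto simp: complex_eq_iff)
qed

section \<open>Integrability of powers of the norm\<close>

text \<open>The integrand is dominated by a series of multiples of indicator functions of balls. Applied to
  dyadic layers, this gives the integrability of powers of the norm without polar coordinates.\<close>

lemma integrable_of_ball_layers:
  fixes f :: "real^'n::finite \<Rightarrow> real"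
  assumes f: "f \<in> borel_measurable borel" and S: "S \<in> sets borel" and f0: "\<And>x. f x \<ge> 0"
    and lay: "\<And>x. x \<in> S \<Longrightarrow> f x \<noteq> 0 \<Longrightarrow> \<exists>j. norm x \<le> b j \<and> f x \<le> m j"
    and b: "\<And>j::nat. b j \<ge> 0" and m: "\<And>j. m j \<ge> 0"
    and sum: "summable (\<lambda>j. m j * b j ^ CARD('n))"
  shows "set_integrable lebesgue S f"
proof -
  define V where "V = unit_ball_vol (real CARD('n))"
  have V: "V \<ge> 0" by (simp add: V_def)
  have "(\<integral>\<^sup>+x. ennreal (indicator S x * f x) \<partial>lborel)
      \<le> (\<integral>\<^sup>+x. (\<Sum>j. ennreal (m j) * indicator (cball (0::real^'n) (b j)) x) \<partial>lborel)"
  proof (rule nn_integral_mono)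
    fix x
    show "ennreal (indicator S x * f x) \<le> (\<Sum>j. ennreal (m j) * indicator (cball (0::real^'n) (b j)) x)"
    proof (cases "x \<in> S \<and> f x \<noteq> 0")
      case True
      then obtain j where j: "norm x \<le> b j" "f x \<le> m j" using lay by blast
      have "ennreal (indicator S x * f x) \<le> ennreal (m j) * indicator (cball (0::real^'n) (b j)) x"
        using True j by (simp add: ennreal_leI)
      also have "\<dots> \<le> (\<Sum>j. ennreal (m j) * indicator (cball (0::real^'n) (b j)) x)"
        using sum_le_suminf[of "\<lambda>j. ennreal (m j) * indicator (cball (0::real^'n) (b j)) x" "{j}"]
        by (simp only: summableI finite.intros sum.insert[OF finite.emptyI] sum.empty empty_iff not_False_eq_True add_0_right simp_thms zero_le)
      finally show ?thesis .
    qed auto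
  qed
  also have "\<dots> = (\<Sum>j. \<integral>\<^sup>+x. ennreal (m j) * indicator (cball (0::real^'n) (b j)) x \<partial>lborel)"
    by (rule nn_integral_suminf) (intro borel_measurable_times_ennreal borel_measurable_const borel_measurable_indicator, simp)
  also have "\<dots> = (\<Sum>j. ennreal (m j * (V * b j ^ CARD('n))))"
    using b m by (intro arg_cong[where f = suminf] ext)
      (simp add: nn_integral_cmult_indicator emeasure_cball V_def ennreal_mult)
  also have "\<dots> < \<infinity>"
  proof -
    have "summable (\<lambda>j. m j * (V * b j ^ CARD('n)))"
      using summable_mult[OF sum, of V] by (simp add: mult_ac)
    then show ?thesis using b m V by (subst suminf_ennreal2) auto
  qed
  finally have fin: "(\<integral>\<^sup>+x. ennreal (indicator S x * f x) \<partial>lborel) < \<infinity>" .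
  have "integrable lborel (\<lambda>x. indicator S x * f x)"
    using fin f0 S f by (intro integrableI_nonneg) auto
  then show ?thesis using S f unfolding set_integrable_def
    by (subst integrable_completion) auto
qed

lemma power_powr: "c > 0 \<Longrightarrow> (c ^ k) powr a = (c powr a) ^ k" for c a :: real
  by (simp add: powr_realpow[symmetric] powr_powr powr_power mult.commute)

lemma norm_powr_integrable_cball:
  fixes a :: real
  assumes a: "a < 0" "a + real CARD('n::finite) > 0" and R: "R > 0"
  shows "set_integrable lebesgue (cball 0 R) (\<lambda>x::real^'n. norm x powr a)"
proof (rule integrable_of_ball_layers[where b = "\<lambda>j. R * (1/2) ^ j" and m = "\<lambda>j. (R * (1/2) ^ Suc j) powr a"])
  let ?n = "CARD('n)"
  have q: "(1/2::real) powr (a + real ?n) < 1" using a(2) powr_less_mono'[of "1/2" 0 "a + real ?n"] by simp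
  have "(R * (1/2) ^ Suc j) powr a * (R * (1/2) ^ j) ^ ?n
     = (R powr a * (1/2) powr a * R ^ ?n) * ((1/2) powr (a + real ?n)) ^ j" for j
  proof -
    have "(R * (1/2) ^ Suc j) powr a = R powr a * (1/2) powr a * ((1/2) powr a) ^ j"
      using R power_powr[of "1/2" "Suc j" a] by (simp only: powr_mult power_Suc mult.assoc)
    moreover have "((1/2::real) ^ j) ^ ?n = ((1/2) powr real ?n) ^ j"
      by (simp add: powr_realpow power_mult[symmetric] mult.commute)
    ultimately show ?thesis by (simp add: power_mult_distrib powr_add mult_ac)
  qed
  then show "summable (\<lambda>j. (R * (1/2) ^ Suc j) powr a * (R * (1/2) ^ j) ^ ?n)"
    using q by (simp add: summable_mult summable_geometric)
  show "\<exists>j. norm x \<le> R * (1/2) ^ j \<and> norm x powr a \<le> (R * (1/2) ^ Suc j) powr a"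
    if "x \<in> cball 0 R" "norm x powr a \<noteq> 0" for x :: "real^'n"
  proof -
    have x: "norm x > 0" "norm x \<le> R" using that by auto
    \<comment> \<open>The least exponent below locates the dyadic layer that contains \<open>x\<close>.\<close>
    have "\<exists>j. (1/2) ^ j < norm x / R" using x R by (intro real_arch_pow_inv) auto
    then obtain j0 where j0: "R * (1/2) ^ j0 < norm x" using R by (auto simp: field_simps)
    define k where "k = (LEAST j. R * (1/2) ^ j < norm x)"
    have k: "R * (1/2) ^ k < norm x" unfolding k_def by (rule LeastI[of "\<lambda>j. R * (1/2) ^ j < norm x", OF j0])
    then obtain j where j: "k = Suc j" using x by (cases k) auto
    have "\<not> R * (1/2) ^ j < norm x" using not_less_Least[of j "\<lambda>j. R * (1/2) ^ j < norm x"] j by (simp add: k_def)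
    moreover have "norm x powr a \<le> (R * (1/2) ^ Suc j) powr a"
      using k j a R by (intro powr_mono2') auto
    ultimately show ?thesis by (intro exI[of _ j]) auto
  qed
qed (use R in auto)

lemma norm_powr_integrable_outside:
  fixes a :: real
  assumes a: "a + real CARD('n::finite) < 0" and r: "r > 0"
  shows "set_integrable lebesgue {x. norm x \<ge> r} (\<lambda>x::real^'n. norm x powr a)"
proof (rule integrable_of_ball_layers[where b = "\<lambda>j. r * 2 ^ Suc j" and m = "\<lambda>j. (r * 2 ^ j) powr a"])
  let ?n = "CARD('n)"
  have a0: "a < 0" using a by linarith
  have q: "(2::real) powr (a + real ?n) < 1" using a powr_less_mono[of "a + real ?n" 0 2] by simp
  have "(r * 2 ^ j) powr a * (r * 2 ^ Suc j) ^ ?n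
     = (r powr a * 2 ^ ?n * r ^ ?n) * (2 powr (a + real ?n)) ^ j" for j
  proof -
    have "(r * 2 ^ j) powr a = r powr a * (2 powr a) ^ j"
      using r power_powr[of 2 j a] by (simp add: powr_mult)
    moreover have "((2::real) ^ j) ^ ?n = (2 powr real ?n) ^ j"
      by (simp add: powr_realpow power_mult[symmetric] mult.commute)
    ultimately show ?thesis by (simp add: power_mult_distrib powr_add mult_ac)
  qed
  then show "summable (\<lambda>j. (r * 2 ^ j) powr a * (r * 2 ^ Suc j) ^ ?n)"
    using q by (simp add: summable_mult summable_geometric)
  show "\<exists>j. norm x \<le> r * 2 ^ Suc j \<and> norm x powr a \<le> (r * 2 ^ j) powr a"
    if "x \<in> {x. norm x \<ge> r}" for x :: "real^'n"
  proof -
    have x: "norm x \<ge> r" using that by auto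
    \<comment> \<open>The least exponent below locates the dyadic layer that contains \<open>x\<close>.\<close>
    have "\<exists>j. norm x / r < 2 ^ j" by (rule real_arch_pow) simp
    then obtain j0 where j0: "norm x < r * 2 ^ j0" using r by (auto simp: field_simps)
    define k where "k = (LEAST j. norm x < r * 2 ^ j)"
    have k: "norm x < r * 2 ^ k" unfolding k_def by (rule LeastI[of "\<lambda>j. norm x < r * 2 ^ j", OF j0])
    then obtain j where j: "k = Suc j" using x by (cases k) auto
    have "\<not> norm x < r * 2 ^ j" using not_less_Least[of j "\<lambda>j. norm x < r * 2 ^ j"] j by (simp add: k_def)
    then have "norm x powr a \<le> (r * 2 ^ j) powr a"
      using a0 r by (intro powr_mono2') auto
    then show ?thesis using k j by (intro exI[of _ j]) auto
  qed
  show "{x::real^'n. norm x \<ge> r} \<in> sets borel" by measurable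
qed (use r in auto)

section \<open>Derivatives of the kernel\<close>

definition monom_fun :: "'n::finite list \<Rightarrow> real^'n \<Rightarrow> real" where
  "monom_fun \<beta> w = prod_list (map (\<lambda>i. w $ i) \<beta>)"

text \<open>The product rule for a monomial: the monomials of its derivative, with multiplicity.\<close>

fun del_one :: "'n \<Rightarrow> 'n list \<Rightarrow> 'n list list" where
  "del_one i [] = []"
| "del_one i (k # \<beta>) = (if i = k then [\<beta>] else []) @ map ((#) k) (del_one i \<beta>)"

definition kern_exp :: "'n::finite itself \<Rightarrow> nat \<Rightarrow> nat \<Rightarrow> real" where
  "kern_exp _ j l = 1 - real CARD('n) - 2 * real j - 2 * real l"

text \<open>The functions \<open>|w|\<^sup>a w\<^sup>\<beta>\<close> with \<open>a = 1 - n - 2 j - 2 |\<beta>|\<close> have the same span as the derivatives of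
  \<open>|w| powr (1 - n)\<close>. For \<open>j = 0\<close> they are that power times the monomials in the point that arises from
  \<open>w\<close> by inversion in the unit sphere.\<close>

definition kern :: "nat \<Rightarrow> 'n::finite list \<Rightarrow> real^'n \<Rightarrow> complex" where
  "kern j \<beta> w = of_real (norm w powr kern_exp TYPE('n) j (length \<beta>)) * of_real (monom_fun \<beta> w)"

lemma ray_kernel_eq_kern: "ray_kernel = kern 0 []"
  by (auto simp: ray_kernel_def kern_def kern_exp_def monom_fun_def)

lemma monom_fun_Nil [simp]: "monom_fun [] w = 1"
  and monom_fun_Cons: "monom_fun (i # \<beta>) w = w $ i * monom_fun \<beta> w"
  and monom_fun_append: "monom_fun (\<beta> @ \<gamma>) w = monom_fun \<beta> w * monom_fun \<gamma> w"
  by (auto simp: monom_fun_def)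

lemma monom_fun_scaleR: "monom_fun \<beta> (c *\<^sub>R w) = c ^ length \<beta> * monom_fun \<beta> w"
  by (induction \<beta>) (auto simp: monom_fun_Cons)

lemma monom_fun_le: "\<bar>monom_fun \<beta> w\<bar> \<le> norm w ^ length \<beta>"
proof (induction \<beta>)
  case (Cons i \<beta>)
  then show ?case
    using component_le_norm_cart[of w i] by (auto simp: monom_fun_Cons abs_mult intro!: mult_mono)
qed simp

lemma length_del_one: "\<gamma> \<in> set (del_one i \<beta>) \<Longrightarrow> Suc (length \<gamma>) = length \<beta>"
  by (induction \<beta> arbitrary: \<gamma>) (auto split: if_splits)

lemma smooth_on_monom_fun: "smooth_on UNIV (\<lambda>w. complex_of_real (monom_fun \<beta> w))"
proof (induction \<beta>)
  case (Cons i \<beta>)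
  show ?case unfolding monom_fun_Cons of_real_mult
    by (rule smooth_on_mult[OF open_UNIV smooth_on_coord[OF open_UNIV] Cons])
qed (simp add: smooth_on_const)

lemma pderiv_coord_coord: "pderiv_coord i (\<lambda>w. complex_of_real (w $ k)) w = (if i = k then 1 else 0)"
  using pderiv_coord_eq[OF bounded_linear_imp_has_derivative[OF bounded_linear_nth_complex], of i k w]
  by (auto simp: axis_def)

lemma pderiv_coord_monom_fun:
  "pderiv_coord i (\<lambda>w. complex_of_real (monom_fun \<beta> w)) w
     = of_real (\<Sum>\<gamma>\<leftarrow>del_one i \<beta>. monom_fun \<gamma> w)"
proof (induction \<beta>)
  case Nil
  then show ?case by (simp add: pderiv_coord_const)
next
  case (Cons k \<beta>)
  have "pderiv_coord i (\<lambda>w. complex_of_real (monom_fun (k # \<beta>) w)) w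
    = pderiv_coord i (\<lambda>w. complex_of_real (w $ k) * of_real (monom_fun \<beta> w)) w"
    by (simp add: monom_fun_Cons)
  also have "\<dots> = pderiv_coord i (\<lambda>w. complex_of_real (w $ k)) w * of_real (monom_fun \<beta> w)
     + of_real (w $ k) * pderiv_coord i (\<lambda>w. complex_of_real (monom_fun \<beta> w)) w"
    by (rule pderiv_coord_mult)
       (auto intro: smooth_on_differentiable[OF smooth_on_monom_fun] smooth_on_differentiable[OF smooth_on_coord[OF open_UNIV]])
  also have "\<dots> = of_real (\<Sum>\<gamma>\<leftarrow>del_one i (k # \<beta>). monom_fun \<gamma> w)"
    unfolding Cons pderiv_coord_coord
    by (simp add: o_def monom_fun_Cons sum_list_const_mult)
  finally show ?case .
qed

lemma smooth_on_kern: "smooth_on (- {0}) (kern j \<beta>)"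
  unfolding kern_def
  by (intro smooth_on_mult smooth_on_norm_powr smooth_on_subset[OF smooth_on_monom_fun]) auto

text \<open>Differentiating the power of the norm gains a coordinate and lowers the exponent by two, as the
  definition of \<open>kern_exp\<close> wants. Differentiating the monomial loses a coordinate at the same exponent,
  which raises \<open>j\<close> by one.\<close>

lemma pderiv_coord_kern:
  fixes w :: "real^'n::finite"
  assumes w: "w \<noteq> 0"
  shows "pderiv_coord i (kern j \<beta>) w = (\<Sum>\<gamma>\<leftarrow>del_one i \<beta>. kern (Suc j) \<gamma> w)
     + of_real (kern_exp TYPE('n) j (length \<beta>)) * kern j (i # \<beta>) w"
proof -
  let ?a = "kern_exp TYPE('n) j (length \<beta>)"
  have 1: "kern_exp TYPE('n) (Suc j) (length \<gamma>) = ?a" if "\<gamma> \<in> set (del_one i \<beta>)" for \<gamma>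
    using length_del_one[OF that, symmetric] by (simp add: kern_exp_def)
  have "pderiv_coord i (kern j \<beta>) w
    = of_real ?a * of_real (norm w powr (?a - 2)) * of_real (w $ i) * of_real (monom_fun \<beta> w)
      + of_real (norm w powr ?a) * of_real (\<Sum>\<gamma>\<leftarrow>del_one i \<beta>. monom_fun \<gamma> w)"
    unfolding kern_def
    by (subst pderiv_coord_mult)
       (auto simp: pderiv_coord_norm_powr[OF w] pderiv_coord_monom_fun w
         intro!: smooth_on_differentiable[OF smooth_on_monom_fun] smooth_on_differentiable[OF smooth_on_norm_powr])
  also have "of_real (norm w powr ?a) * of_real (\<Sum>\<gamma>\<leftarrow>del_one i \<beta>. monom_fun \<gamma> w)
     = (\<Sum>\<gamma>\<leftarrow>del_one i \<beta>. kern (Suc j) \<gamma> w)"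
  proof -
    have "(\<Sum>\<gamma>\<leftarrow>del_one i \<beta>. kern (Suc j) \<gamma> w)
       = (\<Sum>\<gamma>\<leftarrow>del_one i \<beta>. complex_of_real (norm w powr ?a) * of_real (monom_fun \<gamma> w))"
      by (intro arg_cong[where f = sum_list] map_cong refl) (simp add: kern_def 1)
    moreover have "complex_of_real (\<Sum>\<gamma>\<leftarrow>L. monom_fun \<gamma> w) = (\<Sum>\<gamma>\<leftarrow>L. of_real (monom_fun \<gamma> w))" for L
      by (induction L) auto
    ultimately show ?thesis by (simp add: sum_list_const_mult)
  qed
  also have "of_real ?a * of_real (norm w powr (?a - 2)) * of_real (w $ i) * of_real (monom_fun \<beta> w)
    = of_real ?a * kern j (i # \<beta>) w"
  proof -
    have "kern_exp TYPE('n) j (length (i # \<beta>)) = ?a - 2" by (simp add: kern_exp_def)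
    then show ?thesis by (simp add: kern_def monom_fun_Cons mult_ac)
  qed
  finally show ?thesis by simp
qed

lemma sum_kern_diagonal: "(\<Sum>i\<in>UNIV. kern j [i, i] w) = kern (Suc j) [] (w :: real^'n::finite)"
proof (cases "w = 0")
  case False
  let ?a = "kern_exp TYPE('n) (Suc j) 0"
  have e: "kern_exp TYPE('n) j (length [i, i]) = ?a - 2" for i :: 'n by (simp add: kern_exp_def)
  have "(\<Sum>i\<in>UNIV. kern j [i, i] w) = of_real (norm w powr (?a - 2) * (\<Sum>i\<in>UNIV. w $ i * w $ i))"
    by (simp only: kern_def e of_real_mult of_real_sum sum_distrib_left) (simp add: monom_fun_Cons)
  also have "(\<Sum>i\<in>UNIV. w $ i * w $ i) = (norm w)\<^sup>2"
    by (simp add: power2_norm_eq_inner inner_vec_def)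
  also have "norm w powr (?a - 2) * (norm w)\<^sup>2 = norm w powr ?a"
    using False by (simp add: powr_diff)
  finally show ?thesis by (simp add: kern_def)
qed (simp add: kern_def)

text \<open>The exponent in the bound is the degree of homogeneity.\<close>

lemma norm_kern_le: "norm (kern j \<beta> w) \<le> norm w powr (1 - real CARD('n) - 2 * real j - real (length \<beta>))"
  for w :: "real^'n::finite"
proof (cases "w = 0")
  case False
  have "norm (kern j \<beta> w) \<le> norm w powr kern_exp TYPE('n) j (length \<beta>) * norm w ^ length \<beta>"
    using monom_fun_le[of \<beta> w] by (auto simp: kern_def norm_mult intro!: mult_left_mono)
  also have "\<dots> = norm w powr (kern_exp TYPE('n) j (length \<beta>) + real (length \<beta>))"
    using False by (simp add: powr_add powr_realpow)
  also have "\<dots> = norm w powr (1 - real CARD('n) - 2 * real j - real (length \<beta>))"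
    by (simp add: kern_exp_def algebra_simps)
  finally show ?thesis .
qed (simp add: kern_def)

lemma norm_kern_le_away:
  assumes "r > 0"
  obtains C where "C \<ge> 0" "\<And>w::real^'n::finite. norm w \<ge> r \<Longrightarrow> norm (kern j \<beta> w) \<le> C * norm w powr (1 - real CARD('n))"
proof
  let ?b = "- (2 * real j + real (length \<beta>))"
  show "r powr ?b \<ge> 0" by simp
  fix w :: "real^'n" assume w: "norm w \<ge> r"
  have "norm (kern j \<beta> w) \<le> norm w powr (?b + (1 - real CARD('n)))"
    using norm_kern_le[of j \<beta> w] by (simp add: algebra_simps)
  also have "\<dots> = norm w powr ?b * norm w powr (1 - real CARD('n))" by (rule powr_add)
  also have "\<dots> \<le> r powr ?b * norm w powr (1 - real CARD('n))"
    using w assms by (intro mult_right_mono powr_mono2') auto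
  finally show "norm (kern j \<beta> w) \<le> r powr ?b * norm w powr (1 - real CARD('n))" .
qed

text \<open>Think of \<open>G j \<beta> x\<close> as the value of a functional on the translate by \<open>x\<close> of \<open>kern j \<beta>\<close>; the hypotheses
  state what \<open>pderiv_coord_kern\<close> and \<open>sum_kern_diagonal\<close> say about these values. The sign \<open>s\<close> is \<open>1\<close> or
  \<open>- 1\<close> according to whether \<open>x\<close> enters through \<open>x - y\<close> or \<open>y - x\<close>.

  If \<open>G 0 []\<close> vanishes almost everywhere on \<open>E\<close>, then so do all its derivatives. The Laplacian raises
  \<open>j\<close> by one, and a derivative adds a coordinate to \<open>\<beta>\<close> modulo terms with shorter \<open>\<beta>\<close>. No coefficient
  is zero: \<open>kern_exp\<close> is negative as \<open>n \<ge> 2\<close>, and no power of the norm that occurs as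
  \<open>kern j []\<close> is harmonic.\<close>

lemma kern_functionals_vanish:
  fixes G :: "nat \<Rightarrow> 'n::finite list \<Rightarrow> real^'n \<Rightarrow> complex"
  assumes n: "CARD('n) \<ge> 2" and s: "s \<noteq> 0" and B: "open B"
    and cont: "\<And>j \<beta>. continuous_on B (G j \<beta>)"
    and der: "\<And>j \<beta> i x. x \<in> B \<Longrightarrow> ((\<lambda>t. G j \<beta> (x + t *\<^sub>R axis i 1)) has_vector_derivative
       s * ((\<Sum>\<gamma>\<leftarrow>del_one i \<beta>. G (Suc j) \<gamma> x) + of_real (kern_exp TYPE('n) j (length \<beta>)) * G j (i # \<beta>) x)) (at 0)"
    and diag: "\<And>j x. x \<in> B \<Longrightarrow> (\<Sum>i\<in>UNIV. G j [i, i] x) = G (Suc j) [] x"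
    and zero: "AE x in lebesgue. x \<in> E \<inter> B \<longrightarrow> G 0 [] x = 0"
  shows "AE x in lebesgue. x \<in> E \<inter> B \<longrightarrow> (\<forall>j \<beta>. G j \<beta> x = 0)"
proof -
  define Z where "Z j \<beta> \<longleftrightarrow> (AE x in lebesgue. x \<in> E \<inter> B \<longrightarrow> G j \<beta> x = 0)" for j \<beta>
  have a: "complex_of_real (kern_exp TYPE('n) j l) \<noteq> 0" for j l
    unfolding of_real_eq_0_iff kern_exp_def using n by linarith
  have contl: "continuous_on B (\<lambda>x. \<Sum>\<gamma>\<leftarrow>L. G j \<gamma> x)" for j L
    by (induction L) (auto intro!: continuous_intros cont)
  have step: "AE x in lebesgue. x \<in> E \<inter> B \<longrightarrow>
     (\<Sum>\<gamma>\<leftarrow>del_one i \<beta>. G (Suc j) \<gamma> x) + of_real (kern_exp TYPE('n) j (length \<beta>)) * G j (i # \<beta>) x = 0"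
    if "Z j \<beta>" for i j \<beta>
  proof -
    have "AE x in lebesgue. x \<in> B \<and> G j \<beta> x = 0 \<longrightarrow>
      s * ((\<Sum>\<gamma>\<leftarrow>del_one i \<beta>. G (Suc j) \<gamma> x) + of_real (kern_exp TYPE('n) j (length \<beta>)) * G j (i # \<beta>) x) = 0"
      by (rule null_zeros_with_nonzero_derivative[OF B cont _ der]) (auto intro!: continuous_intros contl cont)
    with that show ?thesis unfolding Z_def
      by eventually_elim (use s in \<open>simp only: Int_iff mult_eq_0_iff simp_thms\<close>, blast)
  qed
  have single: "Z j [i]" if "Z j []" for j i
    using step[OF that, of i] a[of j 0] unfolding Z_def by simp
  have up: "Z (Suc j) []" if "Z j []" for j
  proof -
    have "AE x in lebesgue. \<forall>i. x \<in> E \<inter> B \<longrightarrow> G (Suc j) [] x + of_real (kern_exp TYPE('n) j 1) * G j [i, i] x = 0"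
      unfolding AE_all_countable
    proof
      fix i
      show "AE x in lebesgue. x \<in> E \<inter> B \<longrightarrow> G (Suc j) [] x + of_real (kern_exp TYPE('n) j 1) * G j [i, i] x = 0"
        using step[OF single[OF that, of i], of i] by simp
    qed
    then show ?thesis unfolding Z_def
    proof (rule eventually_mono, intro impI)
      fix x assume A: "\<forall>i. x \<in> E \<inter> B \<longrightarrow> G (Suc j) [] x + of_real (kern_exp TYPE('n) j 1) * G j [i, i] x = 0"
        and x: "x \<in> E \<inter> B"
      \<comment> \<open>The Laplacian of \<open>kern j []\<close>, up to the factor \<open>kern_exp\<close> of the first derivative, is \<open>n + kern_exp _ j 1\<close> times \<open>kern (Suc j) []\<close>.\<close>
      have "0 = (\<Sum>i\<in>(UNIV::'n set). G (Suc j) [] x + of_real (kern_exp TYPE('n) j 1) * G j [i, i] x)"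
        using A x by simp
      also have "\<dots> = of_nat CARD('n) * G (Suc j) [] x + of_real (kern_exp TYPE('n) j 1) * (\<Sum>i\<in>UNIV. G j [i, i] x)"
        by (simp add: sum.distrib sum_distrib_left)
      also have "\<dots> = of_real (real CARD('n) + kern_exp TYPE('n) j 1) * G (Suc j) [] x"
        using x by (simp add: diag algebra_simps)
      also have "real CARD('n) + kern_exp TYPE('n) j 1 = - (1 + 2 * real j)" by (simp add: kern_exp_def)
      finally have "complex_of_real (- (1 + 2 * real j)) = 0 \<or> G (Suc j) [] x = 0" by simp
      moreover have "complex_of_real (- (1 + 2 * real j)) \<noteq> 0" unfolding of_real_eq_0_iff by linarith
      ultimately show "G (Suc j) [] x = 0" by blast
    qed
  qed
  have "Z j []" for j by (induction j) (use zero up in \<open>auto simp: Z_def\<close>)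
  then have Z: "Z j \<beta>" for j \<beta>
  proof (induction "length \<beta>" arbitrary: j \<beta> rule: less_induct)
    case less
    show ?case
    proof (cases \<beta>)
      case (Cons i \<beta>')
      have "AE x in lebesgue. x \<in> E \<inter> B \<longrightarrow> (\<forall>\<gamma>\<in>set (del_one i \<beta>'). G (Suc j) \<gamma> x = 0)"
      proof -
        have "AE x in lebesgue. \<forall>\<gamma>\<in>set (del_one i \<beta>'). x \<in> E \<inter> B \<longrightarrow> G (Suc j) \<gamma> x = 0"
        proof (rule AE_ball_countable[THEN iffD2])
          show "countable (set (del_one i \<beta>'))" by simp
          show "\<forall>\<gamma>\<in>set (del_one i \<beta>'). AE x in lebesgue. x \<in> E \<inter> B \<longrightarrow> G (Suc j) \<gamma> x = 0"
            using less(1)[OF _ less(2)] length_del_one[of _ i \<beta>'] Cons unfolding Z_def by fastforce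
        qed
        then show ?thesis by eventually_elim blast
      qed
      moreover have "Z j \<beta>'" using less Cons by auto
      then have "AE x in lebesgue. x \<in> E \<inter> B \<longrightarrow>
         (\<Sum>\<gamma>\<leftarrow>del_one i \<beta>'. G (Suc j) \<gamma> x) + of_real (kern_exp TYPE('n) j (length \<beta>')) * G j (i # \<beta>') x = 0"
        by (rule step)
      ultimately have "AE x in lebesgue. x \<in> E \<inter> B \<longrightarrow> G j (i # \<beta>') x = 0"
      proof eventually_elim
        case (elim x)
        have "(\<Sum>\<gamma>\<leftarrow>L. G (Suc j) \<gamma> x) = 0" if "\<forall>\<gamma>\<in>set L. G (Suc j) \<gamma> x = 0" for L
          using that by (induction L) auto
        then show ?case using elim a[of j "length \<beta>'"] by auto
      qed
      then show ?thesis unfolding Cons Z_def .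
    qed (use less in simp)
  qed
  have "AE x in lebesgue. \<forall>j \<beta>. x \<in> E \<inter> B \<longrightarrow> G j \<beta> x = 0"
    unfolding AE_all_countable using Z by (simp add: Z_def)
  then show ?thesis by (rule eventually_mono) blast
qed

section \<open>Polynomials and inversion\<close>

text \<open>The members of \<open>algebra_gen coords\<close> are the complex polynomials in the coordinates.\<close>

definition coords :: "(real^'n::finite \<Rightarrow> complex) set" where
  "coords = range (\<lambda>i z. complex_of_real (z $ i))"

lemma algebra_gen_coords_monom:
  assumes "f \<in> algebra_gen coords"
  shows "\<exists>L. \<forall>z. f z = (\<Sum>(c, \<beta>)\<leftarrow>L. c * of_real (monom_fun \<beta> z))"
  using assms
proof induction
  case (gen g)
  then obtain i where "g = (\<lambda>z. complex_of_real (z $ i))" unfolding coords_def by (rule rangeE)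
  then show ?case by (intro exI[of _ "[(1, [i])]"]) (simp add: monom_fun_Cons)
next
  case (const c)
  then show ?case by (intro exI[of _ "[(c, [])]"]) simp
next
  case (add f g)
  then obtain L L' where "\<forall>z. f z = (\<Sum>(c, \<beta>)\<leftarrow>L. c * of_real (monom_fun \<beta> z))"
    "\<forall>z. g z = (\<Sum>(c, \<beta>)\<leftarrow>L'. c * of_real (monom_fun \<beta> z))" by blast
  then show ?case by (intro exI[of _ "L @ L'"]) simp
next
  case (mult f g)
  then obtain L L' where L: "\<forall>z. f z = (\<Sum>(c, \<beta>)\<leftarrow>L. c * of_real (monom_fun \<beta> z))"
    "\<forall>z. g z = (\<Sum>(c, \<beta>)\<leftarrow>L'. c * of_real (monom_fun \<beta> z))" by blast
  have 1: "(\<Sum>(d, \<gamma>)\<leftarrow>map (\<lambda>(d, \<gamma>). (c * d, \<beta> @ \<gamma>)) L'. d * of_real (monom_fun \<gamma> z))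
     = c * of_real (monom_fun \<beta> z) * (\<Sum>(d, \<gamma>)\<leftarrow>L'. d * of_real (monom_fun \<gamma> z))" for c \<beta> z
    by (induction L') (auto simp: monom_fun_append algebra_simps)
  have "(\<Sum>(c, \<beta>)\<leftarrow>concat (map (\<lambda>(c, \<beta>). map (\<lambda>(d, \<gamma>). (c * d, \<beta> @ \<gamma>)) L') L). c * of_real (monom_fun \<beta> z))
    = (\<Sum>(c, \<beta>)\<leftarrow>L. c * of_real (monom_fun \<beta> z)) * (\<Sum>(d, \<gamma>)\<leftarrow>L'. d * of_real (monom_fun \<gamma> z))" for z
    by (induction L) (auto simp: 1 distrib_right simp del: map_map)
  then have "\<forall>z. f z * g z = (\<Sum>(c, \<beta>)\<leftarrow>concat (map (\<lambda>(c, \<beta>). map (\<lambda>(d, \<gamma>). (c * d, \<beta> @ \<gamma>)) L') L). c * of_real (monom_fun \<beta> z))"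
    using L by simp
  then show ?case by (rule exI)
qed

lemma real_polynomial_algebra_gen:
  fixes p :: "real^'n::finite \<Rightarrow> real"
  assumes "real_polynomial_function p"
  shows "(\<lambda>z. complex_of_real (p z)) \<in> algebra_gen coords"
  using assms
proof induction
  case (linear f)
  interpret bounded_linear f by fact
  have "complex_of_real (f z) = (\<Sum>i\<in>UNIV. of_real (f (axis i 1)) * of_real (z $ i))" for z
  proof -
    have "f z = f (\<Sum>i\<in>UNIV. z $ i *\<^sub>R axis i 1)"
      using basis_expansion[of z] by (simp add: scalar_mult_eq_scaleR)
    also have "\<dots> = (\<Sum>i\<in>UNIV. f (axis i 1) * z $ i)" unfolding sum scaleR by (simp add: mult.commute)
    finally show ?thesis by simp
  qed
  then have "(\<lambda>z. complex_of_real (f z)) = (\<lambda>z. \<Sum>i\<in>UNIV. of_real (f (axis i 1)) * of_real (z $ i))"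
    by (rule ext)
  moreover have "(\<lambda>z. \<Sum>i\<in>UNIV. complex_of_real (f (axis i 1)) * of_real (z $ i)) \<in> algebra_gen coords"
    by (rule algebra_gen_sum[OF finite algebra_gen.mult[OF algebra_gen.const algebra_gen.gen]]) (simp add: coords_def)
  ultimately show ?case by (simp only:)
next
  case (const c)
  then show ?case by (rule algebra_gen.const)
next
  case (add f g)
  then show ?case using algebra_gen.add[of "\<lambda>z. complex_of_real (f z)" coords "\<lambda>z. complex_of_real (g z)"] by simp
next
  case (mult f g)
  then show ?case using algebra_gen.mult[of "\<lambda>z. complex_of_real (f z)" coords "\<lambda>z. complex_of_real (g z)"] by simp
qed

text \<open>Inversion in the unit sphere. The value at the origin is the origin, which makes the map an
  involution of the whole space.\<close>

definition sphere_inv :: "real^'n::finite \<Rightarrow> real^'n" where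
  "sphere_inv w = inverse ((norm w)\<^sup>2) *\<^sub>R w"

lemma norm_sphere_inv: "norm (sphere_inv w) = inverse (norm w)"
  by (cases "w = 0") (auto simp: sphere_inv_def power2_eq_square)

lemma sphere_inv_involution: "sphere_inv (sphere_inv w) = w"
proof (cases "w = 0")
  case False
  have "sphere_inv (sphere_inv w) = ((norm w)\<^sup>2 * inverse ((norm w)\<^sup>2)) *\<^sub>R w"
    unfolding sphere_inv_def[of "sphere_inv w"] norm_sphere_inv by (simp add: sphere_inv_def power_inverse)
  then show ?thesis using False by simp
qed (simp add: sphere_inv_def)

lemma continuous_on_sphere_inv: "continuous_on (- {0}) sphere_inv"
  unfolding sphere_inv_def by (intro continuous_intros) auto

lemma smooth_on_sphere_inv: "smooth_on (- {0}) (\<lambda>w. complex_of_real (sphere_inv w $ i))"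
proof (rule smooth_on_cong[where \<psi> = "\<lambda>w. complex_of_real (norm w powr (- 2)) * of_real (w $ i)"])
  show "smooth_on (- {0}) (\<lambda>w. complex_of_real (norm w powr (- 2)) * of_real (w $ i))"
    by (intro smooth_on_mult smooth_on_norm_powr smooth_on_coord) auto
qed (auto simp: sphere_inv_def powr_minus)

text \<open>This is what turns functionals that vanish on all \<open>kern 0 \<beta>\<close> into functionals that vanish on all
  polynomials in the inverted variable.\<close>

lemma kern_0_eq: "kern 0 \<beta> w = of_real (norm w powr (1 - real CARD('n))) * of_real (monom_fun \<beta> (sphere_inv w))"
  for w :: "real^'n::finite"
proof (cases "w = 0")
  case False
  have "inverse ((norm w)\<^sup>2) ^ length \<beta> = norm w powr (- 2 * real (length \<beta>))"
  proof -
    have "norm w powr (- 2 * real (length \<beta>)) = inverse (norm w powr real (2 * length \<beta>))"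
      unfolding powr_minus[symmetric] by simp
    also have "norm w powr real (2 * length \<beta>) = norm w ^ (2 * length \<beta>)"
      by (rule powr_realpow) (use False in simp)
    finally show ?thesis by (simp add: power_mult power_inverse)
  qed
  then have "norm w powr kern_exp TYPE('n) 0 (length \<beta>) = norm w powr (1 - real CARD('n)) * inverse ((norm w)\<^sup>2) ^ length \<beta>"
    by (simp add: powr_add[symmetric] kern_exp_def)
  then show ?thesis by (simp add: kern_def sphere_inv_def monom_fun_scaleR)
qed (simp add: kern_def)

section \<open>Pairing a distribution with translates\<close>

lemma compact_norm_bound:
  fixes f :: "'a::topological_space \<Rightarrow> 'b::real_normed_vector"
  assumes "compact K" "continuous_on K f"
  shows "\<exists>C. \<forall>x\<in>K. norm (f x) \<le> C"
  using compact_imp_bounded[OF compact_continuous_image[OF assms(2,1)]] by (auto simp: bounded_iff)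

text \<open>A measurable way to move each point of a compact set to a nearby point of a finite subset: the list
  fixes an order of a finite net, and the first member of the net that is close enough is taken. It
  turns integrals of translates into finite sums.\<close>

lemma finite_selection:
  fixes Y :: "'a::{metric_space, second_countable_topology} set"
  assumes Y: "compact Y" and y0: "y0 \<in> Y" and d: "d > 0"
  shows "\<exists>Z p. finite Z \<and> Z \<subseteq> Y \<and> (\<forall>x. p x \<in> Z) \<and> (\<forall>x\<in>Y. dist (p x) x < d) \<and> p \<in> borel_measurable borel"
proof -
  obtain Z where Z: "finite Z" "Z \<subseteq> Y" "Y \<subseteq> (\<Union>z\<in>Z. ball z d)"
    by (rule compactE_image[OF Y, of Y "\<lambda>z. ball z d"]) (use d in auto)
  obtain zs where zs: "set zs = Z" using finite_list[OF Z(1)] by auto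
  define p where "p = foldr (\<lambda>z q x. if dist z x < d then z else q x) zs (\<lambda>x. y0)"
  have 1: "foldr (\<lambda>z q x. if dist z x < d then z else q x) zs (\<lambda>x. y0) x \<in> insert y0 (set zs)" for x zs
    by (induction zs) auto
  have 2: "dist (foldr (\<lambda>z q x. if dist z x < d then z else q x) zs (\<lambda>x. y0) x) x < d"
    if "x \<in> (\<Union>z\<in>set zs. ball z d)" for x zs
    using that by (induction zs) auto
  have 3: "foldr (\<lambda>z q x. if dist z x < d then z else q x) zs (\<lambda>x. y0) \<in> borel_measurable borel" for zs
  proof (induction zs)
    case (Cons z zs)
    have [measurable]: "foldr (\<lambda>z q x. if dist z x < d then z else q x) zs (\<lambda>x. y0) \<in> borel_measurable borel"
      by (rule Cons)
    show ?case by simp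
  qed simp
  show ?thesis
  proof (intro exI[of _ "insert y0 Z"] exI[of _ p] conjI ballI allI)
    show "p x \<in> insert y0 Z" for x using 1[of zs x] unfolding p_def zs .
    show "dist (p x) x < d" if "x \<in> Y" for x
    proof -
      have "x \<in> (\<Union>z\<in>set zs. ball z d)" using Z(3) that unfolding zs by (rule subsetD)
      then show ?thesis unfolding p_def by (rule 2)
    qed
    show "p \<in> borel_measurable borel" unfolding p_def by (rule 3)
  qed (use Z y0 in auto)
qed

lemma translates_uniformly_close:
  fixes \<kappa> :: "real^'n::finite \<Rightarrow> complex"
  assumes \<kappa>: "continuous_on (- {0}) \<kappa>" and K: "compact K" "compact Y" "K \<inter> Y = {}" and e: "e > 0"
  shows "\<exists>d>0. \<forall>x\<in>Y. \<forall>x'\<in>Y. dist x x' < d \<longrightarrow> (\<forall>y\<in>K. dist (\<kappa> (y - x)) (\<kappa> (y - x')) < e)"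
proof -
  let ?D = "{y - x | y x. y \<in> K \<and> x \<in> Y}"
  have "uniformly_continuous_on ?D \<kappa>"
    by (rule compact_uniformly_continuous[OF continuous_on_subset[OF \<kappa>]])
       (use compact_differences[OF K(1,2)] K(3) in auto)
  then have "\<exists>d>0. \<forall>w\<in>?D. \<forall>w'\<in>?D. dist w' w < d \<longrightarrow> dist (\<kappa> w') (\<kappa> w) < e"
    using e unfolding uniformly_continuous_on_def by simp
  then obtain d where d: "d > 0" "\<forall>w\<in>?D. \<forall>w'\<in>?D. dist w' w < d \<longrightarrow> dist (\<kappa> w') (\<kappa> w) < e"
    by (elim exE conjE)
  show ?thesis
  proof (intro exI[of _ d] conjI ballI impI d(1))
    fix x x' y assume A: "x \<in> Y" "x' \<in> Y" "dist x x' < d" "y \<in> K"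
    have "dist (y - x) (y - x') < d" using A(3) by (simp add: dist_norm norm_minus_commute)
    moreover have "y - x \<in> ?D" "y - x' \<in> ?D" using A by blast+
    ultimately show "dist (\<kappa> (y - x)) (\<kappa> (y - x')) < e" using d(2) by simp
  qed
qed

lemma smooth_on_translate:
  fixes v :: "real^'n::finite \<Rightarrow> complex"
  assumes "smooth_on (- {0}) v" "x \<in> Y"
  shows "smooth_on (- Y) (\<lambda>y. v (y - x))"
proof (rule smooth_on_subset[OF smooth_on_shift[OF assms(1)]])
  show "- Y \<subseteq> (+) x ` (- {0})"
  proof
    fix y assume "y \<in> - Y"
    then have "y - x \<in> - {0}" "y = x + (y - x)" using assms(2) by auto
    then show "y \<in> (+) x ` (- {0})" by blast
  qed
qed

text \<open>The derivatives of \<open>v\<close> are uniformly continuous on the compact set of differences of points of the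
  support of \<open>\<eta>\<close> and of \<open>Y\<close>, which avoids the origin.\<close>

lemma translate_pairing_tendsto:
  fixes v :: "real^'n::finite \<Rightarrow> complex"
  assumes u: "distribution u" and \<eta>: "test_function \<eta>" and v: "smooth_on (- {0}) v"
    and Y: "compact Y" "fun_support \<eta> \<inter> Y = {}" and X: "\<And>m. X m \<in> Y" "x0 \<in> Y" "(X \<longlongrightarrow> x0) F"
  shows "((\<lambda>m. u (\<lambda>y. \<eta> y * v (y - X m))) \<longlongrightarrow> u (\<lambda>y. \<eta> y * v (y - x0))) F"
proof (rule distribution_tendsto[OF u test_function_compact[OF \<eta>]])
  have S: "open (- Y)" "fun_support \<eta> \<subseteq> - Y" using Y compact_imp_closed by auto
  have sm: "smooth_on (- Y) (\<lambda>y. v (y - x))" if "x \<in> Y" for x by (rule smooth_on_translate[OF v that])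
  have tf: "test_function (\<lambda>y. \<eta> y * v (y - x))" if "x \<in> Y" for x
    by (rule test_function_mult[OF \<eta> S sm[OF that]])
  show "test_function (\<lambda>y. \<eta> y * v (y - X m))" "test_function (\<lambda>y. \<eta> y * v (y - x0))" for m using tf X by auto
  show "fun_support (\<lambda>y. \<eta> y * v (y - X m)) \<subseteq> fun_support \<eta>" "fun_support (\<lambda>y. \<eta> y * v (y - x0)) \<subseteq> fun_support \<eta>" for m
    by (rule fun_support_subset[OF closed_fun_support]; simp add: fun_support_zero)+
  fix N
  have "Ck_limit N (fun_support \<eta>) (\<lambda>m y. v (y - X m)) (\<lambda>y. v (y - x0)) F"
    unfolding Ck_limit_def pderivs_shift
  proof (intro allI impI uniform_limitI)
    fix \<alpha> :: "'n list" and e :: real assume "e > 0"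
    obtain d where d: "d > 0" "\<And>x x' y. x \<in> Y \<Longrightarrow> x' \<in> Y \<Longrightarrow> dist x x' < d \<Longrightarrow> y \<in> fun_support \<eta> \<Longrightarrow>
        dist (pderivs \<alpha> v (y - x)) (pderivs \<alpha> v (y - x')) < e"
      using translates_uniformly_close[OF smooth_on_continuous_pderivs[OF v, of \<alpha>] test_function_compact[OF \<eta>] Y \<open>e > 0\<close>] by meson
    have "\<forall>\<^sub>F m in F. dist (X m) x0 < d" using X(3) d(1) by (simp add: tendsto_iff)
    then show "\<forall>\<^sub>F m in F. \<forall>y\<in>fun_support \<eta>. dist (pderivs \<alpha> v (y - X m)) (pderivs \<alpha> v (y - x0)) < e"
      by eventually_elim (use d(2) X in blast)
  qed
  then show "Ck_limit N (fun_support \<eta>) (\<lambda>m y. \<eta> y * v (y - X m)) (\<lambda>y. \<eta> y * v (y - x0)) F"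
    by (intro Ck_limit_mult[OF S test_function_compact[OF \<eta>]] sm X Ck_limit_const test_function_smooth_on[OF \<eta>] S)
qed

lemma continuous_on_translate_pairing:
  fixes v :: "real^'n::finite \<Rightarrow> complex"
  assumes "distribution u" "test_function \<eta>" "smooth_on (- {0}) v" "compact Y" "fun_support \<eta> \<inter> Y = {}"
  shows "continuous_on Y (\<lambda>x. u (\<lambda>y. \<eta> y * v (y - x)))"
  unfolding continuous_on_sequentially comp_def
proof (intro allI ballI impI)
  fix X x0 assume "x0 \<in> Y" "(\<forall>m. X m \<in> Y) \<and> X \<longlonglongrightarrow> x0"
  then show "(\<lambda>m. u (\<lambda>y. \<eta> y * v (y - X m))) \<longlonglongrightarrow> u (\<lambda>y. \<eta> y * v (y - x0))"
    by (intro translate_pairing_tendsto[OF assms]) auto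
qed

text \<open>Near a point off \<open>Y\<close> the derivatives of the integrand are bounded by a constant times the integrable
  function \<open>norm (a s)\<close>, because the points \<open>y - X s\<close> stay in a compact set that avoids the origin.\<close>

lemma smooth_on_integral_translates:
  fixes v :: "real^'n::finite \<Rightarrow> complex"
  assumes v: "smooth_on (- {0}) v" and Y: "compact Y"
    and a: "integrable M a" and X: "X \<in> M \<rightarrow>\<^sub>M borel" "\<And>s. X s \<in> Y"
  shows "smooth_on (- Y) (\<lambda>y. \<integral>s. a s * v (y - X s) \<partial>M)"
    and "y \<in> - Y \<Longrightarrow> pderivs \<alpha> (\<lambda>y. \<integral>s. a s * v (y - X s) \<partial>M) y = (\<integral>s. a s * pderivs \<alpha> v (y - X s) \<partial>M)"
proof -
  have S: "open (- Y)" using Y compact_imp_closed by auto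
  have sm: "smooth_on (- Y) (\<lambda>y. v (y - X s))" for s by (rule smooth_on_translate[OF v X(2)])
  have smF: "smooth_on (- Y) (\<lambda>y. a s * v (y - X s))" for s
    by (intro smooth_on_mult[OF S] smooth_on_const[OF S] sm)
  have dF: "pderivs \<alpha> (\<lambda>y. a s * v (y - X s)) y = a s * pderivs \<alpha> v (y - X s)" if "y \<in> - Y" for \<alpha> s y
    using pderivs_cmult[OF S sm that, of \<alpha> "a s"] by (simp add: pderivs_shift)
  have meas: "(\<lambda>s. pderivs \<alpha> (\<lambda>y. a s * v (y - X s)) y) \<in> borel_measurable M" if y: "y \<in> - Y" for \<alpha> y
  proof -
    have "continuous_on (- {y}) (\<lambda>x. pderivs \<alpha> v (y - x))"
      by (rule continuous_on_compose2[OF smooth_on_continuous_pderivs[OF v]]) (auto intro!: continuous_intros)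
    then have "continuous_on Y (\<lambda>x. pderivs \<alpha> v (y - x))" by (rule continuous_on_subset) (use y in auto)
    then have 1: "(\<lambda>x. indicator Y x *\<^sub>R pderivs \<alpha> v (y - x)) \<in> borel_measurable borel"
      using Y by (intro borel_measurable_continuous_on_indicator) (auto intro: borel_compact)
    have 2: "(\<lambda>s. indicator Y (X s) *\<^sub>R pderivs \<alpha> v (y - X s)) = (\<lambda>s. pderivs \<alpha> v (y - X s))" using X(2) by auto
    have "(\<lambda>s. pderivs \<alpha> v (y - X s)) \<in> borel_measurable M" using measurable_compose[OF X(1) 1] unfolding 2 .
    then show ?thesis unfolding dF[OF y] using a by (intro borel_measurable_times) auto
  qed
  have dom: "\<exists>e>0. \<exists>D. integrable M D \<and>
       (\<forall>s\<in>space M. \<forall>y\<in>ball y0 e. norm (pderivs \<alpha> (\<lambda>y. a s * v (y - X s)) y) \<le> D s)" if y0: "y0 \<in> - Y" for \<alpha> y0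
  proof -
    obtain e where e: "e > 0" "cball y0 e \<subseteq> - Y" using S y0 open_contains_cball by blast
    let ?D = "{y - x | y x. y \<in> cball y0 e \<and> x \<in> Y}"
    have D: "compact ?D" "?D \<subseteq> - {0}" using compact_differences[OF compact_cball Y, of y0 e] e(2) by auto
    obtain C where C: "\<And>w. w \<in> ?D \<Longrightarrow> norm (pderivs \<alpha> v w) \<le> C"
      using compact_norm_bound[OF D(1) continuous_on_subset[OF smooth_on_continuous_pderivs[OF v] D(2)]] by meson
    have "norm (pderivs \<alpha> (\<lambda>y. a s * v (y - X s)) y) \<le> norm (a s) * C" if "y \<in> ball y0 e" for s y
    proof -
      have "y \<in> cball y0 e" using that by auto
      moreover from this have "y \<in> - Y" using e(2) by blast
      moreover from calculation(1) have "norm (pderivs \<alpha> v (y - X s)) \<le> C" by (intro C) (use X(2) in blast)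
      ultimately show ?thesis by (simp add: dF norm_mult mult_left_mono)
    qed
    moreover have "integrable M (\<lambda>s. norm (a s) * C)" using a by auto
    ultimately show ?thesis using e(1) by blast
  qed
  show "smooth_on (- Y) (\<lambda>y. \<integral>s. a s * v (y - X s) \<partial>M)" by (rule pderivs_integral(1)[OF S smF meas dom])
  show "pderivs \<alpha> (\<lambda>y. \<integral>s. a s * v (y - X s) \<partial>M) y = (\<integral>s. a s * pderivs \<alpha> v (y - X s) \<partial>M)" if "y \<in> - Y"
    unfolding dF[OF that, symmetric] by (rule pderivs_integral(2)[OF S smF meas dom that])
qed

text \<open>A distribution commutes with an integral of translates: replacing the translation vectors by
  finitely many nearby ones turns the integral into a finite sum, and these Riemann sums converge
  with all derivatives.\<close>

lemma distribution_integral_translates: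
  fixes v :: "real^'n::finite \<Rightarrow> complex" and a :: "'s \<Rightarrow> complex"
  assumes u: "distribution u" and \<eta>: "test_function \<eta>" and v: "smooth_on (- {0}) v"
    and Y: "compact Y" "fun_support \<eta> \<inter> Y = {}"
    and a: "integrable M a" and X: "X \<in> M \<rightarrow>\<^sub>M borel" "\<And>s. X s \<in> Y"
  shows "u (\<lambda>y. \<eta> y * (\<integral>s. a s * v (y - X s) \<partial>M)) = (\<integral>s. a s * u (\<lambda>y. \<eta> y * v (y - X s)) \<partial>M)"
proof -
  define G where "G x = u (\<lambda>y. \<eta> y * v (y - x))" for x
  have S: "open (- Y)" "fun_support \<eta> \<subseteq> - Y" using Y compact_imp_closed by auto
  have Gc: "continuous_on Y G" unfolding G_def by (rule continuous_on_translate_pairing[OF u \<eta> v Y])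
  obtain C where C: "\<And>x. x \<in> Y \<Longrightarrow> norm (G x) \<le> C" using compact_norm_bound[OF Y(1) Gc] by auto
  have "\<exists>Z p. finite Z \<and> Z \<subseteq> Y \<and> (\<forall>x. p x \<in> Z) \<and>
      (\<forall>x\<in>Y. dist (p x) x < inverse (real (Suc m))) \<and> p \<in> borel_measurable borel" for m
    by (rule finite_selection[OF Y(1) X(2)]) simp
  then obtain Z p where Zp: "\<And>m. finite (Z m) \<and> Z m \<subseteq> Y \<and> (\<forall>x. p m x \<in> Z m) \<and>
      (\<forall>x\<in>Y. dist (p m x) x < inverse (real (Suc m))) \<and> p m \<in> borel_measurable borel"
    by (metis (no_types))
  have Z: "finite (Z m)" "Z m \<subseteq> Y" and p: "p m x \<in> Z m" "p m \<in> borel_measurable borel" for m x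
    using Zp[of m] by auto
  have pd: "dist (p m x) x < inverse (real (Suc m))" if "x \<in> Y" for m x
    using Zp[of m] that by auto
  have pY: "p m x \<in> Y" for m x using Z p by blast
  have Xp: "(\<lambda>s. p m (X s)) \<in> M \<rightarrow>\<^sub>M borel" for m using measurable_compose[OF X(1) p(2)] .
  \<comment> \<open>The Riemann sums, written as integrals; \<open>c m z\<close> is the weight of the translation vector \<open>z\<close>.\<close>
  define f where "f m y = (\<integral>s. a s * v (y - p m (X s)) \<partial>M)" for m y
  define c where "c m z = (\<integral>s. a s * indicator {z} (p m (X s)) \<partial>M)" for m z
  have ai: "integrable M (\<lambda>s. a s * indicator {z} (p m (X s)))" for m z
  proof (rule Bochner_Integration.integrable_bound[OF a])
    have "(\<lambda>s. indicator {z} (p m (X s)) :: complex) \<in> borel_measurable M"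
      by (rule measurable_compose[OF Xp]) auto
    then show "(\<lambda>s. a s * indicator {z} (p m (X s))) \<in> borel_measurable M"
      using a by (intro borel_measurable_times) auto
  qed (auto intro!: AE_I2 simp: indicator_def)
  have simple: "(\<integral>s. a s * h (p m (X s)) \<partial>M) = (\<Sum>z\<in>Z m. c m z * h z)" for m and h :: "real^'n \<Rightarrow> complex"
  proof -
    have "a s * h (p m (X s)) = (\<Sum>z\<in>Z m. h z * (a s * indicator {z} (p m (X s))))" for s
    proof -
      have "(\<Sum>z\<in>Z m. h z * (a s * indicator {z} (p m (X s)))) = (\<Sum>z\<in>Z m. if z = p m (X s) then h z * a s else 0)"
        by (intro sum.cong refl) (auto simp: indicator_def)
      also have "\<dots> = h (p m (X s)) * a s" using Z(1) p(1) by simp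
      finally show ?thesis by simp
    qed
    then have "(\<integral>s. a s * h (p m (X s)) \<partial>M) = (\<integral>s. (\<Sum>z\<in>Z m. h z * (a s * indicator {z} (p m (X s)))) \<partial>M)" by simp
    also have "\<dots> = (\<Sum>z\<in>Z m. h z * c m z)"
      unfolding c_def by (subst Bochner_Integration.integral_sum) (auto intro: ai)
    finally show ?thesis by (simp add: mult.commute)
  qed
  have tf: "test_function (\<lambda>y. \<eta> y * v (y - x))" if "x \<in> Y" for x
    by (rule test_function_mult[OF \<eta> S smooth_on_translate[OF v that]])
  have uf: "u (\<lambda>y. \<eta> y * f m y) = (\<integral>s. a s * G (p m (X s)) \<partial>M)" for m
  proof -
    have "f m y = (\<Sum>z\<in>Z m. c m z * v (y - z))" for y
      unfolding f_def by (rule simple[where h = "\<lambda>x. v (y - x)"])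
    then have "(\<lambda>y. \<eta> y * f m y) = (\<lambda>y. \<Sum>z\<in>Z m. c m z * (\<eta> y * v (y - z)))"
      by (auto simp: sum_distrib_left mult_ac)
    then have "u (\<lambda>y. \<eta> y * f m y) = u (\<lambda>y. \<Sum>z\<in>Z m. c m z * (\<eta> y * v (y - z)))" by (simp only:)
    also have "\<dots> = (\<Sum>z\<in>Z m. c m z * G z)"
      unfolding G_def by (rule distribution_sum(2)[OF u Z(1) tf]) (use Z(2) in auto)
    also have "\<dots> = (\<integral>s. a s * G (p m (X s)) \<partial>M)" by (rule simple[symmetric])
    finally show ?thesis .
  qed
  have sf: "smooth_on (- Y) (f m)" for m
    unfolding f_def by (rule smooth_on_integral_translates(1)[OF v Y(1) a Xp pY])
  define f' where "f' y = (\<integral>s. a s * v (y - X s) \<partial>M)" for y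
  have sf': "smooth_on (- Y) f'"
    unfolding f'_def by (rule smooth_on_integral_translates(1)[OF v Y(1) a X])
  define A where "A = (\<integral>s. norm (a s) \<partial>M)"
  have A0: "A \<ge> 0" by (simp add: A_def)
  have lim: "Ck_limit N (fun_support \<eta>) f f' sequentially" for N
    unfolding Ck_limit_def
  proof (intro allI impI uniform_limitI)
    fix \<alpha> :: "'n list" and e :: real assume e: "e > 0"
    define e' where "e' = e / (A + 1)"
    have e': "e' > 0" "e' * A < e" using e A0 by (auto simp: e'_def field_simps)
    obtain d where d: "d > 0" "\<And>x x' y. x \<in> Y \<Longrightarrow> x' \<in> Y \<Longrightarrow> dist x x' < d \<Longrightarrow> y \<in> fun_support \<eta> \<Longrightarrow>
        dist (pderivs \<alpha> v (y - x)) (pderivs \<alpha> v (y - x')) < e'"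
      using translates_uniformly_close[OF smooth_on_continuous_pderivs[OF v, of \<alpha>] test_function_compact[OF \<eta>] Y e'(1)] by meson
    have "\<forall>\<^sub>F m in sequentially. inverse (real (Suc m)) < d"
      using LIMSEQ_inverse_real_of_nat d(1) by (rule order_tendstoD)
    then show "\<forall>\<^sub>F m in sequentially. \<forall>y\<in>fun_support \<eta>. dist (pderivs \<alpha> (f m) y) (pderivs \<alpha> f' y) < e"
    proof (eventually_elim, intro ballI)
      fix m y assume m: "inverse (real (Suc m)) < d" and y: "y \<in> fun_support \<eta>"
      have yY: "y \<in> - Y" using y S by auto
      have i: "integrable M (\<lambda>s. a s * pderivs \<alpha> v (y - X' s))" if X': "X' \<in> M \<rightarrow>\<^sub>M borel" "\<And>s. X' s \<in> Y" for X'
      proof -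
        have "continuous_on Y (\<lambda>x. pderivs \<alpha> v (y - x))"
          by (rule continuous_on_compose2[OF smooth_on_continuous_pderivs[OF v]]) (use yY in \<open>auto intro!: continuous_intros\<close>)
        then have cont: "(\<lambda>x. indicator Y x *\<^sub>R pderivs \<alpha> v (y - x)) \<in> borel_measurable borel"
          and "\<exists>C. \<forall>x\<in>Y. norm (pderivs \<alpha> v (y - x)) \<le> C"
          using Y by (auto intro!: borel_measurable_continuous_on_indicator compact_norm_bound intro: borel_compact)
        then obtain C where C: "\<And>x. x \<in> Y \<Longrightarrow> norm (pderivs \<alpha> v (y - x)) \<le> C" by meson
        have 2: "(\<lambda>s. indicator Y (X' s) *\<^sub>R pderivs \<alpha> v (y - X' s)) = (\<lambda>s. pderivs \<alpha> v (y - X' s))" using X'(2) by auto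
        have m: "(\<lambda>s. pderivs \<alpha> v (y - X' s)) \<in> borel_measurable M" using measurable_compose[OF X'(1) cont] unfolding 2 .
        show ?thesis
        proof (rule Bochner_Integration.integrable_bound)
          show "integrable M (\<lambda>s. norm (a s) * C)" using a by auto
          show "(\<lambda>s. a s * pderivs \<alpha> v (y - X' s)) \<in> borel_measurable M"
            using a m by (intro borel_measurable_times) auto
          show "AE s in M. norm (a s * pderivs \<alpha> v (y - X' s)) \<le> norm (norm (a s) * C)"
            using C X'(2) by (intro AE_I2) (auto simp: norm_mult abs_mult intro!: mult_left_mono intro: order_trans[OF C abs_ge_self])
        qed
      qed
      have "dist (pderivs \<alpha> (f m) y) (pderivs \<alpha> f' y)
        = norm ((\<integral>s. a s * pderivs \<alpha> v (y - p m (X s)) \<partial>M) - (\<integral>s. a s * pderivs \<alpha> v (y - X s) \<partial>M))"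
        unfolding f_def f'_def dist_norm
        by (simp add: smooth_on_integral_translates(2)[OF v Y(1) a Xp pY yY] smooth_on_integral_translates(2)[OF v Y(1) a X yY])
      also have "\<dots> = norm (\<integral>s. a s * pderivs \<alpha> v (y - p m (X s)) - a s * pderivs \<alpha> v (y - X s) \<partial>M)"
        by (subst Bochner_Integration.integral_diff[OF i[OF Xp pY] i[OF X]]) (rule refl)
      also have "\<dots> \<le> (\<integral>s. norm (a s * pderivs \<alpha> v (y - p m (X s)) - a s * pderivs \<alpha> v (y - X s)) \<partial>M)"
        by (rule integral_norm_bound)
      also have "\<dots> \<le> (\<integral>s. e' * norm (a s) \<partial>M)"
      proof (rule integral_mono)
        show "integrable M (\<lambda>s. norm (a s * pderivs \<alpha> v (y - p m (X s)) - a s * pderivs \<alpha> v (y - X s)))"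
          by (rule integrable_norm[OF Bochner_Integration.integrable_diff[OF i[OF Xp pY] i[OF X]]])
        show "integrable M (\<lambda>s. e' * norm (a s))" using a by auto
        fix s
        have "dist (p m (X s)) (X s) < d" using pd[OF X(2)[of s], of m] m by simp
        then have "norm (pderivs \<alpha> v (y - p m (X s)) - pderivs \<alpha> v (y - X s)) \<le> e'"
          using d(2)[OF pY X(2) _ y, of m "X s" s] by (simp add: dist_norm)
        from mult_left_mono[OF this norm_ge_zero[of "a s"]]
        show "norm (a s * pderivs \<alpha> v (y - p m (X s)) - a s * pderivs \<alpha> v (y - X s)) \<le> e' * norm (a s)"
          by (simp add: right_diff_distrib[symmetric] norm_mult mult.commute[of e'])
      qed
      also have "\<dots> = e' * A" by (simp add: A_def)
      also have "\<dots> < e" by (rule e')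
      finally show "dist (pderivs \<alpha> (f m) y) (pderivs \<alpha> f' y) < e" .
    qed
  qed
  have "(\<lambda>m. u (\<lambda>y. \<eta> y * f m y)) \<longlonglongrightarrow> u (\<lambda>y. \<eta> y * f' y)"
  proof (rule distribution_tendsto[OF u test_function_compact[OF \<eta>]])
    show "test_function (\<lambda>y. \<eta> y * f m y)" "test_function (\<lambda>y. \<eta> y * f' y)" for m
      by (intro test_function_mult[OF \<eta> S] sf sf')+
    show "fun_support (\<lambda>y. \<eta> y * f m y) \<subseteq> fun_support \<eta>" "fun_support (\<lambda>y. \<eta> y * f' y) \<subseteq> fun_support \<eta>" for m
      by (rule fun_support_subset[OF closed_fun_support]; simp add: fun_support_zero)+
    show "Ck_limit N (fun_support \<eta>) (\<lambda>m y. \<eta> y * f m y) (\<lambda>y. \<eta> y * f' y) sequentially" for N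
      by (intro Ck_limit_mult[OF S test_function_compact[OF \<eta>]] sf sf' lim Ck_limit_const test_function_smooth_on[OF \<eta>] S)
  qed
  moreover have "(\<lambda>m. \<integral>s. a s * G (p m (X s)) \<partial>M) \<longlonglongrightarrow> (\<integral>s. a s * G (X s) \<partial>M)"
  proof (rule integral_dominated_convergence[where w = "\<lambda>s. norm (a s) * C"])
    have GY: "(\<lambda>x. indicator Y x *\<^sub>R G x) \<in> borel_measurable borel"
      using Gc Y by (intro borel_measurable_continuous_on_indicator) (auto intro: borel_compact)
    have Gm: "(\<lambda>s. G (X' s)) \<in> borel_measurable M" if "X' \<in> M \<rightarrow>\<^sub>M borel" "\<And>s. X' s \<in> Y" for X'
    proof -
      have "(\<lambda>s. indicator Y (X' s) *\<^sub>R G (X' s)) = (\<lambda>s. G (X' s))" using that(2) by auto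
      then show ?thesis using measurable_compose[OF that(1) GY] by simp
    qed
    show "(\<lambda>s. a s * G (X s)) \<in> borel_measurable M" "(\<lambda>s. a s * G (p m (X s))) \<in> borel_measurable M" for m
      by (rule borel_measurable_times[OF borel_measurable_integrable[OF a]], rule Gm, rule X Xp, rule X pY)+
    show "integrable M (\<lambda>s. norm (a s) * C)" using a by auto
    show "AE s in M. norm (a s * G (p m (X s))) \<le> norm (a s) * C" for m
      using C[OF pY] by (intro AE_I2) (auto simp: norm_mult intro!: mult_left_mono)
    show "AE s in M. (\<lambda>m. a s * G (p m (X s))) \<longlonglongrightarrow> a s * G (X s)"
    proof (intro AE_I2 tendsto_mult tendsto_const)
      fix s
      have le: "dist (p m (X s)) (X s) \<le> inverse (real (Suc m))" for m
        by (rule less_imp_le[OF pd[OF X(2)]])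
      have "(\<lambda>m. p m (X s)) \<longlonglongrightarrow> X s"
      proof (rule tendsto_dist_iff[THEN iffD2], rule tendsto_sandwich[where f = "\<lambda>m. 0" and h = "\<lambda>m. inverse (real (Suc m))"])
        show "\<forall>\<^sub>F m in sequentially. dist (p m (X s)) (X s) \<le> inverse (real (Suc m))"
          using le by (intro always_eventually allI)
      qed (rule LIMSEQ_inverse_real_of_nat tendsto_const always_eventually | simp)+
      then show "(\<lambda>m. G (p m (X s))) \<longlonglongrightarrow> G (X s)"
        by (rule continuous_on_tendsto_compose[OF Gc _ X(2)]) (simp add: pY)
    qed
  qed
  ultimately have "u (\<lambda>y. \<eta> y * f' y) = (\<integral>s. a s * G (X s) \<partial>M)"
    unfolding uf by (rule LIMSEQ_unique)
  then show ?thesis by (simp add: f'_def G_def)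
qed

text \<open>By the fundamental theorem of calculus an increment of \<open>v\<close> is an integral of translates of its
  derivative, and the distribution may be moved under that integral. What remains is the continuity
  of the pairing with translates of the derivative.\<close>

lemma translate_pairing_has_derivative:
  fixes v :: "real^'n::finite \<Rightarrow> complex"
  assumes u: "distribution u" and \<eta>: "test_function \<eta>" and v: "smooth_on (- {0}) v"
    and Y: "compact Y" "fun_support \<eta> \<inter> Y = {}" and r: "r > 0" "cball x r \<subseteq> Y"
  shows "((\<lambda>t. u (\<lambda>y. \<eta> y * v (y - (x + t *\<^sub>R axis i 1)))) has_vector_derivative
     - u (\<lambda>y. \<eta> y * pderiv_coord i v (y - x))) (at 0)"
proof -
  define e where "e = (axis i 1 :: real^'n)"
  have ne: "norm e = 1" by (simp add: e_def)
  define v' where "v' = pderiv_coord i v"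
  have v': "smooth_on (- {0}) v'" unfolding v'_def by (rule smooth_on_pderiv_coord[OF v])
  define G where "G x = u (\<lambda>y. \<eta> y * v (y - x))" for x
  define H where "H x = u (\<lambda>y. \<eta> y * v' (y - x))" for x
  have S: "open (- Y)" "fun_support \<eta> \<subseteq> - Y" using Y compact_imp_closed by auto
  have Hc: "continuous_on Y H" unfolding H_def by (rule continuous_on_translate_pairing[OF u \<eta> v' Y])
  \<comment> \<open>The integral runs over the whole line with a weight supported in the unit interval; clamping the parameter keeps every translation vector in \<open>Y\<close>.\<close>
  define cl where "cl s = max 0 (min 1 s)" for s :: real
  have cl: "0 \<le> cl s" "cl s \<le> 1" for s by (auto simp: cl_def)
  define a where "a s = complex_of_real (indicator {0..1::real} s)" for s
  have ai: "integrable lborel a"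
  proof -
    have "integrable lborel (indicator {0..1::real} :: real \<Rightarrow> real)" by (intro integrable_real_indicator) auto
    then show ?thesis unfolding a_def by (rule integrable_of_real)
  qed
  have inY: "x + (cl s * h) *\<^sub>R e \<in> Y" if "\<bar>h\<bar> < r" for s h
  proof -
    have "norm ((cl s * h) *\<^sub>R e) \<le> 1 * \<bar>h\<bar>" using cl[of s] by (simp add: ne abs_mult mult_left_le_one_le)
    then have "x + (cl s * h) *\<^sub>R e \<in> cball x r" using that by (simp add: dist_norm)
    then show ?thesis using r by blast
  qed
  have xY: "x \<in> Y" using r by auto
  have clm: "cl \<in> borel_measurable borel" unfolding cl_def by measurable
  have Xm: "(\<lambda>s. x + (cl s * h) *\<^sub>R e) \<in> lborel \<rightarrow>\<^sub>M borel" for h using clm by measurable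
  have ftc: "v (y - (x + h *\<^sub>R e)) - v (y - x) = of_real (- h) * (\<integral>s. a s * v' (y - (x + (cl s * h) *\<^sub>R e)) \<partial>lborel)"
    if h: "\<bar>h\<bar> < r" and y: "y \<in> fun_support \<eta>" for h y
  proof -
    define F where "F s = v (y - (x + (s * h) *\<^sub>R e))" for s
    define f where "f s = of_real (- h) * v' (y - (x + (s * h) *\<^sub>R e))" for s
    have nz: "y - (x + (s * h) *\<^sub>R e) \<in> - {0}" if "0 \<le> s" "s \<le> 1" for s
    proof -
      have "x + (s * h) *\<^sub>R e \<in> Y" using inY[OF h, of s] that by (simp add: cl_def)
      then show ?thesis using y Y(2) by auto
    qed
    have "(F has_vector_derivative f s) (at s within {0..1})" if s: "0 \<le> s" "s \<le> 1" for s
    proof -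
      have 1: "((\<lambda>s. y - (x + (s * h) *\<^sub>R e)) has_derivative (\<lambda>t. - ((t * h) *\<^sub>R e))) (at s)"
        by (auto intro!: derivative_eq_intros)
      have "(v has_derivative (\<lambda>w. \<Sum>k\<in>UNIV. of_real (w $ k) * pderiv_coord k v (y - (x + (s * h) *\<^sub>R e)))) (at (y - (x + (s * h) *\<^sub>R e)))"
        by (rule has_derivative_pderivs[OF smooth_on_differentiable[OF v nz[OF s]]])
      from diff_chain_at[OF 1 this]
      have "(F has_derivative (\<lambda>t. \<Sum>k\<in>UNIV. of_real ((- ((t * h) *\<^sub>R e)) $ k) * pderiv_coord k v (y - (x + (s * h) *\<^sub>R e)))) (at s)"
        by (simp add: o_def F_def[abs_def])
      moreover have "(\<Sum>k\<in>UNIV. of_real ((- ((t * h) *\<^sub>R e)) $ k) * pderiv_coord k v (y - (x + (s * h) *\<^sub>R e))) = t *\<^sub>R f s" for t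
      proof -
        have "(\<Sum>k\<in>UNIV. of_real ((- ((t * h) *\<^sub>R e)) $ k) * pderiv_coord k v w) = of_real (- (t * h)) * pderiv_coord i v w" for w
        proof -
          have "(\<Sum>k\<in>UNIV. of_real ((- ((t * h) *\<^sub>R e)) $ k) * pderiv_coord k v w)
            = (\<Sum>k\<in>UNIV. if k = i then of_real (- (t * h)) * pderiv_coord k v w else 0)"
            by (intro sum.cong refl) (simp add: e_def axis_def)
          then show ?thesis by simp
        qed
        moreover have "t *\<^sub>R (of_real (- h) * c) = of_real (- (t * h)) * c" for c :: complex
          by (simp add: scaleR_conv_of_real)
        ultimately show ?thesis unfolding f_def v'_def by (simp only:)
      qed
      ultimately show ?thesis
        by (simp add: has_vector_derivative_def has_derivative_at_withinI)
    qed
    moreover have "continuous_on {0..1} f"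
    proof -
      have "continuous_on {0..1} (\<lambda>s. y - (x + (s * h) *\<^sub>R e))" by (intro continuous_intros)
      moreover have "(\<lambda>s. y - (x + (s * h) *\<^sub>R e)) ` {0..1} \<subseteq> - {0}"
        by (rule image_subsetI, rule nz) auto
      ultimately have "continuous_on {0..1} (\<lambda>s. v' (y - (x + (s * h) *\<^sub>R e)))"
        by (rule continuous_on_compose2[OF smooth_on_continuous[OF v']])
      then show ?thesis unfolding f_def by (intro continuous_on_mult continuous_on_const)
    qed
    ultimately have "(\<integral>s. indicator {0..1} s *\<^sub>R f s \<partial>lborel) = F 1 - F 0"
      by (intro integral_FTC_atLeastAtMost) auto
    moreover have "indicator {0..1} s *\<^sub>R f s = of_real (- h) * (a s * v' (y - (x + (cl s * h) *\<^sub>R e)))" for s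
      by (auto simp: f_def a_def cl_def indicator_def)
    ultimately show ?thesis by (simp add: F_def)
  qed
  have incr: "G (x + h *\<^sub>R e) - G x = of_real (- h) * (\<integral>s. a s * H (x + (cl s * h) *\<^sub>R e) \<partial>lborel)"
    if h: "\<bar>h\<bar> < r" for h
  proof -
    have xh: "x + h *\<^sub>R e \<in> Y" using inY[OF h, of 1] by (simp add: cl_def)
    have tf: "test_function (\<lambda>y. \<eta> y * v (y - x))" if "x \<in> Y" for x
      by (rule test_function_mult[OF \<eta> S smooth_on_translate[OF v that]])
    have ti: "test_function (\<lambda>y. \<eta> y * (\<integral>s. a s * v' (y - (x + (cl s * h) *\<^sub>R e)) \<partial>lborel))"
      by (rule test_function_mult[OF \<eta> S smooth_on_integral_translates(1)[OF v' Y(1) ai Xm inY[OF h]]])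
    have eq: "1 * (\<eta> y * v (y - (x + h *\<^sub>R e))) + (-1) * (\<eta> y * v (y - x))
       = of_real (- h) * (\<eta> y * (\<integral>s. a s * v' (y - (x + (cl s * h) *\<^sub>R e)) \<partial>lborel)) + 0 * (\<eta> y * v (y - x))" for y
    proof (cases "y \<in> fun_support \<eta>")
      case True
      have "1 * (\<eta> y * v (y - (x + h *\<^sub>R e))) + (-1) * (\<eta> y * v (y - x)) = \<eta> y * (v (y - (x + h *\<^sub>R e)) - v (y - x))"
        by (simp add: algebra_simps)
      then show ?thesis unfolding ftc[OF h True] by simp
    qed (simp add: fun_support_zero)
    have "G (x + h *\<^sub>R e) - G x = u (\<lambda>y. 1 * (\<eta> y * v (y - (x + h *\<^sub>R e))) + (-1) * (\<eta> y * v (y - x)))"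
      unfolding G_def by (subst distribution_lin[OF u tf[OF xh] tf[OF xY]]) simp
    also have "\<dots> = of_real (- h) * u (\<lambda>y. \<eta> y * (\<integral>s. a s * v' (y - (x + (cl s * h) *\<^sub>R e)) \<partial>lborel))"
      unfolding eq by (subst distribution_lin[OF u ti tf[OF xY]]) simp
    also have "u (\<lambda>y. \<eta> y * (\<integral>s. a s * v' (y - (x + (cl s * h) *\<^sub>R e)) \<partial>lborel)) = (\<integral>s. a s * H (x + (cl s * h) *\<^sub>R e) \<partial>lborel)"
      unfolding H_def by (rule distribution_integral_translates[OF u \<eta> v' Y ai Xm inY[OF h]])
    finally show ?thesis .
  qed
  have aone: "(\<integral>s. a s * c \<partial>lborel) = c" for c
  proof -
    have "(\<integral>s. a s \<partial>lborel) = of_real (\<integral>s. indicator {0..1::real} s \<partial>lborel)"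
      unfolding a_def by (rule integral_complex_of_real)
    then show ?thesis by simp
  qed
  have "((\<lambda>t. G (x + t *\<^sub>R e)) has_vector_derivative - H x) (at 0)"
    unfolding has_vector_derivative_def has_derivative_at
  proof
    show "bounded_linear (\<lambda>h. h *\<^sub>R - H x)" by (rule bounded_linear_scaleR_left)
    show "((\<lambda>h. norm (G (x + (0 + h) *\<^sub>R e) - G (x + 0 *\<^sub>R e) - h *\<^sub>R - H x) / norm h) \<longlongrightarrow> 0) (at 0)"
    proof (rule tendstoI)
      fix \<epsilon> :: real assume \<epsilon>: "\<epsilon> > 0"
      obtain d where d: "d > 0" "\<And>z. z \<in> Y \<Longrightarrow> dist z x < d \<Longrightarrow> dist (H z) (H x) < \<epsilon> / 2"
        using Hc xY \<epsilon> unfolding continuous_on_iff by (meson half_gt_zero)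
      have "norm (G (x + h *\<^sub>R e) - G x - h *\<^sub>R - H x) / \<bar>h\<bar> < \<epsilon>" if h: "h \<noteq> 0" "\<bar>h\<bar> < min r d" for h
      proof -
        have hr: "\<bar>h\<bar> < r" using h by simp
        let ?X = "\<lambda>s. x + (cl s * h) *\<^sub>R e"
        have close: "dist (H (?X s)) (H x) \<le> \<epsilon> / 2" for s
        proof -
          have "norm ((cl s * h) *\<^sub>R e) \<le> 1 * \<bar>h\<bar>" using cl[of s] by (simp add: ne abs_mult mult_left_le_one_le)
          then have "dist (?X s) x < d" using h by (simp add: dist_norm)
          then show ?thesis using d(2)[OF inY[OF hr]] by (simp add: less_imp_le)
        qed
        have Hm: "(\<lambda>s. H (?X s)) \<in> borel_measurable lborel"
        proof -
          have HY: "(\<lambda>x. indicator Y x *\<^sub>R H x) \<in> borel_measurable borel"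
            using Hc Y by (intro borel_measurable_continuous_on_indicator) (auto intro: borel_compact)
          have "(\<lambda>s. indicator Y (?X s) *\<^sub>R H (?X s)) = (\<lambda>s. H (?X s))" using inY[OF hr] by auto
          then show ?thesis using measurable_compose[OF Xm HY, of h] by simp
        qed
        have bnd: "norm (a s * (H (?X s) - H x)) \<le> norm (a s) * (\<epsilon> / 2)" for s
          using mult_left_mono[OF close[of s, unfolded dist_norm] norm_ge_zero[of "a s"]] by (simp only: norm_mult)
        have am: "a \<in> borel_measurable lborel" using ai by auto
        have ni: "integrable lborel (\<lambda>s. norm (a s) * (\<epsilon> / 2))" using ai by auto
        have di: "integrable lborel (\<lambda>s. a s * (H (?X s) - H x))"
        proof (rule Bochner_Integration.integrable_bound[OF ni])
          show "(\<lambda>s. a s * (H (?X s) - H x)) \<in> borel_measurable lborel"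
            using am Hm by (intro borel_measurable_times borel_measurable_diff borel_measurable_const)
          show "AE s in lborel. norm (a s * (H (?X s) - H x)) \<le> norm (norm (a s) * (\<epsilon> / 2))"
            by (intro AE_I2 order_trans[OF bnd]) simp
        qed
        have ci: "integrable lborel (\<lambda>s. a s * H x)" using ai by auto
        have sum: "(\<integral>s. a s * H (?X s) \<partial>lborel) - H x = (\<integral>s. a s * (H (?X s) - H x) \<partial>lborel)"
        proof -
          have "(\<integral>s. a s * H (?X s) \<partial>lborel) = (\<integral>s. a s * (H (?X s) - H x) + a s * H x \<partial>lborel)"
            by (simp add: algebra_simps)
          also have "\<dots> = (\<integral>s. a s * (H (?X s) - H x) \<partial>lborel) + H x"
            by (subst Bochner_Integration.integral_add[OF di ci]) (simp only: aone)
          finally show ?thesis by simp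
        qed
        have "norm (\<integral>s. a s * (H (?X s) - H x) \<partial>lborel) \<le> (\<integral>s. norm (a s * (H (?X s) - H x)) \<partial>lborel)"
          by (rule integral_norm_bound)
        also have "\<dots> \<le> (\<integral>s. norm (a s) * (\<epsilon> / 2) \<partial>lborel)"
          by (rule integral_mono[OF integrable_norm[OF di] ni bnd])
        also have "\<dots> = \<epsilon> / 2" by (simp add: a_def)
        finally have le: "norm ((\<integral>s. a s * H (?X s) \<partial>lborel) - H x) \<le> \<epsilon> / 2" unfolding sum .
        have "G (x + h *\<^sub>R e) - G x - h *\<^sub>R - H x = of_real (- h) * ((\<integral>s. a s * H (?X s) \<partial>lborel) - H x)"
          unfolding incr[OF hr] by (simp add: scaleR_conv_of_real algebra_simps)
        then have "norm (G (x + h *\<^sub>R e) - G x - h *\<^sub>R - H x) = \<bar>h\<bar> * norm ((\<integral>s. a s * H (?X s) \<partial>lborel) - H x)"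
          by (simp add: norm_mult)
        then show ?thesis using le h \<epsilon> by simp
      qed
      then show "\<forall>\<^sub>F h in at 0. dist (norm (G (x + (0 + h) *\<^sub>R e) - G (x + 0 *\<^sub>R e) - h *\<^sub>R - H x) / norm h) 0 < \<epsilon>"
        unfolding eventually_at using r(1) d(1) by (intro exI[of _ "min r d"]) (auto simp: dist_real_def)
    qed
  qed
  then show ?thesis unfolding G_def H_def v'_def e_def .
qed

section \<open>Approximation by polynomials with all derivatives\<close>

lemma smooth_on_polynomial: "Q \<in> algebra_gen coords \<Longrightarrow> open S \<Longrightarrow> smooth_on S Q"
  by (erule smooth_on_algebra_gen[rotated 2]) (auto simp: coords_def smooth_on_coord)

text \<open>This separation of variables shows that the convolution of a test function with a polynomial is
  again a polynomial.\<close>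

lemma polynomial_translate:
  assumes "P \<in> algebra_gen coords"
  shows "\<exists>L. (\<forall>(p, q)\<in>set L. p \<in> algebra_gen coords \<and> q \<in> algebra_gen coords) \<and>
     (\<forall>z y. P (z - y) = (\<Sum>(p, q)\<leftarrow>L. p z * q y))"
  using assms
proof induction
  case (gen g)
  then obtain i where i: "g = (\<lambda>z. complex_of_real (z $ i))" unfolding coords_def by (rule rangeE)
  have "(\<lambda>y. (-1) * g y) \<in> algebra_gen coords" by (intro algebra_gen.mult algebra_gen.const algebra_gen.gen gen)
  then show ?case using gen i
    by (intro exI[of _ "[(g, \<lambda>y. 1), (\<lambda>z. 1, \<lambda>y. (-1) * g y)]"]) (auto intro: algebra_gen.gen algebra_gen.const)
next
  case (const c)
  then show ?case by (intro exI[of _ "[(\<lambda>z. c, \<lambda>y. 1)]"]) (auto intro: algebra_gen.const)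
next
  case (add f g)
  then obtain L L' where "\<forall>(p, q)\<in>set L. p \<in> algebra_gen coords \<and> q \<in> algebra_gen coords"
     "\<forall>z y. f (z - y) = (\<Sum>(p, q)\<leftarrow>L. p z * q y)" "\<forall>(p, q)\<in>set L'. p \<in> algebra_gen coords \<and> q \<in> algebra_gen coords"
     "\<forall>z y. g (z - y) = (\<Sum>(p, q)\<leftarrow>L'. p z * q y)" by meson
  then show ?case by (intro exI[of _ "L @ L'"]) (simp add: ball_Un)
next
  case (mult f g)
  then obtain L L' where L: "\<forall>(p, q)\<in>set L. p \<in> algebra_gen coords \<and> q \<in> algebra_gen coords"
     "\<forall>z y. f (z - y) = (\<Sum>(p, q)\<leftarrow>L. p z * q y)" "\<forall>(p, q)\<in>set L'. p \<in> algebra_gen coords \<and> q \<in> algebra_gen coords"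
     "\<forall>z y. g (z - y) = (\<Sum>(p, q)\<leftarrow>L'. p z * q y)" by meson
  \<comment> \<open>All products of a term of \<open>L\<close> with a term of \<open>L'\<close>.\<close>
  define M where "M = concat (map (\<lambda>(p, q). map (\<lambda>(p', q'). (\<lambda>z. p z * p' z, \<lambda>y. q y * q' y)) L') L)"
  have 1: "(\<Sum>(p', q')\<leftarrow>map (\<lambda>(p', q'). (\<lambda>z. p z * p' z, \<lambda>y. q y * q' y)) L'. p' z * q' y)
     = p z * q y * (\<Sum>(p', q')\<leftarrow>L'. p' z * q' y)" for p q z y
    by (induction L') (auto simp: algebra_simps)
  have "(\<Sum>(p, q)\<leftarrow>M. p z * q y) = (\<Sum>(p, q)\<leftarrow>L. p z * q y) * (\<Sum>(p', q')\<leftarrow>L'. p' z * q' y)" for z y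
    unfolding M_def by (induction L) (auto simp: 1 distrib_right simp del: map_map)
  moreover have "\<forall>(p, q)\<in>set M. p \<in> algebra_gen coords \<and> q \<in> algebra_gen coords"
  proof
    fix x assume "x \<in> set M"
    then obtain p q p' q' where x: "(p, q) \<in> set L" "(p', q') \<in> set L'" "x = (\<lambda>z. p z * p' z, \<lambda>y. q y * q' y)"
      unfolding M_def by (auto simp: case_prod_unfold)
    have "p \<in> algebra_gen coords" "q \<in> algebra_gen coords" "p' \<in> algebra_gen coords" "q' \<in> algebra_gen coords"
      using x(1,2) L(1,3) by auto
    then show "case x of (p, q) \<Rightarrow> p \<in> algebra_gen coords \<and> q \<in> algebra_gen coords"
      unfolding x(3) by (auto intro!: algebra_gen.mult)
  qed
  ultimately show ?case using L(2,4) by (intro exI[of _ M]) simp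
qed

lemma convol_polynomial:
  assumes \<psi>: "test_function \<psi>" and P: "P \<in> algebra_gen coords"
  shows "convol \<psi> P \<in> algebra_gen coords"
proof -
  obtain L where L: "\<forall>(p, q)\<in>set L. p \<in> algebra_gen coords \<and> q \<in> algebra_gen coords"
     "\<forall>z y. P (z - y) = (\<Sum>(p, q)\<leftarrow>L. p z * q y)"
    using polynomial_translate[OF P] by meson
  have "(\<forall>z. integrable lebesgue (\<lambda>y. \<psi> y * (\<Sum>(p, q)\<leftarrow>L. p z * q y))) \<and>
      (\<lambda>z. LINT y|lebesgue. \<psi> y * (\<Sum>(p, q)\<leftarrow>L. p z * q y)) \<in> algebra_gen coords"
    using L(1)
  proof (induction L)
    case Nil
    then show ?case by (simp add: algebra_gen.const)
  next
    case (Cons a L)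
    obtain p q where a: "a = (p, q)" by (cases a)
    have pq: "p \<in> algebra_gen coords" "q \<in> algebra_gen coords" using Cons.prems a by auto
    have IH: "integrable lebesgue (\<lambda>y. \<psi> y * (\<Sum>(p, q)\<leftarrow>L. p z * q y))"
      "(\<lambda>z. LINT y|lebesgue. \<psi> y * (\<Sum>(p, q)\<leftarrow>L. p z * q y)) \<in> algebra_gen coords" for z
      using Cons by auto
    have i: "integrable lebesgue (\<lambda>y. \<psi> y * q y)"
      by (rule test_function_integrable[OF test_function_mult[OF \<psi> open_UNIV subset_UNIV smooth_on_polynomial[OF pq(2) open_UNIV]]])
    have e: "(\<lambda>y. \<psi> y * (\<Sum>(p, q)\<leftarrow>a # L. p z * q y)) = (\<lambda>y. p z * (\<psi> y * q y) + \<psi> y * (\<Sum>(p, q)\<leftarrow>L. p z * q y))" for z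
      by (auto simp: a algebra_simps)
    have "(\<lambda>z. LINT y|lebesgue. \<psi> y * (\<Sum>(p, q)\<leftarrow>a # L. p z * q y))
       = (\<lambda>z. p z * (LINT y|lebesgue. \<psi> y * q y) + (LINT y|lebesgue. \<psi> y * (\<Sum>(p, q)\<leftarrow>L. p z * q y)))"
      unfolding e using i IH by (intro ext) (subst Bochner_Integration.integral_add; simp)
    then show ?case
      using i IH(1) algebra_gen.add[OF algebra_gen.mult[OF pq(1) algebra_gen.const] IH(2)]
      unfolding e by (simp only: Bochner_Integration.integrable_add integrable_mult_right simp_thms all_simps)
  qed
  then show ?thesis unfolding convol_def[abs_def] using L(2) by simp
qed

lemma continuous_set_integrable_cball:
  fixes f :: "real^'n::finite \<Rightarrow> complex"
  assumes "continuous_on UNIV f"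
  shows "set_integrable lebesgue (cball 0 R) f"
proof -
  have "integrable lborel (\<lambda>x. indicator (cball 0 R) x *\<^sub>R f x)"
    by (rule borel_integrable_compact[OF compact_cball continuous_on_subset[OF assms]]) simp
  then show ?thesis unfolding set_integrable_def
    by (subst integrable_completion) (auto dest: borel_measurable_integrable)
qed

lemma test_function_uniformly_continuous:
  fixes \<phi> :: "real^'n::finite \<Rightarrow> complex"
  assumes "test_function \<phi>" "e > 0"
  shows "\<exists>d>0. \<forall>z v. norm z \<le> R \<longrightarrow> norm v < d \<longrightarrow> norm (\<phi> (z - v) - \<phi> z) < e"
proof -
  have "uniformly_continuous_on (cball 0 (R + 1)) \<phi>"
    by (rule compact_uniformly_continuous[OF smooth_on_continuous[OF smooth_on_subset[OF test_function_smooth_on[OF assms(1) open_UNIV]]] compact_cball]) simp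
  then have "\<exists>d>0. \<forall>x\<in>cball 0 (R + 1). \<forall>x'\<in>cball 0 (R + 1). dist x' x < d \<longrightarrow> dist (\<phi> x') (\<phi> x) < e"
    using assms(2) unfolding uniformly_continuous_on_def by simp
  then obtain d where d: "d > 0" "\<forall>x\<in>cball 0 (R + 1). \<forall>x'\<in>cball 0 (R + 1). dist x' x < d \<longrightarrow> dist (\<phi> x') (\<phi> x) < e"
    by (elim exE conjE)
  have "norm (\<phi> (z - v) - \<phi> z) < e" if A: "norm z \<le> R" "norm v < min d 1" for z v
  proof -
    have "norm (z - v) \<le> R + 1" using norm_triangle_ineq4[of z v] A by linarith
    then have "z - v \<in> cball 0 (R + 1)" "z \<in> cball 0 (R + 1)" using A by simp_all
    moreover have "dist (z - v) z < d" using A by (simp add: dist_norm)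
    ultimately have "dist (\<phi> (z - v)) (\<phi> z) < e" using d(2) by blast
    then show ?thesis by (simp add: dist_norm)
  qed
  then show ?thesis using d(1) by (intro exI[of _ "min d 1"]) auto
qed

text \<open>Convolution with a mollifier changes the derivatives of \<open>\<psi>\<close> up to a given order by little. Replacing
  the mollifier by a polynomial that is uniformly close to it changes little again, because the
  derivatives fall on \<open>\<psi>\<close>, and it makes the convolution a polynomial.\<close>

lemma polynomial_approximation:
  fixes \<psi> :: "real^'n::finite \<Rightarrow> complex"
  assumes \<psi>: "test_function \<psi>" and A: "finite A" and e: "e > 0"
  shows "\<exists>Q\<in>algebra_gen coords. \<forall>\<alpha>\<in>A. \<forall>z\<in>cball 0 \<rho>. norm (pderivs \<alpha> Q z - pderivs \<alpha> \<psi> z) < e"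
proof -
  have tp: "test_function (pderivs \<alpha> \<psi>)" for \<alpha> by (rule test_function_pderivs[OF \<psi>])
  obtain R where "\<forall>x\<in>fun_support \<psi>. norm x \<le> R"
    using compact_imp_bounded[OF test_function_compact[OF \<psi>]] unfolding bounded_iff by (rule exE)
  then have R: "pderivs \<alpha> \<psi> x = 0" if "norm x > R" for x \<alpha>
  proof -
    have "x \<notin> fun_support (pderivs \<alpha> \<psi>)"
      using \<open>\<forall>x\<in>fun_support \<psi>. norm x \<le> R\<close> that subsetD[OF fun_support_pderivs] by (meson not_le)
    then show ?thesis by (rule fun_support_zero)
  qed
  have "\<exists>d>0. \<forall>z v. norm z \<le> \<rho> \<longrightarrow> norm v < d \<longrightarrow> norm (pderivs \<alpha> \<psi> (z - v) - pderivs \<alpha> \<psi> z) < e / 2" for \<alpha>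
    by (rule test_function_uniformly_continuous[OF tp]) (use e in simp)
  then obtain d where d: "\<And>\<alpha>. d \<alpha> > 0"
    "\<And>\<alpha> z v. norm z \<le> \<rho> \<Longrightarrow> norm v < d \<alpha> \<Longrightarrow> norm (pderivs \<alpha> \<psi> (z - v) - pderivs \<alpha> \<psi> z) < e / 2" by metis
  \<comment> \<open>Mollifying at scale \<open>\<delta>\<close> costs at most \<open>e / 2\<close> in each derivative.\<close>
  define \<delta> where "\<delta> = Min (insert 1 (d ` A))"
  have \<delta>: "\<delta> > 0" "\<And>\<alpha>. \<alpha> \<in> A \<Longrightarrow> \<delta> \<le> d \<alpha>" using A d(1) by (auto simp: \<delta>_def)
  obtain m :: "real^'n \<Rightarrow> complex" where m: "test_function m"
    "\<And>x. norm x \<ge> \<delta> \<Longrightarrow> m x = 0" "\<And>x. m x = of_real (norm (m x))"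
    "(LINT x|lebesgue. norm (m x)) = 1" "(LINT x|lebesgue. m x) = 1"
    using mollifier_exists[OF \<delta>(1)] by metis
  define I where "I \<alpha> = (LINT x|lebesgue. norm (pderivs \<alpha> \<psi> x))" for \<alpha>
  have I0: "I \<alpha> \<ge> 0" for \<alpha> unfolding I_def by (intro Bochner_Integration.integral_nonneg) simp
  \<comment> \<open>A uniform error \<open>e / (2 * B)\<close> in the mollifier costs less than \<open>e / 2\<close>, since \<open>B\<close> exceeds the integrals of the norms of the derivatives.\<close>
  define B where "B = Max (insert 0 (I ` A)) + 1"
  have B: "B > 0" "\<And>\<alpha>. \<alpha> \<in> A \<Longrightarrow> I \<alpha> < B"
  proof -
    have "0 \<le> Max (insert 0 (I ` A))" using A by simp
    then show "B > 0" by (simp add: B_def)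
    show "I \<alpha> < B" if "\<alpha> \<in> A" for \<alpha>
    proof -
      have "I \<alpha> \<le> Max (insert 0 (I ` A))" using A that by simp
      then show ?thesis by (simp add: B_def)
    qed
  qed
  have mc: "continuous_on UNIV m" by (rule smooth_on_continuous[OF test_function_smooth_on[OF m(1) open_UNIV]])
  \<comment> \<open>For \<open>norm z \<le> \<rho>\<close> the convolution at \<open>z\<close> involves only points of norm at most \<open>\<rho> + R\<close>.\<close>
  have "continuous_on (cball 0 (\<rho> + R)) (\<lambda>x. norm (m x))"
    by (intro continuous_on_norm continuous_on_subset[OF mc]) simp
  then obtain p where p: "real_polynomial_function p" "\<And>x. x \<in> cball 0 (\<rho> + R) \<Longrightarrow> \<bar>norm (m x) - p x\<bar> < e / (2 * B)"
    using Stone_Weierstrass_real_polynomial_function[OF compact_cball, of 0 "\<rho> + R" "\<lambda>x. norm (m x)" "e / (2 * B)"] e B by auto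
  define P where "P = (\<lambda>x. complex_of_real (p x))"
  have P: "P \<in> algebra_gen coords" unfolding P_def by (rule real_polynomial_algebra_gen[OF p(1)])
  have Pc: "continuous_on UNIV P" by (rule smooth_on_continuous[OF smooth_on_polynomial[OF P open_UNIV]])
  have Pm: "P \<in> borel_measurable borel" by (rule borel_measurable_continuous_onI[OF Pc])
  have mm: "m \<in> borel_measurable borel" by (rule test_function_borel[OF m(1)])
  have close: "norm (P x - m x) \<le> e / (2 * B)" if "norm x \<le> \<rho> + R" for x
  proof -
    have "P x - m x = of_real (p x - norm (m x))" by (subst m(3)) (simp add: P_def)
    then have "norm (P x - m x) = \<bar>p x - norm (m x)\<bar>" by (simp only: norm_of_real)
    then show ?thesis using p(2)[of x] that by auto
  qed
  show ?thesis
  proof (intro bexI ballI)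
    show "convol \<psi> P \<in> algebra_gen coords" by (rule convol_polynomial[OF \<psi> P])
    fix \<alpha> and z :: "real^'n" assume \<alpha>: "\<alpha> \<in> A" and z: "z \<in> cball 0 \<rho>"
    define w where "w = pderivs \<alpha> \<psi>"
    have wt: "test_function w" unfolding w_def by (rule tp)
    have wm: "w \<in> borel_measurable borel" by (rule test_function_borel[OF wt])
    have prod_int: "integrable lebesgue (\<lambda>v. w (z - v) * g v)"
      if g: "continuous_on UNIV g" for g
    proof -
      have gm: "g \<in> borel_measurable borel" by (rule borel_measurable_continuous_onI[OF g])
      obtain Bw where Bw: "\<And>x. norm (w x) \<le> Bw" "Bw \<ge> 0" using test_function_bounded[OF wt] by blast
      have "integrable lebesgue (\<lambda>v. Bw * norm (indicator (cball 0 (\<rho> + R)) v *\<^sub>R g v))"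
        using integrable_norm[OF continuous_set_integrable_cball[OF g, of "\<rho> + R", unfolded set_integrable_def]]
        by (rule integrable_mult_right)
      then show ?thesis
      proof (rule Bochner_Integration.integrable_bound)
        show "(\<lambda>v. w (z - v) * g v) \<in> borel_measurable lebesgue"
        proof (rule borel_measurable_lebesgueI)
          note [measurable] = wm gm
          show "(\<lambda>v. w (z - v) * g v) \<in> borel_measurable borel" by measurable
        qed
        show "AE v in lebesgue. norm (w (z - v) * g v) \<le> norm (Bw * norm (indicator (cball 0 (\<rho> + R)) v *\<^sub>R g v))"
        proof (rule AE_I2)
          fix v
          show "norm (w (z - v) * g v) \<le> norm (Bw * norm (indicator (cball 0 (\<rho> + R)) v *\<^sub>R g v))"
          proof (cases "norm v \<le> \<rho> + R")
            case True
            then show ?thesis using Bw mult_right_mono[OF Bw(1)[of "z - v"] norm_ge_zero[of "g v"]] by (simp add: norm_mult)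
          next
            case False
            then have "norm (z - v) > R" using z norm_triangle_ineq2[of v z] by (simp add: norm_minus_commute)
            then show ?thesis using R by (simp add: w_def)
          qed
        qed
      qed
    qed
    have wi: "(LINT v|lebesgue. norm (w (z - v))) = I \<alpha>"
    proof -
      have "complex_of_real (LINT v|lebesgue. norm (w (z - v))) = (LINT v|lebesgue. of_real (norm (w (z - v))))"
        by (rule integral_complex_of_real[symmetric])
      also have "\<dots> = (LINT v|lebesgue. of_real (norm (w v)))"
        by (rule integral_reflect[of "\<lambda>x. of_real (norm (w x))"]) (use wm in \<open>auto intro!: borel_measurable_of_real borel_measurable_norm\<close>)
      also have "\<dots> = of_real (I \<alpha>)" unfolding I_def w_def by (rule integral_complex_of_real)
      finally show ?thesis by (simp only: of_real_eq_iff)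
    qed
    have winorm: "integrable lebesgue (\<lambda>v. norm (w (z - v)))"
      using integrable_norm[OF prod_int[of "\<lambda>x. 1"]] by simp
    have d1: "pderivs \<alpha> (convol \<psi> P) z = (LINT v|lebesgue. w (z - v) * P v)"
      unfolding w_def by (rule pderivs_convol(2)[OF \<psi> Pm continuous_set_integrable_cball[OF Pc]])
    have "norm ((LINT v|lebesgue. w (z - v) * P v) - (LINT v|lebesgue. w (z - v) * m v))
       = norm (LINT v|lebesgue. w (z - v) * P v - w (z - v) * m v)"
      by (subst Bochner_Integration.integral_diff[OF prod_int[OF Pc] prod_int[OF mc]]) (rule refl)
    also have "\<dots> \<le> (LINT v|lebesgue. norm (w (z - v) * P v - w (z - v) * m v))" by (rule integral_norm_bound)
    also have "\<dots> \<le> (LINT v|lebesgue. norm (w (z - v)) * (e / (2 * B)))"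
    proof (rule integral_mono)
      show "integrable lebesgue (\<lambda>v. norm (w (z - v) * P v - w (z - v) * m v))"
        by (rule integrable_norm[OF Bochner_Integration.integrable_diff[OF prod_int[OF Pc] prod_int[OF mc]]])
      show "integrable lebesgue (\<lambda>v. norm (w (z - v)) * (e / (2 * B)))" using winorm by (rule integrable_mult_left)
      fix v
      show "norm (w (z - v) * P v - w (z - v) * m v) \<le> norm (w (z - v)) * (e / (2 * B))"
      proof (cases "norm v \<le> \<rho> + R")
        case True
        then show ?thesis using mult_left_mono[OF close[OF True] norm_ge_zero[of "w (z - v)"]]
          by (simp add: right_diff_distrib[symmetric] norm_mult)
      next
        case False
        then have "norm (z - v) > R" using z norm_triangle_ineq2[of v z] by (simp add: norm_minus_commute)
        then show ?thesis using R by (simp add: w_def)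
      qed
    qed
    also have "\<dots> = I \<alpha> * (e / (2 * B))" by (simp add: wi)
    also have "\<dots> < B * (e / (2 * B))" using B(2)[OF \<alpha>] e B(1) by (intro mult_strict_right_mono) auto
    also have "\<dots> = e / 2" using B(1) by simp
    finally have 1: "norm ((LINT v|lebesgue. w (z - v) * P v) - (LINT v|lebesgue. w (z - v) * m v)) < e / 2" .
    have mi: "integrable lebesgue (\<lambda>v. w z * m v)" using test_function_integrable[OF m(1)] by (rule integrable_mult_right)
    have wz: "w z = (LINT v|lebesgue. w z * m v)" using m(5) by simp
    have "norm ((LINT v|lebesgue. w (z - v) * m v) - w z) = norm (LINT v|lebesgue. w (z - v) * m v - w z * m v)"
      by (subst Bochner_Integration.integral_diff[OF prod_int[OF mc] mi]) (simp only: wz[symmetric])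
    also have "\<dots> \<le> (LINT v|lebesgue. norm (w (z - v) * m v - w z * m v))" by (rule integral_norm_bound)
    also have "\<dots> \<le> (LINT v|lebesgue. (e / 2) * norm (m v))"
    proof (rule integral_mono)
      show "integrable lebesgue (\<lambda>v. norm (w (z - v) * m v - w z * m v))"
        by (rule integrable_norm[OF Bochner_Integration.integrable_diff[OF prod_int[OF mc] mi]])
      show "integrable lebesgue (\<lambda>v. (e / 2) * norm (m v))"
        using integrable_norm[OF test_function_integrable[OF m(1)]] by (rule integrable_mult_right)
      fix v
      show "norm (w (z - v) * m v - w z * m v) \<le> (e / 2) * norm (m v)"
      proof (cases "norm v < \<delta>")
        case True
        then have "norm (w (z - v) - w z) \<le> e / 2"
          unfolding w_def using d(2)[of z v \<alpha>] z \<delta>(2)[OF \<alpha>] by simp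
        from mult_right_mono[OF this norm_ge_zero[of "m v"]] show ?thesis
          by (simp add: left_diff_distrib[symmetric] norm_mult)
      qed (use m(2) in simp)
    qed
    also have "\<dots> = e / 2" using m(4) by simp
    finally have 2: "norm ((LINT v|lebesgue. w (z - v) * m v) - w z) \<le> e / 2" .
    show "norm (pderivs \<alpha> (convol \<psi> P) z - pderivs \<alpha> \<psi> z) < e"
      unfolding d1 w_def[symmetric]
      using norm_triangle_ineq[of "(LINT v|lebesgue. w (z - v) * P v) - (LINT v|lebesgue. w (z - v) * m v)"
         "(LINT v|lebesgue. w (z - v) * m v) - w z"] 1 2 by simp
  qed
qed

lemma polynomial_sequence:
  fixes \<psi> :: "real^'n::finite \<Rightarrow> complex"
  assumes \<psi>: "test_function \<psi>"
  obtains Q where "\<And>m::nat. Q m \<in> algebra_gen coords" "\<And>N. Ck_limit N (cball 0 \<rho>) Q \<psi> sequentially"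
proof -
  have ex: "\<exists>Q\<in>algebra_gen coords. \<forall>\<alpha>\<in>{\<alpha> :: 'n list. length \<alpha> \<le> m}. \<forall>z\<in>cball 0 \<rho>.
      norm (pderivs \<alpha> Q z - pderivs \<alpha> \<psi> z) < inverse (real (Suc m))" for m
    by (rule polynomial_approximation[OF \<psi>]) (use finite_lists_length_le[of "UNIV :: 'n set" m] in auto)
  have "\<forall>m. \<exists>Q. Q \<in> algebra_gen coords \<and> (\<forall>\<alpha>. length \<alpha> \<le> m \<longrightarrow> (\<forall>z\<in>cball 0 \<rho>.
      norm (pderivs \<alpha> Q z - pderivs \<alpha> \<psi> z) < inverse (real (Suc m))))"
  proof
    fix m
    obtain Q where "Q \<in> algebra_gen coords" "\<forall>\<alpha>\<in>{\<alpha> :: 'n list. length \<alpha> \<le> m}. \<forall>z\<in>cball 0 \<rho>.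
      norm (pderivs \<alpha> Q z - pderivs \<alpha> \<psi> z) < inverse (real (Suc m))" using ex[of m] by (elim bexE)
    then show "\<exists>Q. Q \<in> algebra_gen coords \<and> (\<forall>\<alpha>. length \<alpha> \<le> m \<longrightarrow> (\<forall>z\<in>cball 0 \<rho>.
      norm (pderivs \<alpha> Q z - pderivs \<alpha> \<psi> z) < inverse (real (Suc m))))" by (intro exI[of _ Q]) simp
  qed
  then obtain Q where Q: "\<forall>m. Q m \<in> algebra_gen coords \<and> (\<forall>\<alpha>. length \<alpha> \<le> m \<longrightarrow> (\<forall>z\<in>cball 0 \<rho>.
      norm (pderivs \<alpha> (Q m) z - pderivs \<alpha> \<psi> z) < inverse (real (Suc m))))" by (rule choice[THEN exE])
  show ?thesis
  proof (rule that[of Q])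
    show "Q m \<in> algebra_gen coords" for m using Q by blast
    show "Ck_limit N (cball 0 \<rho>) Q \<psi> sequentially" for N
      unfolding Ck_limit_def
    proof (intro allI impI uniform_limitI)
      fix \<alpha> :: "'n list" and e :: real assume A: "length \<alpha> \<le> N" "e > 0"
      have "\<forall>\<^sub>F m in sequentially. inverse (real (Suc m)) < e"
        using LIMSEQ_inverse_real_of_nat A(2) by (rule order_tendstoD)
      then show "\<forall>\<^sub>F m in sequentially. \<forall>z\<in>cball 0 \<rho>. dist (pderivs \<alpha> (Q m) z) (pderivs \<alpha> \<psi> z) < e"
        using eventually_ge_at_top[of N]
      proof (eventually_elim, intro ballI)
        fix m and z :: "real^'n" assume m: "inverse (real (Suc m)) < e" "N \<le> m" and z: "z \<in> cball 0 \<rho>"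
        have "norm (pderivs \<alpha> (Q m) z - pderivs \<alpha> \<psi> z) < inverse (real (Suc m))" using Q A(1) m(2) z by auto
        then show "dist (pderivs \<alpha> (Q m) z) (pderivs \<alpha> \<psi> z) < e" using m(1) by (simp add: dist_norm)
      qed
    qed
  qed
qed

section \<open>Compactly supported distributions\<close>

lemma Ck_limit_shift:
  "Ck_limit N ((\<lambda>y. y - a) ` K) f g F \<Longrightarrow> Ck_limit N K (\<lambda>m y. f m (y - a)) (\<lambda>y. g (y - a)) F"
  unfolding Ck_limit_def pderivs_shift by (auto simp: uniform_limit_iff)

text \<open>In the variable inverted about \<open>x0\<close> a test function that vanishes near \<open>x0\<close> becomes a test function
  again. The polynomials that approximate it with all derivatives pull back to linear combinations
  of the functions \<open>kern 0 \<beta>\<close>, on which \<open>u\<close> vanishes.\<close>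

lemma distribution_zero_if_moments_zero:
  fixes u :: "(real^'n::finite \<Rightarrow> complex) \<Rightarrow> complex"
  assumes u: "distribution u" and \<eta>: "cutoff_for (dist_support u) \<eta>"
    and r: "r > 0" "fun_support \<eta> \<inter> cball x0 r = {}"
    and zero: "\<And>\<beta>. u (\<lambda>y. \<eta> y * kern 0 \<beta> (y - x0)) = 0"
    and \<phi>: "test_function \<phi>"
  shows "u \<phi> = 0"
proof -
  let ?b = "1 - real CARD('n)"
  have t\<eta>: "test_function \<eta>" by (rule cutoff_forD(1)[OF \<eta>])
  have t\<eta>\<phi>: "test_function (\<lambda>y. \<eta> y * \<phi> y)"
    by (rule test_function_mult[OF t\<eta> open_UNIV subset_UNIV test_function_smooth_on[OF \<phi> open_UNIV]])
  \<comment> \<open>The part of \<open>\<phi>\<close> that \<open>u\<close> sees, moved so that \<open>x0\<close> becomes the origin.\<close>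
  define \<theta> where "\<theta> w = \<eta> (w - (- x0)) * \<phi> (w - (- x0))" for w
  have s\<theta>: "smooth_on UNIV \<theta>"
    unfolding \<theta>_def using smooth_on_shift[OF test_function_smooth_on[OF t\<eta>\<phi> open_UNIV], of "- x0"]
    by (simp add: surj_plus)
  have \<eta>0: "\<eta> y = 0" if "norm (y - x0) \<le> r" for y
  proof -
    have "y \<in> cball x0 r" using that by (simp add: dist_norm norm_minus_commute)
    then have "y \<notin> fun_support \<eta>" using r(2) by blast
    then show ?thesis by (rule fun_support_zero)
  qed
  have \<theta>r: "\<theta> w = 0" if "norm w \<le> r" for w using \<eta>0[of "w + x0"] that by (simp add: \<theta>_def)
  obtain R0 where R0: "\<forall>y\<in>fun_support \<eta>. norm y \<le> R0"
    using compact_imp_bounded[OF test_function_compact[OF t\<eta>]] unfolding bounded_iff by (rule exE)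
  define R where "R = max r (R0 + norm x0)"
  have R: "R > 0" using r(1) by (simp add: R_def)
  have \<theta>R: "\<theta> w = 0" if "norm w > R" for w
  proof -
    have "norm (w + x0) > R0" using that norm_triangle_ineq4[of "w + x0" x0] by (simp add: R_def)
    then have "w + x0 \<notin> fun_support \<eta>" using R0 by force
    then show ?thesis by (simp add: \<theta>_def fun_support_zero)
  qed
  \<comment> \<open>The transplant of \<open>\<theta>\<close>: it vanishes for \<open>norm z > inverse r\<close> as \<open>\<theta>\<close> vanishes near the origin, and it vanishes near the origin as \<open>\<theta>\<close> has bounded support. The power of the norm cancels the one in \<open>kern\<close>.\<close>
  define \<psi> where "\<psi> z = complex_of_real (norm z powr ?b) * \<theta> (sphere_inv z)" for z
  have s\<psi>: "smooth_on (- {0}) \<psi>"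
    unfolding \<psi>_def
    by (rule smooth_on_mult[OF _ smooth_on_norm_powr smooth_on_compose[OF _ smooth_on_sphere_inv s\<theta> subset_UNIV]]) auto
  have \<psi>0: "\<psi> z = 0" if "norm z < inverse R" for z
  proof (cases "z = 0")
    case False
    then have "R < norm (sphere_inv z)" unfolding norm_sphere_inv using that R
      by (metis inverse_inverse_eq less_imp_inverse_less zero_less_norm_iff)
    then show ?thesis by (simp add: \<psi>_def \<theta>R)
  qed (simp add: \<psi>_def)
  have \<psi>1: "\<psi> z = 0" if "norm z > inverse r" for z
  proof -
    have "norm (sphere_inv z) \<le> r" unfolding norm_sphere_inv using that r(1)
      by (metis inverse_inverse_eq less_imp_inverse_less less_imp_le positive_imp_inverse_positive)
    then show ?thesis by (simp add: \<psi>_def \<theta>r)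
  qed
  have t\<psi>: "test_function \<psi>"
  proof (rule test_functionI[where K = "cball 0 (inverse r)"])
    have "smooth_on (ball 0 (inverse R)) \<psi>"
      by (rule smooth_on_cong[where \<psi> = "\<lambda>z. 0"]) (auto simp: \<psi>0 smooth_on_const)
    from smooth_on_Un[OF s\<psi> this] show "smooth \<psi>" unfolding smooth_iff_smooth_on
      by (rule smooth_on_subset) (use R in auto)
  qed (use \<psi>1 in auto)
  obtain Q where Q: "\<And>m::nat. Q m \<in> algebra_gen coords" "\<And>N. Ck_limit N (cball 0 (inverse r)) Q \<psi> sequentially"
    using polynomial_sequence[OF t\<psi>, of "inverse r"] by blast
  define h where "h m w = complex_of_real (norm w powr ?b) * Q m (sphere_inv w)" for m w
  define g where "g w = complex_of_real (norm w powr ?b) * \<psi> (sphere_inv w)" for w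
  have g\<theta>: "g w = \<theta> w" for w
  proof (cases "w = 0")
    case True
    then show ?thesis using \<theta>r[of 0] r(1) by (simp add: g_def)
  next
    case False
    have "norm w powr ?b * inverse (norm w) powr ?b = 1"
      using False by (simp add: powr_mult[symmetric])
    then have "complex_of_real (norm w powr ?b) * of_real (inverse (norm w) powr ?b) = 1"
      by (simp only: of_real_mult[symmetric] of_real_1)
    then show ?thesis by (simp add: g_def \<psi>_def norm_sphere_inv sphere_inv_involution mult.assoc[symmetric])
  qed
  define K where "K = (\<lambda>y. y - x0) ` fun_support \<eta>"
  have K: "compact K" unfolding K_def
    by (rule compact_continuous_image[OF _ test_function_compact[OF t\<eta>]]) (intro continuous_intros)
  have Kr: "norm w > r" if "w \<in> K" for w
  proof -
    obtain y where "w = y - x0" "y \<in> fun_support \<eta>" using \<open>w \<in> K\<close> unfolding K_def by blast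
    then show ?thesis using r(2) by (force simp: dist_norm norm_minus_commute)
  qed
  have K0: "K \<subseteq> - {0}" using Kr r(1) by force
  have sQ: "smooth_on UNIV (Q m)" for m by (rule smooth_on_polynomial[OF Q(1) open_UNIV])
  have o: "open (- {0::real^'n})" by auto
  have sh: "smooth_on (- {0}) (h m)" for m unfolding h_def
    by (rule smooth_on_mult[OF o smooth_on_norm_powr smooth_on_compose[OF o smooth_on_sphere_inv sQ subset_UNIV]])
  have sg: "smooth_on (- {0}) g" unfolding g_def
    by (rule smooth_on_mult[OF o smooth_on_norm_powr smooth_on_compose[OF o smooth_on_sphere_inv test_function_smooth_on[OF t\<psi> open_UNIV] subset_UNIV]])
  have lim: "Ck_limit N K h g sequentially" for N
  proof -
    have "sphere_inv ` K \<subseteq> cball 0 (inverse r)"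
      using Kr r(1) by (auto simp: norm_sphere_inv less_imp_le intro!: le_imp_inverse_le)
    then have lc: "Ck_limit N K (\<lambda>m w. Q m (sphere_inv w)) (\<lambda>w. \<psi> (sphere_inv w)) sequentially"
      by (rule Ck_limit_compose[OF o K0 K smooth_on_sphere_inv subset_UNIV _ sQ test_function_smooth_on[OF t\<psi> open_UNIV] Q(2)])
    have sQi: "smooth_on (- {0}) (\<lambda>w. Q m (sphere_inv w))" for m
      by (rule smooth_on_compose[OF o smooth_on_sphere_inv sQ subset_UNIV])
    have s\<psi>i: "smooth_on (- {0}) (\<lambda>w. \<psi> (sphere_inv w))"
      by (rule smooth_on_compose[OF o smooth_on_sphere_inv test_function_smooth_on[OF t\<psi> open_UNIV] subset_UNIV])
    show ?thesis unfolding h_def g_def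
      by (rule Ck_limit_mult[OF o K0 K smooth_on_norm_powr sQi smooth_on_norm_powr s\<psi>i Ck_limit_const lc])
  qed
  have S: "open (- cball x0 r)" "fun_support \<eta> \<subseteq> - cball x0 r" using r(2) by auto
  have x0: "x0 \<in> cball x0 r" using r(1) by simp
  have sh': "smooth_on (- cball x0 r) (\<lambda>y. h m (y - x0))" for m by (rule smooth_on_translate[OF sh x0])
  have sg': "smooth_on (- cball x0 r) (\<lambda>y. g (y - x0))" by (rule smooth_on_translate[OF sg x0])
  have lim': "(\<lambda>m. u (\<lambda>y. \<eta> y * h m (y - x0))) \<longlonglongrightarrow> u (\<lambda>y. \<eta> y * g (y - x0))"
  proof (rule distribution_tendsto[OF u test_function_compact[OF t\<eta>]])
    show "test_function (\<lambda>y. \<eta> y * h m (y - x0))" "test_function (\<lambda>y. \<eta> y * g (y - x0))" for m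
      by (rule test_function_mult[OF t\<eta> S sh'], rule test_function_mult[OF t\<eta> S sg'])
    show "fun_support (\<lambda>y. \<eta> y * h m (y - x0)) \<subseteq> fun_support \<eta>" "fun_support (\<lambda>y. \<eta> y * g (y - x0)) \<subseteq> fun_support \<eta>" for m
      by (rule fun_support_subset[OF closed_fun_support]; simp add: fun_support_zero)+
    show "Ck_limit N (fun_support \<eta>) (\<lambda>m y. \<eta> y * h m (y - x0)) (\<lambda>y. \<eta> y * g (y - x0)) sequentially" for N
      by (intro Ck_limit_mult[OF S test_function_compact[OF t\<eta>]] sh' sg' Ck_limit_const test_function_smooth_on[OF t\<eta>] S
          Ck_limit_shift lim[unfolded K_def])
  qed
  have tk: "test_function (\<lambda>y. \<eta> y * kern 0 \<beta> (y - x0))" for \<beta>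
    by (rule test_function_mult[OF t\<eta> S smooth_on_translate[OF smooth_on_kern x0]])
  have "u (\<lambda>y. \<eta> y * h m (y - x0)) = 0" for m
  proof -
    obtain L where L: "\<forall>z. Q m z = (\<Sum>(c, \<beta>)\<leftarrow>L. c * of_real (monom_fun \<beta> z))"
      using algebra_gen_coords_monom[OF Q(1)] by (rule exE)
    have "test_function (\<lambda>y. \<Sum>(c, \<beta>)\<leftarrow>L. c * (\<eta> y * kern 0 \<beta> (y - x0)))
       \<and> u (\<lambda>y. \<Sum>(c, \<beta>)\<leftarrow>L. c * (\<eta> y * kern 0 \<beta> (y - x0))) = 0" for L
    proof (induction L)
      case Nil
      then show ?case by (simp add: test_function_zero distribution_zero[OF u])
    next
      case (Cons a L)
      obtain c \<beta> where a: "a = (c, \<beta>)" by (cases a)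
      let ?f = "\<lambda>y. \<Sum>(c, \<beta>)\<leftarrow>L. c * (\<eta> y * kern 0 \<beta> (y - x0))"
      have "(\<lambda>y. \<Sum>(c, \<beta>)\<leftarrow>a # L. c * (\<eta> y * kern 0 \<beta> (y - x0)))
        = (\<lambda>y. c * (\<eta> y * kern 0 \<beta> (y - x0)) + 1 * ?f y)" by (simp add: a)
      moreover have "test_function (\<lambda>y. c * (\<eta> y * kern 0 \<beta> (y - x0)) + 1 * ?f y)"
        by (rule test_function_lin[OF tk]) (use Cons in simp)
      moreover have "u (\<lambda>y. c * (\<eta> y * kern 0 \<beta> (y - x0)) + 1 * ?f y)
         = c * u (\<lambda>y. \<eta> y * kern 0 \<beta> (y - x0)) + 1 * u ?f"
        by (rule distribution_lin[OF u tk]) (use Cons in simp)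
      ultimately show ?case using Cons zero by simp
    qed
    moreover have "\<eta> y * h m (y - x0) = (\<Sum>(c, \<beta>)\<leftarrow>L. c * (\<eta> y * kern 0 \<beta> (y - x0)))" for y
    proof -
      have "\<eta> y * (complex_of_real (norm (y - x0) powr ?b) * (\<Sum>(c, \<beta>)\<leftarrow>L. c * of_real (monom_fun \<beta> (sphere_inv (y - x0)))))
        = (\<Sum>(c, \<beta>)\<leftarrow>L. c * (\<eta> y * kern 0 \<beta> (y - x0)))"
        by (induction L) (auto simp: kern_0_eq algebra_simps)
      then show ?thesis using L by (simp add: h_def)
    qed
    ultimately show ?thesis by simp
  qed
  then have "(\<lambda>m::nat. 0) \<longlonglongrightarrow> u (\<lambda>y. \<eta> y * g (y - x0))" using lim' by simp
  then have "u (\<lambda>y. \<eta> y * g (y - x0)) = 0" by (rule LIMSEQ_unique[OF _ tendsto_const])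
  moreover have "(\<lambda>y. \<eta> y * g (y - x0)) = (\<lambda>y. \<eta> y * (\<eta> y * \<phi> y))"
    by (simp add: g\<theta> \<theta>_def)
  \<comment> \<open>One factor \<open>\<eta>\<close> comes from the pairing with translates, the other from \<open>\<theta>\<close>.\<close>
  moreover have "u (\<lambda>y. \<eta> y * (\<eta> y * \<phi> y)) = u \<phi>"
  proof -
    obtain V where V: "open V" "dist_support u \<subseteq> V" "\<forall>x\<in>V. \<eta> x = 1" using \<eta> unfolding cutoff_for_def by blast
    show ?thesis
      by (rule distribution_eq_near_support[OF u test_function_mult[OF t\<eta> open_UNIV subset_UNIV test_function_smooth_on[OF t\<eta>\<phi> open_UNIV]] \<phi> V(1,2)])
         (use V(3) in auto)
  qed
  ultimately show ?thesis by simp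
qed

text \<open>Bounded cutoff functions for \<open>C\<close> with supports shrinking to \<open>C\<close> converge pointwise to the indicator
  function of \<open>C\<close>.\<close>

lemma compact_integral_zero:
  fixes g :: "real^'n::finite \<Rightarrow> complex"
  assumes B: "open B" and C: "compact C" "C \<subseteq> B"
    and int: "\<And>C. compact C \<Longrightarrow> C \<subseteq> B \<Longrightarrow> set_integrable lebesgue C g"
    and zero: "\<And>\<phi>. test_function \<phi> \<Longrightarrow> fun_support \<phi> \<subseteq> B \<Longrightarrow> (LINT x|lebesgue. g x * \<phi> x) = 0"
  shows "(LINT x:C|lebesgue. g x) = 0"
proof -
  have "\<exists>\<zeta>0. cutoff_for C \<zeta>0 \<and> fun_support \<zeta>0 \<subseteq> B"
    by (rule cutoff_exists[OF C(1) B C(2)]) (rule exI conjI | assumption)+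
  then obtain \<zeta>0 where c0: "cutoff_for C \<zeta>0" "fun_support \<zeta>0 \<subseteq> B" by (elim exE conjE)
  define K where "K = fun_support \<zeta>0"
  have K: "compact K" "K \<subseteq> B" using test_function_compact[OF cutoff_forD(1)[OF c0(1)]] c0(2) by (auto simp: K_def)
  obtain V where V: "open V" "C \<subseteq> V" "\<forall>x\<in>V. \<zeta>0 x = 1" using c0(1) unfolding cutoff_for_def by (elim exE conjE)
  have VK: "V \<subseteq> K" unfolding K_def using V(3) fun_support_zero[of _ \<zeta>0] by force
  define W where "W m = V \<inter> (\<Union>x\<in>C. ball x (inverse (real (Suc m))))" for m
  have W: "open (W m)" "C \<subseteq> W m" for m using V by (auto simp: W_def)
  have "\<exists>\<zeta>. cutoff_for C \<zeta> \<and> fun_support \<zeta> \<subseteq> W m \<and> (\<forall>x. norm (\<zeta> x) \<le> 1)" for m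
    by (rule cutoff_exists[OF C(1) W]) (rule exI conjI allI | assumption)+
  then have "\<forall>m. \<exists>\<zeta>. cutoff_for C \<zeta> \<and> fun_support \<zeta> \<subseteq> W m \<and> (\<forall>x. norm (\<zeta> x) \<le> 1)" by (rule allI)
  then obtain c where c: "\<forall>m. cutoff_for C (c m) \<and> fun_support (c m) \<subseteq> W m \<and> (\<forall>x. norm (c m x) \<le> 1)"
    by (rule choice[THEN exE])
  have ct: "test_function (c m)" for m using c cutoff_forD(1) by blast
  have gK: "integrable lebesgue (\<lambda>x. indicator K x *\<^sub>R g x)" using int[OF K] by (simp add: set_integrable_def)
  have cK: "c m x = 0" if "x \<notin> K" for m x
  proof -
    have "x \<notin> fun_support (c m)" using c VK that unfolding W_def by blast
    then show ?thesis by (rule fun_support_zero)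
  qed
  have "(\<lambda>m. LINT x|lebesgue. g x * c m x) \<longlonglongrightarrow> (LINT x|lebesgue. indicator C x *\<^sub>R g x)"
  proof (rule integral_dominated_convergence[where w = "\<lambda>x. norm (indicator K x *\<^sub>R g x)"])
    have e: "g x * c m x = (indicator K x *\<^sub>R g x) * c m x" for m x using cK[of x m] by (auto simp: indicator_def)
    show "(\<lambda>x. indicator C x *\<^sub>R g x) \<in> borel_measurable lebesgue"
      using int[OF C] by (auto simp: set_integrable_def)
    show "(\<lambda>x. g x * c m x) \<in> borel_measurable lebesgue" for m
      unfolding e by (rule borel_measurable_times[OF borel_measurable_integrable[OF gK] borel_measurable_lebesgueI[OF test_function_borel[OF ct]]])
    show "integrable lebesgue (\<lambda>x. norm (indicator K x *\<^sub>R g x))" by (rule integrable_norm[OF gK])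
    show "AE x in lebesgue. norm (g x * c m x) \<le> norm (indicator K x *\<^sub>R g x)" for m
    proof (rule AE_I2)
      fix x
      have "norm (c m x) \<le> 1" using c by blast
      from mult_left_mono[OF this norm_ge_zero[of "indicator K x *\<^sub>R g x"]]
      show "norm (g x * c m x) \<le> norm (indicator K x *\<^sub>R g x)" unfolding e norm_mult by simp
    qed
    show "AE x in lebesgue. (\<lambda>m. g x * c m x) \<longlonglongrightarrow> indicator C x *\<^sub>R g x"
    proof (rule AE_I2)
      fix x
      show "(\<lambda>m. g x * c m x) \<longlonglongrightarrow> indicator C x *\<^sub>R g x"
      proof (cases "x \<in> C")
        case True
        then have "c m x = 1" for m using c cutoff_forD(2) by blast
        then show ?thesis using True by simp
      next
        case False
        have "open (- C)" using compact_imp_closed[OF C(1)] by (rule open_Compl)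
        from bspec[OF open_contains_ball[THEN iffD1, OF this], of x] False
        obtain e where e: "e > 0" "ball x e \<subseteq> - C" by auto
        have "\<forall>\<^sub>F m in sequentially. inverse (real (Suc m)) < e"
          using LIMSEQ_inverse_real_of_nat e(1) by (rule order_tendstoD)
        then have "\<forall>\<^sub>F m in sequentially. g x * c m x = 0"
        proof eventually_elim
          case (elim m)
          have "x \<notin> W m"
          proof
            assume "x \<in> W m"
            then obtain z where "z \<in> C" "dist z x < inverse (real (Suc m))" unfolding W_def by auto
            then have "z \<in> ball x e" "z \<in> C" using elim by (simp_all add: dist_commute)
            then show False using e(2) by blast
          qed
          then have "x \<notin> fun_support (c m)" using c by blast
          then show ?case by (simp add: fun_support_zero)
        qed
        then show ?thesis using False by (simp add: tendsto_eventually)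
      qed
    qed
  qed
  moreover have "(LINT x|lebesgue. g x * c m x) = 0" for m
  proof (rule zero[OF ct])
    show "fun_support (c m) \<subseteq> B" using c VK K(2) unfolding W_def by blast
  qed
  ultimately have "(\<lambda>m::nat. 0) \<longlonglongrightarrow> (LINT x|lebesgue. indicator C x *\<^sub>R g x)" by simp
  then have "(LINT x|lebesgue. indicator C x *\<^sub>R g x) = 0" by (rule LIMSEQ_unique[OF _ tendsto_const])
  then show ?thesis by (simp add: set_lebesgue_integral_def)
qed

text \<open>Countably many such balls cover \<open>U\<close>. The doubled radius leaves room: the ball of radius \<open>r\<close> around
  each point of the small ball still lies in \<open>U\<close>.\<close>

lemma positive_measure_in_ball:
  fixes U E :: "(real^'n::finite) set"
  assumes U: "open U" and E: "E \<subseteq> U" "E \<in> sets lebesgue" "emeasure lebesgue E > 0"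
  shows "\<exists>x r. r > 0 \<and> cball x (2 * r) \<subseteq> U \<and> emeasure lebesgue (E \<inter> ball x r) > 0"
proof (rule ccontr)
  assume "\<nexists>x r. r > 0 \<and> cball x (2 * r) \<subseteq> U \<and> emeasure lebesgue (E \<inter> ball x r) > 0"
  then have "\<not> emeasure lebesgue (E \<inter> ball x r) > 0" if "r > 0" "cball x (2 * r) \<subseteq> U" for x r
    using that by blast
  then have null: "emeasure lebesgue (E \<inter> ball x r) = 0" if "r > 0" "cball x (2 * r) \<subseteq> U" for x r
    using that by simp
  define F where "F = {ball x r | x r. r > 0 \<and> cball x (2 * r) \<subseteq> U}"
  obtain F' where F': "F' \<subseteq> F" "countable F'" "\<Union>F' = \<Union>F"
    by (rule Lindelof[of F]) (auto simp: F_def)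
  have "U \<subseteq> \<Union>F"
  proof
    fix x assume "x \<in> U"
    then obtain e where e: "e > 0" "cball x e \<subseteq> U" using U open_contains_cball by blast
    then have "ball x (e / 2) \<in> F" unfolding F_def by (intro CollectI exI[of _ x] exI[of _ "e / 2"]) simp
    then show "x \<in> \<Union>F" using e(1) by (intro UnionI[of "ball x (e / 2)"]) auto
  qed
  then have "E \<subseteq> \<Union>F'" using E(1) F'(3) by simp
  then have "E = (\<Union>S\<in>F'. E \<inter> S)" unfolding Int_Union[symmetric] by (rule Int_absorb2[symmetric])
  moreover have "(\<Union>S\<in>F'. E \<inter> S) \<in> null_sets lebesgue"
  proof (rule null_sets_UN'[OF F'(2)])
    fix S assume "S \<in> F'"
    then obtain x r where "S = ball x r" "r > 0" "cball x (2 * r) \<subseteq> U" using F'(1) unfolding F_def by blast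
    then show "E \<inter> S \<in> null_sets lebesgue" using null E(2) by (intro null_setsI) auto
  qed
  ultimately show False using E(3) by (metis less_irrefl null_setsD1)
qed

lemma AE_ex_in_positive_measure:
  assumes "AE x in M. x \<in> A \<longrightarrow> P x" "A \<in> sets M" "emeasure M A > 0"
  shows "\<exists>x\<in>A. P x"
proof (rule ccontr)
  assume "\<not> (\<exists>x\<in>A. P x)"
  then have "AE x in M. x \<notin> A" using assms(1) by (auto elim!: eventually_mono)
  then have "A \<in> null_sets M" using AE_iff_null_sets[OF assms(2)] by simp
  then show False using assms(3) by auto
qed

lemma kern_borel: "kern j \<beta> \<in> borel_measurable borel" for \<beta> :: "'n::finite list"
proof -
  have "continuous_on (- {0}) (kern j \<beta> :: real^'n \<Rightarrow> complex)" by (rule smooth_on_continuous[OF smooth_on_kern])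
  then have "(\<lambda>w. indicator (- {0}) w *\<^sub>R kern j \<beta> w) \<in> borel_measurable borel"
    by (intro borel_measurable_continuous_on_indicator) auto
  moreover have "(\<lambda>w. indicator (- {0}) w *\<^sub>R kern j \<beta> w) = kern j \<beta>"
    by (auto simp: indicator_def kern_def)
  ultimately show ?thesis by simp
qed

lemma ray_kernel_locally_integrable:
  assumes "CARD('n::finite) \<ge> 2"
  shows "set_integrable lebesgue (cball 0 R) (ray_kernel :: real^'n \<Rightarrow> complex)"
proof -
  have "set_integrable lebesgue (cball 0 (max R 1)) (\<lambda>x::real^'n. norm x powr (1 - real CARD('n)))"
    by (rule norm_powr_integrable_cball) (use assms in auto)
  then have "set_integrable lebesgue (cball 0 R) (\<lambda>x::real^'n. norm x powr (1 - real CARD('n)))"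
    by (rule set_integrable_subset) auto
  then show ?thesis
    unfolding set_integrable_def ray_kernel_def
    using integrable_of_real[where 'a = complex] by (fastforce simp: scaleR_conv_of_real)
qed

text \<open>The cutoff function \<open>\<eta>\<close> that localises \<open>u\<close> near its support is chosen to vanish near the ball \<open>B\<close>, so
  that \<open>G j \<beta> x\<close> is defined and smooth for \<open>x\<close> in \<open>B\<close>. On \<open>B\<close> the distribution \<open>normal_op_dist u\<close> is the
  function \<open>2 * G 0 []\<close>.\<close>

lemma compactly_supported_distribution_unique_continuation:
  fixes u :: "(real^'n::finite \<Rightarrow> complex) \<Rightarrow> complex"
  assumes n: "CARD('n) \<ge> 2" and U: "open U" and E: "E \<subseteq> U" "E \<in> sets lebesgue" "emeasure lebesgue E > 0"
    and u: "compactly_supported_distribution u" and uU: "dist_zero_on u U"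
    and NE: "dist_ae_zero_on (normal_op_dist u) E"
  shows "dist_zero_on u UNIV"
proof -
  have du: "distribution u" and K: "compact (dist_support u)"
    using u by (auto simp: compactly_supported_distribution_def)
  have KU: "dist_support u \<inter> U = {}" using U uU unfolding dist_support_def by blast
  obtain x1 r where r: "r > 0" "cball x1 (2 * r) \<subseteq> U" "emeasure lebesgue (E \<inter> ball x1 r) > 0"
    using positive_measure_in_ball[OF U E] by (elim exE conjE)
  define B where "B = ball x1 r"
  define Y where "Y = cball x1 r"
  have Y: "compact Y" "B \<subseteq> Y" by (auto simp: Y_def B_def)
  have "\<exists>\<eta>. cutoff_for (dist_support u) \<eta> \<and> fun_support \<eta> \<subseteq> - cball x1 (2 * r)"
  proof (rule cutoff_exists[OF K])
    show "open (- cball x1 (2 * r))" by auto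
    show "dist_support u \<subseteq> - cball x1 (2 * r)" using KU r(2) by blast
  qed (rule exI conjI | assumption)+
  then obtain \<eta> where \<eta>: "cutoff_for (dist_support u) \<eta>" "fun_support \<eta> \<subseteq> - cball x1 (2 * r)" by (elim exE conjE)
  have t\<eta>: "test_function \<eta>" by (rule cutoff_forD(1)[OF \<eta>(1)])
  have "Y \<subseteq> cball x1 (2 * r)" using r(1) unfolding Y_def by (intro subset_cball) simp
  then have \<eta>Y: "fun_support \<eta> \<inter> Y = {}" using \<eta>(2) by blast
  have S: "open (- Y)" "fun_support \<eta> \<subseteq> - Y" using \<eta>Y by (auto simp: Y_def)
  define G where "G j \<beta> x = u (\<lambda>y. \<eta> y * kern j \<beta> (y - x))" for j \<beta> x
  have tk: "test_function (\<lambda>y. \<eta> y * kern j \<beta> (y - x))" if "x \<in> Y" for j \<beta> x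
    by (rule test_function_mult[OF t\<eta> S smooth_on_translate[OF smooth_on_kern that]])
  have Gc: "continuous_on Y (G j \<beta>)" for j \<beta>
    unfolding G_def by (rule continuous_on_translate_pairing[OF du t\<eta> smooth_on_kern Y(1) \<eta>Y])
  have nz: "y - x \<noteq> 0" if "y \<in> fun_support \<eta>" "x \<in> Y" for x y using that \<eta>Y by auto
  have lin: "test_function (\<lambda>y. \<Sum>\<gamma>\<leftarrow>L. \<eta> y * kern j \<gamma> (y - x)) \<and>
      u (\<lambda>y. \<Sum>\<gamma>\<leftarrow>L. \<eta> y * kern j \<gamma> (y - x)) = (\<Sum>\<gamma>\<leftarrow>L. G j \<gamma> x)" if x: "x \<in> Y" for L j x
  proof (induction L)
    case Nil
    then show ?case by (simp add: test_function_zero distribution_zero[OF du])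
  next
    case (Cons \<gamma> L)
    have t: "test_function (\<lambda>y. \<Sum>\<gamma>\<leftarrow>L. \<eta> y * kern j \<gamma> (y - x))" using Cons by (rule conjunct1)
    show ?case
      using test_function_lin[OF tk[OF x, of j \<gamma>] t, of 1 1] distribution_lin[OF du tk[OF x, of j \<gamma>] t, of 1 1] Cons
      by (simp add: G_def)
  qed
  have Gd: "((\<lambda>t. G j \<beta> (x + t *\<^sub>R axis i 1)) has_vector_derivative
       - ((\<Sum>\<gamma>\<leftarrow>del_one i \<beta>. G (Suc j) \<gamma> x) + of_real (kern_exp TYPE('n) j (length \<beta>)) * G j (i # \<beta>) x)) (at 0)"
    if x: "x \<in> B" for j \<beta> i x
  proof -
    let ?a = "complex_of_real (kern_exp TYPE('n) j (length \<beta>))"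
    have xY: "x \<in> Y" using x Y by blast
    have "\<exists>s>0. cball x s \<subseteq> B"
      using bspec[OF open_contains_cball[THEN iffD1] x] by (simp add: B_def)
    then obtain s where s: "s > 0" "cball x s \<subseteq> B" by (elim exE conjE)
    then have sY: "cball x s \<subseteq> Y" using Y by blast
    let ?f = "\<lambda>y. \<Sum>\<gamma>\<leftarrow>del_one i \<beta>. \<eta> y * kern (Suc j) \<gamma> (y - x)"
    have "(\<lambda>y. \<eta> y * pderiv_coord i (kern j \<beta>) (y - x)) = (\<lambda>y. 1 * ?f y + ?a * (\<eta> y * kern j (i # \<beta>) (y - x)))"
    proof
      fix y
      show "\<eta> y * pderiv_coord i (kern j \<beta>) (y - x) = 1 * ?f y + ?a * (\<eta> y * kern j (i # \<beta>) (y - x))"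
      proof (cases "y \<in> fun_support \<eta>")
        case True
        show ?thesis unfolding pderiv_coord_kern[OF nz[OF True xY]]
          by (simp add: sum_list_const_mult distrib_left mult_ac)
      qed (simp add: fun_support_zero sum_list_const_mult)
    qed
    then have "u (\<lambda>y. \<eta> y * pderiv_coord i (kern j \<beta>) (y - x)) = u (\<lambda>y. 1 * ?f y + ?a * (\<eta> y * kern j (i # \<beta>) (y - x)))"
      by (simp only:)
    also have "\<dots> = (\<Sum>\<gamma>\<leftarrow>del_one i \<beta>. G (Suc j) \<gamma> x) + ?a * G j (i # \<beta>) x"
      using distribution_lin[OF du conjunct1[OF lin[OF xY]] tk[OF xY, of j "i # \<beta>"], of 1 "Suc j" "del_one i \<beta>" ?a]
        conjunct2[OF lin[OF xY, of "Suc j" "del_one i \<beta>"]] by (simp add: G_def)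
    finally show ?thesis
      using translate_pairing_has_derivative[OF du t\<eta> smooth_on_kern Y(1) \<eta>Y s(1) sY, of j \<beta> i] by (simp add: G_def)
  qed
  have Gs: "(\<Sum>i\<in>UNIV. G j [i, i] x) = G (Suc j) [] x" if x: "x \<in> B" for j x
  proof -
    have xY: "x \<in> Y" using x Y by blast
    have "(\<lambda>y. \<Sum>i\<in>UNIV. 1 * (\<eta> y * kern j [i, i] (y - x))) = (\<lambda>y. \<eta> y * kern (Suc j) [] (y - x))"
      unfolding sum_kern_diagonal[symmetric] by (simp add: sum_distrib_left)
    moreover have "u (\<lambda>y. \<Sum>i\<in>(UNIV::'n set). 1 * (\<eta> y * kern j [i, i] (y - x)))
       = (\<Sum>i\<in>UNIV. 1 * u (\<lambda>y. \<eta> y * kern j [i, i] (y - x)))"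
      by (rule distribution_sum(2)[OF du finite tk[OF xY]])
    ultimately show ?thesis by (simp add: G_def)
  qed
  obtain h where h: "locally_integrable h" "\<And>\<phi>. test_function \<phi> \<Longrightarrow> normal_op_dist u \<phi> = dist_of_fun h \<phi>"
     "AE x in lebesgue. x \<in> E \<longrightarrow> h x = 0"
    using NE unfolding dist_ae_zero_on_def by blast
  define g where "g x = h x - 2 * G 0 [] x" for x
  have GI: "set_integrable lebesgue C (G 0 [])" if "compact C" "C \<subseteq> B" for C
  proof -
    have "integrable lborel (\<lambda>x. indicator C x *\<^sub>R G 0 [] x)"
      using that Y by (intro borel_integrable_compact continuous_on_subset[OF Gc]) auto
    then show ?thesis unfolding set_integrable_def
      by (subst integrable_completion) (auto dest: borel_measurable_integrable)
  qed
  have hI: "set_integrable lebesgue C h" if "compact C" for C using h(1) that by (simp add: locally_integrable_def)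
  have gI: "set_integrable lebesgue C g" if "compact C" "C \<subseteq> B" for C
    unfolding g_def by (intro set_integral_diff(1) hI set_integrable_mult_right GI that)
  have key: "(LINT x|lebesgue. g x * \<phi> x) = 0" if \<phi>: "test_function \<phi>" "fun_support \<phi> \<subseteq> B" for \<phi>
  proof -
    have ck: "smooth (convol \<phi> ray_kernel)"
      by (rule pderivs_convol(1)[OF \<phi>(1) _ ray_kernel_locally_integrable[OF n]]) (simp add: ray_kernel_eq_kern kern_borel)
    \<comment> \<open>The cutoff function in \<open>dist_extend\<close> may be replaced by \<open>\<eta>\<close>.\<close>
    define \<zeta>' where "\<zeta>' = (SOME \<eta>. cutoff_for (dist_support u) \<eta>)"
    have \<zeta>': "cutoff_for (dist_support u) \<zeta>'" unfolding \<zeta>'_def using \<eta>(1) by (rule someI[where P = "cutoff_for (dist_support u)"])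
    obtain V V' where V: "open V" "dist_support u \<subseteq> V" "\<forall>x\<in>V. \<eta> x = 1"
      and V': "open V'" "dist_support u \<subseteq> V'" "\<forall>x\<in>V'. \<zeta>' x = 1"
      using \<eta>(1) \<zeta>' unfolding cutoff_for_def by (elim exE conjE)
    have tc: "test_function (\<lambda>x. \<zeta> x * convol \<phi> ray_kernel x)" if "test_function \<zeta>" for \<zeta>
      by (rule test_function_mult[OF that open_UNIV subset_UNIV ck[unfolded smooth_iff_smooth_on]])
    have "dist_extend u (convol \<phi> ray_kernel) = u (\<lambda>x. \<eta> x * convol \<phi> ray_kernel x)"
      unfolding dist_extend_def \<zeta>'_def[symmetric]
    proof (rule distribution_eq_near_support[OF du tc[OF cutoff_forD(1)[OF \<zeta>']] tc[OF t\<eta>]])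
      show "open (V \<inter> V')" "dist_support u \<subseteq> V \<inter> V'" using V V' by auto
    qed (use V V' in auto)
    also have "\<dots> = (LINT s|lebesgue. \<phi> s * G 0 [] s)"
    proof -
      \<comment> \<open>The translation vectors have to stay in \<open>Y\<close>; where \<open>s\<close> leaves \<open>Y\<close>, the weight \<open>\<phi> s\<close> is zero and any point of \<open>Y\<close> will do.\<close>
      define X where "X s = (if s \<in> Y then s else x1)" for s
      have XY: "X s \<in> Y" for s using r(1) by (simp add: X_def Y_def)
      have Xm: "X \<in> lebesgue \<rightarrow>\<^sub>M borel"
      proof -
        have [measurable]: "Y \<in> sets borel" unfolding Y_def by simp
        have "X \<in> borel \<rightarrow>\<^sub>M borel" unfolding X_def by measurable
        then show ?thesis by (rule borel_measurable_lebesgueI)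
      qed
      have Xs: "X s = s" if "\<phi> s \<noteq> 0" for s
      proof -
        have "s \<in> fun_support \<phi>" using that fun_support_zero[of s \<phi>] by blast
        then show ?thesis using \<phi>(2) Y(2) by (auto simp: X_def)
      qed
      have "convol \<phi> ray_kernel y = (LINT s|lebesgue. \<phi> s * kern 0 [] (y - X s))" for y
        unfolding convol_def ray_kernel_eq_kern
      proof (intro Bochner_Integration.integral_cong refl)
        show "\<phi> s * kern 0 [] (y - s) = \<phi> s * kern 0 [] (y - X s)" for s by (cases "\<phi> s = 0") (simp_all add: Xs)
      qed
      then have "u (\<lambda>y. \<eta> y * convol \<phi> ray_kernel y) = u (\<lambda>y. \<eta> y * (LINT s|lebesgue. \<phi> s * kern 0 [] (y - X s)))" by (simp only:)
      also have "\<dots> = (LINT s|lebesgue. \<phi> s * G 0 [] (X s))"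
        unfolding G_def by (rule distribution_integral_translates[OF du t\<eta> smooth_on_kern Y(1) \<eta>Y test_function_integrable[OF \<phi>(1)] Xm XY])
      also have "\<dots> = (LINT s|lebesgue. \<phi> s * G 0 [] s)"
      proof (intro Bochner_Integration.integral_cong refl)
        show "\<phi> s * G 0 [] (X s) = \<phi> s * G 0 [] s" for s by (cases "\<phi> s = 0") (simp_all add: Xs)
      qed
      finally show ?thesis .
    qed
    finally have eq: "dist_of_fun h \<phi> = 2 * (LINT s|lebesgue. \<phi> s * G 0 [] s)"
      using h(2)[OF \<phi>(1)] by (simp add: normal_op_dist_def)
    have K\<phi>: "compact (fun_support \<phi>)" by (rule test_function_compact[OF \<phi>(1)])
    obtain b where b: "\<And>x. norm (\<phi> x) \<le> b" "b \<ge> 0" using test_function_bounded[OF \<phi>(1)] by blast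
    have pi: "integrable lebesgue (\<lambda>x. f x * \<phi> x)" if f: "set_integrable lebesgue (fun_support \<phi>) f" for f
    proof (rule Bochner_Integration.integrable_bound)
      have e: "f x * \<phi> x = (indicator (fun_support \<phi>) x *\<^sub>R f x) * \<phi> x" for x
        using fun_support_zero[of x \<phi>] by (auto simp: indicator_def)
      show "integrable lebesgue (\<lambda>x. norm (indicator (fun_support \<phi>) x *\<^sub>R f x) * b)"
        using integrable_norm[OF f[unfolded set_integrable_def]] by (rule integrable_mult_left)
      show "(\<lambda>x. f x * \<phi> x) \<in> borel_measurable lebesgue"
        unfolding e by (rule borel_measurable_times[OF borel_measurable_integrable[OF f[unfolded set_integrable_def]] borel_measurable_lebesgueI[OF test_function_borel[OF \<phi>(1)]]])
      show "AE x in lebesgue. norm (f x * \<phi> x) \<le> norm (norm (indicator (fun_support \<phi>) x *\<^sub>R f x) * b)"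
      proof (rule AE_I2)
        fix x
        show "norm (f x * \<phi> x) \<le> norm (norm (indicator (fun_support \<phi>) x *\<^sub>R f x) * b)"
          unfolding e norm_mult using mult_left_mono[OF b(1)[of x] norm_ge_zero[of "indicator (fun_support \<phi>) x *\<^sub>R f x"]] b(2) by simp
      qed
    qed
    have "(LINT x|lebesgue. g x * \<phi> x) = (LINT x|lebesgue. h x * \<phi> x - 2 * (G 0 [] x * \<phi> x))"
      by (simp add: g_def algebra_simps)
    also have "\<dots> = (LINT x|lebesgue. h x * \<phi> x) - (LINT x|lebesgue. 2 * (G 0 [] x * \<phi> x))"
      by (rule Bochner_Integration.integral_diff[OF pi[OF hI[OF K\<phi>]] integrable_mult_right[OF pi[OF GI[OF K\<phi> \<phi>(2)]]]])
    also have "(LINT x|lebesgue. 2 * (G 0 [] x * \<phi> x)) = 2 * (LINT x|lebesgue. \<phi> x * G 0 [] x)"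
      by (simp add: mult.commute)
    finally show ?thesis using eq by (simp add: dist_of_fun_def)
  qed
  have "AE x in lebesgue. x \<in> B \<longrightarrow> g x = 0"
  proof (rule AE_zero_if_compact_integrals_0)
    have "(\<lambda>x. indicator B x *\<^sub>R (indicator Y x *\<^sub>R h x - 2 * (indicator Y x *\<^sub>R G 0 [] x))) \<in> borel_measurable lebesgue"
    proof -
      have m1: "(\<lambda>x. indicator Y x *\<^sub>R h x) \<in> borel_measurable lebesgue"
        using hI[OF Y(1)] by (auto simp: set_integrable_def)
      have m2: "(\<lambda>x. indicator Y x *\<^sub>R G 0 [] x) \<in> borel_measurable lebesgue"
        by (intro borel_measurable_lebesgueI borel_measurable_continuous_on_indicator Gc borel_compact[OF Y(1)])
      have "B \<in> sets lebesgue" by (simp add: B_def)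
      then show ?thesis
        by (rule borel_measurable_scaleR[OF borel_measurable_indicator
              borel_measurable_diff[OF m1 borel_measurable_times[OF borel_measurable_const m2]]])
    qed
    moreover have "(\<lambda>x. indicator B x *\<^sub>R (indicator Y x *\<^sub>R h x - 2 * (indicator Y x *\<^sub>R G 0 [] x))) = (\<lambda>x. indicator B x *\<^sub>R g x)"
    proof
      fix x
      show "indicator B x *\<^sub>R (indicator Y x *\<^sub>R h x - 2 * (indicator Y x *\<^sub>R G 0 [] x)) = indicator B x *\<^sub>R g x"
        using subsetD[OF Y(2), of x] by (cases "x \<in> B") (simp_all add: g_def)
    qed
    ultimately show "(\<lambda>x. indicator B x *\<^sub>R g x) \<in> borel_measurable lebesgue" by simp
    show "B \<in> sets lebesgue" by (simp add: B_def)
    show "set_integrable lebesgue C g" if "compact C" "C \<subseteq> B" for C by (rule gI[OF that])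
    show "(LINT x:C|lebesgue. g x) = 0" if "compact C" "C \<subseteq> B" for C
      by (rule compact_integral_zero[OF _ that gI key]) (simp_all add: B_def)
  qed
  with h(3) have "AE x in lebesgue. x \<in> E \<inter> B \<longrightarrow> G 0 [] x = 0"
    by eventually_elim (auto simp: g_def)
  then have ae: "AE x in lebesgue. x \<in> E \<inter> B \<longrightarrow> (\<forall>j \<beta>. G j \<beta> x = 0)"
  proof (rule kern_functionals_vanish[where G = G and B = B and s = "- 1", OF n, rotated -1])
    show "(- 1 :: complex) \<noteq> 0" by simp
    show "open B" by (simp add: B_def)
    show "continuous_on B (G j \<beta>)" for j \<beta> by (rule continuous_on_subset[OF Gc Y(2)])
    show "((\<lambda>t. G j \<beta> (x + t *\<^sub>R axis i 1)) has_vector_derivative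
       - 1 * ((\<Sum>\<gamma>\<leftarrow>del_one i \<beta>. G (Suc j) \<gamma> x) + of_real (kern_exp TYPE('n) j (length \<beta>)) * G j (i # \<beta>) x)) (at 0)"
      if "x \<in> B" for j \<beta> i x
      using Gd[OF that, of j \<beta> i] by simp
    show "(\<Sum>i\<in>UNIV. G j [i, i] x) = G (Suc j) [] x" if "x \<in> B" for j x by (rule Gs[OF that])
  qed
  have "\<exists>x0\<in>E \<inter> B. \<forall>j \<beta>. G j \<beta> x0 = 0"
    by (rule AE_ex_in_positive_measure[OF ae]) (use E(2) r(3) in \<open>auto simp: B_def\<close>)
  then obtain x0 where x0: "x0 \<in> B" "\<And>\<beta>. G 0 \<beta> x0 = 0" by blast
  have "cball x0 r \<subseteq> cball x1 (2 * r)"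
  proof
    fix y assume "y \<in> cball x0 r"
    then show "y \<in> cball x1 (2 * r)" using x0(1) dist_triangle[of x1 y x0] by (simp add: B_def)
  qed
  then have "fun_support \<eta> \<inter> cball x0 r = {}" using \<eta>(2) by blast
  from distribution_zero_if_moments_zero[OF du \<eta>(1) r(1) this x0(2)[unfolded G_def]]
  show ?thesis by (simp add: dist_zero_on_def)
qed

section \<open>Functions in a Lebesgue space\<close>

lemma integrable_translate:
  fixes f :: "real^'n::finite \<Rightarrow> real"
  assumes f: "f \<in> borel_measurable borel" and i: "integrable lebesgue f"
  shows "integrable lebesgue (\<lambda>y. f (y - a))"
proof -
  note [measurable] = f
  have "integrable lborel f" using i f by (subst (asm) integrable_completion) simp_all
  then have "integrable (distr lborel borel ((+) (- a))) f" by (simp only: lborel_distr_plus)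
  then have "integrable lborel (\<lambda>y. f (- a + y))" by (subst (asm) integrable_distr_eq) simp_all
  then have "integrable lborel (\<lambda>y. f (y - a))" by (simp add: add.commute)
  then show ?thesis by (subst integrable_completion) simp_all
qed

text \<open>For \<open>p > 1\<close> this is Hoelder's inequality: with the conjugate exponent \<open>q = p / (p - 1)\<close> the power
  \<open>(1 - n) q\<close> of the norm is integrable at infinity if and only if \<open>(1 - n) q < - n\<close>, that is \<open>p < n\<close>. For
  \<open>p = 1\<close> the kernel is bounded where \<open>f\<close> is not zero.\<close>

lemma Lp_mult_kernel_integrable:
  fixes f :: "real^'n::finite \<Rightarrow> complex" and p :: real
  assumes n: "CARD('n) \<ge> 2" and p: "1 \<le> p" "p < real CARD('n)" and f: "in_Lp p f"
    and r: "r > 0" and f0: "\<And>y. norm (y - a) < r \<Longrightarrow> f y = 0"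
  shows "integrable lebesgue (\<lambda>y. norm (f y) * norm (y - a) powr (1 - real CARD('n)))"
proof -
  let ?b = "1 - real CARD('n)"
  have fm: "f \<in> borel_measurable lebesgue" and fi: "integrable lebesgue (\<lambda>y. norm (f y) powr p)"
    using f by (auto simp: in_Lp_def)
  have km: "(\<lambda>y::real^'n. norm (y - a) powr ?b) \<in> borel_measurable lebesgue"
    by (rule borel_measurable_lebesgueI) measurable
  have m: "(\<lambda>y. norm (f y) * norm (y - a) powr ?b) \<in> borel_measurable lebesgue"
    by (rule borel_measurable_times[OF measurable_compose[OF fm borel_measurable_norm] km])
  show ?thesis
  proof (cases "p = 1")
    case True
    have fi1: "integrable lebesgue (\<lambda>y. norm (f y) * r powr ?b)" using fi True by simp
    show ?thesis
    proof (rule Bochner_Integration.integrable_bound[OF fi1 m], rule AE_I2)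
      fix y
      show "norm (norm (f y) * norm (y - a) powr ?b) \<le> norm (norm (f y) * r powr ?b)"
      proof (cases "norm (y - a) < r")
        case False
        then have "norm (y - a) powr ?b \<le> r powr ?b" using n r by (intro powr_mono2') auto
        then show ?thesis by (simp add: mult_left_mono)
      qed (simp add: f0)
    qed
  next
    case False
    then have p1: "p > 1" using p by simp
    define q where "q = p / (p - 1)"
    have q: "q > 0" "(p - 1) * q = p" using p1 by (auto simp: q_def)
    have bq: "?b * q + real CARD('n) < 0"
    proof -
      have "(p - 1) * (?b * q + real CARD('n)) = ?b * ((p - 1) * q) + (p - 1) * real CARD('n)" by (simp add: algebra_simps)
      also have "\<dots> = p - real CARD('n)" unfolding q(2) by (simp add: algebra_simps)
      finally have "(p - 1) * (?b * q + real CARD('n)) < 0" using p by simp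
      then show ?thesis using p1 by (simp add: mult_less_0_iff)
    qed
    have "integrable lebesgue (\<lambda>w::real^'n. indicator {w. norm w \<ge> r} w * norm w powr (?b * q))"
      using norm_powr_integrable_outside[OF bq r] by (simp add: set_integrable_def)
    moreover have "(\<lambda>w::real^'n. indicator {w. norm w \<ge> r} w * norm w powr (?b * q)) \<in> borel_measurable borel"
      by measurable
    ultimately have "integrable lebesgue (\<lambda>y. indicator {w. norm w \<ge> r} (y - a) * norm (y - a) powr (?b * q))"
      by (intro integrable_translate)
    then have i: "integrable lebesgue (\<lambda>y. norm (f y) powr p + indicator {w. norm w \<ge> r} (y - a) * norm (y - a) powr (?b * q))"
      using fi by (rule Bochner_Integration.integrable_add[rotated])
    show ?thesis
    proof (rule Bochner_Integration.integrable_bound[OF i m], rule AE_I2)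
      fix y
      show "norm (norm (f y) * norm (y - a) powr ?b)
         \<le> norm (norm (f y) powr p + indicator {w. norm w \<ge> r} (y - a) * norm (y - a) powr (?b * q))"
      proof (cases "norm (y - a) < r")
        case True
        then show ?thesis by (simp add: f0)
      next
        case False
        define s where "s = norm (f y)"
        define t where "t = norm (y - a) powr ?b"
        have st: "s \<ge> 0" "t > 0" using False r by (auto simp: s_def t_def)
        \<comment> \<open>Young's inequality without constants: compare \<open>t\<close> with \<open>s\<close> to the power \<open>p - 1\<close>.\<close>
        have "s * t \<le> s powr p + t powr q"
        proof (cases "t \<le> s powr (p - 1)")
          case True
          then have "s * t \<le> s * s powr (p - 1)" using st by (intro mult_left_mono)
          also have "\<dots> = s powr p" using st by (cases "s = 0") (auto simp: powr_mult_base)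
          finally show ?thesis by (simp add: add_increasing2)
        next
          case False
          have "s powr (p - 1) \<le> t" using False by simp
          then have "(s powr (p - 1)) powr (q - 1) * t \<le> t powr (q - 1) * t"
            using st q p1 by (intro mult_right_mono powr_mono2) (auto simp: q_def field_simps)
          moreover have "t powr (q - 1) * t = t powr q" using st powr_mult_base[of t "q - 1"] by (simp add: mult.commute)
          moreover have "(s powr (p - 1)) powr (q - 1) = s"
          proof -
            have "(p - 1) * (q - 1) = 1" using q(2) by (simp add: algebra_simps)
            then show ?thesis using st by (simp add: powr_powr)
          qed
          ultimately show ?thesis by (simp add: add_increasing)
        qed
        moreover have "t powr q = norm (y - a) powr (?b * q)" by (simp add: t_def powr_powr)
        ultimately show ?thesis using False st by (simp add: s_def t_def)
      qed
    qed
  qed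
qed

text \<open>Multiplied by the power of the norm, \<open>f\<close> annihilates all polynomials in the variable inverted about
  \<open>x0\<close>, and this variable stays in a compact ball where \<open>f\<close> is not zero. By the Stone--Weierstrass
  theorem the product annihilates all continuous functions of the inverted variable, hence in the
  limit the indicator functions of all compact sets that avoid \<open>x0\<close>.\<close>

lemma AE_zero_if_moments_zero:
  fixes f :: "real^'n::finite \<Rightarrow> complex"
  assumes fm: "f \<in> borel_measurable lebesgue" and r: "r > 0" and f0: "\<And>y. norm (x0 - y) < r \<Longrightarrow> f y = 0"
    and i: "integrable lebesgue (\<lambda>y. norm (f y) * norm (x0 - y) powr (1 - real CARD('n)))"
    and zero: "\<And>\<beta>. (LINT y|lebesgue. f y * kern 0 \<beta> (x0 - y)) = 0"
  shows "AE y in lebesgue. f y = 0"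
proof -
  let ?b = "1 - real CARD('n)"
  define g where "g y = f y * of_real (norm (x0 - y) powr ?b)" for y
  define \<iota> where "\<iota> y = sphere_inv (x0 - y)" for y
  have gm: "g \<in> borel_measurable lebesgue" unfolding g_def
    by (intro borel_measurable_times fm borel_measurable_lebesgueI) measurable
  have gi: "integrable lebesgue g"
  proof (rule Bochner_Integration.integrable_bound[OF i gm])
    show "AE y in lebesgue. norm (g y) \<le> norm (norm (f y) * norm (x0 - y) powr ?b)"
      by (intro AE_I2) (simp add: g_def norm_mult)
  qed
  define A where "A = (LINT y|lebesgue. norm (g y))"
  have A: "A \<ge> 0" by (simp add: A_def)
  have \<iota>m: "\<iota> \<in> borel_measurable borel" unfolding \<iota>_def sphere_inv_def by measurable
  have \<iota>r: "\<iota> y \<in> cball 0 (inverse r)" if "g y \<noteq> 0" for y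
  proof -
    have "norm (x0 - y) \<ge> r" using that f0[of y] by (force simp: g_def)
    then show ?thesis using r by (simp add: \<iota>_def norm_sphere_inv le_imp_inverse_le)
  qed
  have prod_int: "integrable lebesgue (\<lambda>y. g y * h (\<iota> y))"
    if h: "h \<in> borel_measurable borel" "\<And>z. z \<in> cball 0 (inverse r) \<Longrightarrow> norm (h z) \<le> M" for h :: "real^'n \<Rightarrow> complex" and M
  proof (rule Bochner_Integration.integrable_bound)
    show "integrable lebesgue (\<lambda>y. norm (g y) * M)" using integrable_norm[OF gi] by (rule integrable_mult_left)
    show "(\<lambda>y. g y * h (\<iota> y)) \<in> borel_measurable lebesgue"
      by (intro borel_measurable_times gm borel_measurable_lebesgueI measurable_compose[OF \<iota>m h(1)])
    show "AE y in lebesgue. norm (g y * h (\<iota> y)) \<le> norm (norm (g y) * M)"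
    proof (rule AE_I2)
      fix y
      show "norm (g y * h (\<iota> y)) \<le> norm (norm (g y) * M)"
      proof (cases "g y = 0")
        case False
        have "norm (h (\<iota> y)) \<le> \<bar>M\<bar>" using h(2)[OF \<iota>r[OF False]] by linarith
        then show ?thesis by (simp add: norm_mult abs_mult mult_left_mono)
      qed simp
    qed
  qed
  have bounded_cont: "\<exists>M. \<forall>z\<in>cball 0 (inverse r). norm (h z) \<le> M" if "continuous_on UNIV h" for h :: "real^'n \<Rightarrow> complex"
    by (rule compact_norm_bound[OF compact_cball continuous_on_subset[OF that]]) simp
  have cont_int: "integrable lebesgue (\<lambda>y. g y * h (\<iota> y))" if h: "continuous_on UNIV h" for h :: "real^'n \<Rightarrow> complex"
  proof -
    obtain M where "\<forall>z\<in>cball 0 (inverse r). norm (h z) \<le> M" using bounded_cont[OF h] by (rule exE)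
    then show ?thesis by (intro prod_int[of h M] borel_measurable_continuous_onI[OF h]) auto
  qed
  have monom: "g y * of_real (monom_fun \<beta> (\<iota> y)) = f y * kern 0 \<beta> (x0 - y)" for y \<beta>
    by (simp add: g_def \<iota>_def kern_0_eq)
  have poly: "(LINT y|lebesgue. g y * of_real (q (\<iota> y))) = 0" if q: "real_polynomial_function q" for q
  proof -
    obtain L where L: "\<forall>z. complex_of_real (q z) = (\<Sum>(c, \<beta>)\<leftarrow>L. c * of_real (monom_fun \<beta> z))"
      using algebra_gen_coords_monom[OF real_polynomial_algebra_gen[OF q]] by (rule exE)
    have mi: "integrable lebesgue (\<lambda>y. f y * kern 0 \<beta> (x0 - y))" for \<beta>
      unfolding monom[symmetric]
      by (rule cont_int[OF smooth_on_continuous[OF smooth_on_monom_fun]])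
    have "integrable lebesgue (\<lambda>y. \<Sum>(c, \<beta>)\<leftarrow>L. c * (f y * kern 0 \<beta> (x0 - y))) \<and>
       (LINT y|lebesgue. (\<Sum>(c, \<beta>)\<leftarrow>L. c * (f y * kern 0 \<beta> (x0 - y)))) = 0" for L
    proof (induction L)
      case (Cons a L)
      obtain c \<beta> where a: "a = (c, \<beta>)" by (cases a)
      have ci: "integrable lebesgue (\<lambda>y. c * (f y * kern 0 \<beta> (x0 - y)))" by (rule integrable_mult_right[OF mi])
      have c0: "(LINT y|lebesgue. c * (f y * kern 0 \<beta> (x0 - y))) = 0" using zero[of \<beta>] by simp
      show ?case
        using Bochner_Integration.integrable_add[OF ci conjunct1[OF Cons]]
          Bochner_Integration.integral_add[OF ci conjunct1[OF Cons]] conjunct2[OF Cons] c0 by (simp add: a)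
    qed simp
    moreover have "g y * of_real (q (\<iota> y)) = (\<Sum>(c, \<beta>)\<leftarrow>L. c * (f y * kern 0 \<beta> (x0 - y)))" for y
    proof -
      have "g y * (\<Sum>(c, \<beta>)\<leftarrow>L. c * of_real (monom_fun \<beta> (\<iota> y))) = (\<Sum>(c, \<beta>)\<leftarrow>L. c * (f y * kern 0 \<beta> (x0 - y)))"
        unfolding monom[symmetric] by (induction L) (auto simp: algebra_simps)
      then show ?thesis using L by simp
    qed
    ultimately show ?thesis by simp
  qed
  have cont: "(LINT y|lebesgue. g y * of_real (h (\<iota> y))) = 0" if h: "continuous_on UNIV h" for h :: "real^'n \<Rightarrow> real"
  proof -
    have hc: "continuous_on UNIV (\<lambda>z. complex_of_real (h z))" using h by (rule continuous_on_of_real)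
    have "norm (LINT y|lebesgue. g y * of_real (h (\<iota> y))) \<le> e" if e: "e > 0" for e
    proof -
      define e' where "e' = e / (A + 1)"
      have e': "e' > 0" "e' * A \<le> e" using e A by (auto simp: e'_def field_simps)
      have "continuous_on (cball 0 (inverse r)) h" by (rule continuous_on_subset[OF h]) simp
      then obtain q where q: "real_polynomial_function q" "\<And>z. z \<in> cball 0 (inverse r) \<Longrightarrow> \<bar>h z - q z\<bar> < e'"
        using Stone_Weierstrass_real_polynomial_function[OF compact_cball _ e'(1), of 0 "inverse r" h] by blast
      have qc: "continuous_on UNIV (\<lambda>z. complex_of_real (q z))"
        by (rule smooth_on_continuous[OF smooth_on_polynomial[OF real_polynomial_algebra_gen[OF q(1)] open_UNIV]])
      have di: "integrable lebesgue (\<lambda>y. g y * of_real (h (\<iota> y)) - g y * of_real (q (\<iota> y)))"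
        by (rule Bochner_Integration.integrable_diff[OF cont_int[OF hc] cont_int[OF qc]])
      have ei: "integrable lebesgue (\<lambda>y. e' * norm (g y))" using integrable_norm[OF gi] by (rule integrable_mult_right)
      have "(LINT y|lebesgue. g y * of_real (h (\<iota> y))) = (LINT y|lebesgue. g y * of_real (h (\<iota> y)) - g y * of_real (q (\<iota> y)))"
        by (subst Bochner_Integration.integral_diff[OF cont_int[OF hc] cont_int[OF qc]]) (simp only: poly[OF q(1)] diff_zero)
      then have "norm (LINT y|lebesgue. g y * of_real (h (\<iota> y))) \<le> (LINT y|lebesgue. norm (g y * of_real (h (\<iota> y)) - g y * of_real (q (\<iota> y))))"
        by (simp only: integral_norm_bound)
      also have "\<dots> \<le> (LINT y|lebesgue. e' * norm (g y))"
      proof (rule integral_mono[OF integrable_norm[OF di] ei])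
        fix y
        show "norm (g y * of_real (h (\<iota> y)) - g y * of_real (q (\<iota> y))) \<le> e' * norm (g y)"
        proof (cases "g y = 0")
          case False
          have "norm (g y * of_real (h (\<iota> y)) - g y * of_real (q (\<iota> y))) = norm (g y) * \<bar>h (\<iota> y) - q (\<iota> y)\<bar>"
            unfolding right_diff_distrib[symmetric] of_real_diff[symmetric] norm_mult norm_of_real ..
          also have "\<dots> \<le> norm (g y) * e'" using q(2)[OF \<iota>r[OF False]] by (intro mult_left_mono) auto
          finally show ?thesis by (simp add: mult.commute)
        qed simp
      qed
      also have "\<dots> = e' * A" by (simp add: A_def)
      finally show ?thesis using e'(2) by simp
    qed
    then have "norm (LINT y|lebesgue. g y * of_real (h (\<iota> y))) \<le> 0" by (rule field_le_epsilon[of _ 0, simplified])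
    then show ?thesis by simp
  qed
  have compact0: "(LINT y:C|lebesgue. g y) = 0" if C: "compact C" "C \<subseteq> - {x0}" for C
  proof (cases "C = {}")
    case False
    define C' where "C' = \<iota> ` C"
    have "continuous_on C \<iota>" unfolding \<iota>_def
      by (rule continuous_on_compose2[OF continuous_on_sphere_inv]) (use C(2) in \<open>auto intro!: continuous_intros\<close>)
    then have C': "closed C'" "C' \<noteq> {}" using False compact_continuous_image[OF _ C(1)] compact_imp_closed by (auto simp: C'_def)
    have inC': "\<iota> y \<in> C' \<longleftrightarrow> y \<in> C" for y
    proof
      assume "\<iota> y \<in> C'"
      then obtain y' where y': "y' \<in> C" "\<iota> y = \<iota> y'" by (auto simp: C'_def)
      have "x0 - y = x0 - y'" using arg_cong[OF y'(2), of sphere_inv] by (simp add: \<iota>_def sphere_inv_involution)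
      then show "y \<in> C" using y'(1) by simp
    qed (auto simp: C'_def)
    \<comment> \<open>Continuous functions that decrease to the indicator function of the closed set \<open>C'\<close>.\<close>
    define h where "h m z = max 0 (1 - real m * infdist z C')" for m z
    have hc: "continuous_on UNIV (h m)" for m unfolding h_def by (intro continuous_intros)
    have "(\<lambda>m. LINT y|lebesgue. g y * of_real (h m (\<iota> y))) \<longlonglongrightarrow> (LINT y|lebesgue. indicator C y *\<^sub>R g y)"
    proof (rule integral_dominated_convergence[where w = "\<lambda>y. norm (g y)"])
      show "(\<lambda>y. indicator C y *\<^sub>R g y) \<in> borel_measurable lebesgue"
        by (rule borel_measurable_scaleR[OF borel_measurable_indicator[OF fmeasurableD[OF lmeasurable_compact[OF C(1)]]] gm])
      show "(\<lambda>y. g y * of_real (h m (\<iota> y))) \<in> borel_measurable lebesgue" for m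
        by (rule borel_measurable_integrable[OF cont_int[OF continuous_on_of_real[OF hc]]])
      show "integrable lebesgue (\<lambda>y. norm (g y))" by (rule integrable_norm[OF gi])
      show "AE y in lebesgue. norm (g y * of_real (h m (\<iota> y))) \<le> norm (g y)" for m
      proof (rule AE_I2)
        fix y
        have "\<bar>h m (\<iota> y)\<bar> \<le> 1" using infdist_nonneg[of "\<iota> y" C'] by (auto simp: h_def)
        then show "norm (g y * of_real (h m (\<iota> y))) \<le> norm (g y)"
          using mult_left_mono[of "\<bar>h m (\<iota> y)\<bar>" 1 "norm (g y)"] by (simp add: norm_mult)
      qed
      show "AE y in lebesgue. (\<lambda>m. g y * of_real (h m (\<iota> y))) \<longlonglongrightarrow> indicator C y *\<^sub>R g y"
      proof (rule AE_I2)
        fix y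
        show "(\<lambda>m. g y * of_real (h m (\<iota> y))) \<longlonglongrightarrow> indicator C y *\<^sub>R g y"
        proof (cases "y \<in> C")
          case True
          then have "h m (\<iota> y) = 1" for m using inC'[of y] by (simp add: h_def)
          then show ?thesis using True by simp
        next
          case False
          then have "infdist (\<iota> y) C' > 0"
            using inC'[of y] C' in_closed_iff_infdist_zero[of C' "\<iota> y"] infdist_nonneg[of "\<iota> y" C'] by force
          moreover obtain m0 where "1 / infdist (\<iota> y) C' < real m0" using reals_Archimedean2 by (rule exE)
          ultimately have m0: "1 < real m0 * infdist (\<iota> y) C'" by (simp add: field_simps)
          have "h m (\<iota> y) = 0" if "m \<ge> m0" for m
          proof -
            have "real m0 * infdist (\<iota> y) C' \<le> real m * infdist (\<iota> y) C'"
              using that infdist_nonneg[of "\<iota> y" C'] by (intro mult_right_mono) auto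
            then show ?thesis using m0 by (simp add: h_def)
          qed
          then have "\<forall>\<^sub>F m in sequentially. g y * of_real (h m (\<iota> y)) = 0"
            by (intro eventually_sequentiallyI[of m0]) simp
          then show ?thesis using False by (simp add: tendsto_eventually)
        qed
      qed
    qed
    then have "(\<lambda>m::nat. 0) \<longlonglongrightarrow> (LINT y|lebesgue. indicator C y *\<^sub>R g y)" using cont[OF hc] by simp
    then have "(LINT y|lebesgue. indicator C y *\<^sub>R g y) = 0" by (rule LIMSEQ_unique[OF _ tendsto_const])
    then show ?thesis by (simp add: set_lebesgue_integral_def)
  qed (simp add: set_lebesgue_integral_def)
  have "AE y in lebesgue. y \<in> - {x0} \<longrightarrow> g y = 0"
  proof (rule AE_zero_if_compact_integrals_0)
    show "(\<lambda>y. indicator (- {x0}) y *\<^sub>R g y) \<in> borel_measurable lebesgue"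
      using gm by (intro borel_measurable_scaleR borel_measurable_indicator) auto
    show "- {x0} \<in> sets lebesgue" by auto
    show "set_integrable lebesgue C g" if "compact C" for C
      unfolding set_integrable_def
      by (rule integrable_mult_indicator[OF fmeasurableD[OF lmeasurable_compact[OF that]] gi])
    show "(LINT y:C|lebesgue. g y) = 0" if "compact C" "C \<subseteq> - {x0}" for C by (rule compact0[OF that])
  qed
  then show ?thesis
  proof (rule eventually_mono)
    fix y assume "y \<in> - {x0} \<longrightarrow> g y = 0"
    then show "f y = 0" using f0[of y] r by (cases "y = x0") (auto simp: g_def)
  qed
qed

text \<open>Setting \<open>f\<close> to zero on a closed ball inside \<open>U\<close> gives a representative \<open>f0\<close> for which all the integrals
  \<open>G j \<beta> x\<close> converge absolutely for every \<open>x\<close> in the smaller ball \<open>B\<close>, uniformly dominated by a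
  multiple of \<open>D\<close>. So they may be differentiated under the integral sign.\<close>

lemma Lp_unique_continuation:
  fixes f :: "real^'n::finite \<Rightarrow> complex" and p :: real
  assumes n: "CARD('n) \<ge> 2" and U: "open U" and E: "E \<subseteq> U" "E \<in> sets lebesgue" "emeasure lebesgue E > 0"
    and p: "1 \<le> p" "p < real CARD('n)" and f: "in_Lp p f"
    and fU: "AE x in lebesgue. x \<in> U \<longrightarrow> f x = 0"
    and fE: "AE x in lebesgue. x \<in> E \<longrightarrow> normal_op f x = 0"
  shows "AE x in lebesgue. f x = 0"
proof -
  let ?b = "1 - real CARD('n)"
  obtain x1 r where r: "r > 0" "cball x1 (2 * r) \<subseteq> U" "emeasure lebesgue (E \<inter> ball x1 r) > 0"
    using positive_measure_in_ball[OF U E] by (elim exE conjE)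
  define B where "B = ball x1 r"
  have oB: "open B" by (simp add: B_def)
  define f0 where "f0 y = indicator (- cball x1 (2 * r)) y *\<^sub>R f y" for y
  have fm: "f \<in> borel_measurable lebesgue" using f by (simp add: in_Lp_def)
  have f0m: "f0 \<in> borel_measurable lebesgue" unfolding f0_def
    using fm by (intro borel_measurable_scaleR borel_measurable_indicator) auto
  have ff0: "AE y in lebesgue. f y = f0 y"
    using fU by (rule eventually_mono) (use r(2) in \<open>auto simp: f0_def indicator_def\<close>)
  have f0Lp: "in_Lp p f0"
  proof -
    have "integrable lebesgue (\<lambda>y. norm (f y) powr p)" using f by (simp add: in_Lp_def)
    then have "integrable lebesgue (\<lambda>y. norm (f0 y) powr p)"
    proof (rule Bochner_Integration.integrable_bound)
      show "(\<lambda>y. norm (f0 y) powr p) \<in> borel_measurable lebesgue" using f0m by measurable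
    qed (intro AE_I2, auto simp: f0_def indicator_def)
    then show ?thesis using f0m by (simp add: in_Lp_def)
  qed
  define D where "D y = norm (f0 y) * norm (y - x1) powr ?b" for y
  have Di: "integrable lebesgue D" unfolding D_def
    by (rule Lp_mult_kernel_integrable[OF n p f0Lp, of "2 * r"])
       (use r(1) in \<open>auto simp: f0_def dist_norm norm_minus_commute\<close>)
  have D0: "D y \<ge> 0" for y by (simp add: D_def)
  have far: "norm (x - y) \<ge> r" "norm (x - y) \<ge> norm (y - x1) / 2" if "x \<in> B" "f0 y \<noteq> 0" for x y
  proof -
    have "norm (y - x1) > 2 * r" using that(2) by (auto simp: f0_def indicator_def dist_norm norm_minus_commute split: if_splits)
    moreover have "norm (x - x1) < r" using that(1) by (simp add: B_def dist_norm norm_minus_commute)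
    moreover have "norm (y - x1) \<le> norm (x - y) + norm (x - x1)"
      using norm_triangle_ineq4[of "x - x1" "x - y"] by simp
    ultimately show "norm (x - y) \<ge> r" "norm (x - y) \<ge> norm (y - x1) / 2" by linarith+
  qed
  have kb: "\<exists>C\<ge>0. \<forall>x\<in>B. \<forall>y. norm (f0 y * kern j \<beta> (x - y)) \<le> C * D y" for j \<beta>
  proof -
    obtain C where C: "C \<ge> 0" "\<And>w::real^'n. norm w \<ge> r \<Longrightarrow> norm (kern j \<beta> w) \<le> C * norm w powr ?b"
      using norm_kern_le_away[OF r(1), of j \<beta>] by blast
    have "norm (f0 y * kern j \<beta> (x - y)) \<le> (C * (1 / 2) powr ?b) * D y" if x: "x \<in> B" for x y
    proof (cases "f0 y = 0")
      case False
      have "norm (y - x1) \<noteq> 0" using False r(1) by (auto simp: f0_def)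
      then have "norm (x - y) powr ?b \<le> (norm (y - x1) / 2) powr ?b"
        using far(2)[OF x False] n by (intro powr_mono2') auto
      also have "\<dots> = (1 / 2) powr ?b * norm (y - x1) powr ?b"
        using powr_mult[of "1 / 2" "norm (y - x1)" ?b] by simp
      finally have "norm (kern j \<beta> (x - y)) \<le> C * ((1 / 2) powr ?b * norm (y - x1) powr ?b)"
        using C(2)[OF far(1)[OF x False]] mult_left_mono[OF _ C(1)] by (meson order_trans)
      from mult_left_mono[OF this norm_ge_zero[of "f0 y"]] show ?thesis
        by (simp add: norm_mult D_def mult_ac)
    qed (simp add: D_def)
    then show ?thesis using C(1) by (intro exI[of _ "C * (1 / 2) powr ?b"]) simp
  qed
  have km: "(\<lambda>y. f0 y * kern j \<beta> (x - y)) \<in> borel_measurable lebesgue" for j \<beta> x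
  proof -
    note [measurable] = kern_borel[of j \<beta>]
    have "(\<lambda>y. kern j \<beta> (x - y)) \<in> borel_measurable borel" by measurable
    then show ?thesis by (intro borel_measurable_times f0m borel_measurable_lebesgueI)
  qed
  have ki: "integrable lebesgue (\<lambda>y. f0 y * kern j \<beta> (x - y))" if x: "x \<in> B" for j \<beta> x
  proof -
    obtain C where C: "C \<ge> 0" "\<forall>x\<in>B. \<forall>y. norm (f0 y * kern j \<beta> (x - y)) \<le> C * D y" using kb[of j \<beta>] by (elim exE conjE)
    have "integrable lebesgue (\<lambda>y. C * D y)" by (rule integrable_mult_right[OF Di])
    then show ?thesis
      by (rule Bochner_Integration.integrable_bound[OF _ km]) (use C x D0 in \<open>auto intro!: AE_I2\<close>)
  qed
  define G where "G j \<beta> x = (LINT y|lebesgue. f0 y * kern j \<beta> (x - y))" for j \<beta> x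
  \<comment> \<open>The derivative of \<open>kern j \<beta>\<close> in direction \<open>i\<close>, away from the origin.\<close>
  define v' where "v' i j \<beta> w = (\<Sum>\<gamma>\<leftarrow>del_one i \<beta>. kern (Suc j) \<gamma> w)
     + of_real (kern_exp TYPE('n) j (length \<beta>)) * kern j (i # \<beta>) w" for i j \<beta> and w :: "real^'n"
  have lsum: "(\<exists>C\<ge>0. \<forall>x\<in>B. \<forall>y. norm (f0 y * (\<Sum>\<gamma>\<leftarrow>L. kern j \<gamma> (x - y))) \<le> C * D y) \<and>
     (\<forall>x\<in>B. integrable lebesgue (\<lambda>y. f0 y * (\<Sum>\<gamma>\<leftarrow>L. kern j \<gamma> (x - y))) \<and>
       (LINT y|lebesgue. f0 y * (\<Sum>\<gamma>\<leftarrow>L. kern j \<gamma> (x - y))) = (\<Sum>\<gamma>\<leftarrow>L. G j \<gamma> x))" for j L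
  proof (induction L)
    case (Cons \<gamma> L)
    obtain C where C: "C \<ge> 0" "\<forall>x\<in>B. \<forall>y. norm (f0 y * kern j \<gamma> (x - y)) \<le> C * D y" using kb[of j \<gamma>] by (elim exE conjE)
    obtain C' where C': "C' \<ge> 0" "\<forall>x\<in>B. \<forall>y. norm (f0 y * (\<Sum>\<gamma>\<leftarrow>L. kern j \<gamma> (x - y))) \<le> C' * D y"
      using Cons by (elim exE conjE)
    have IH: "integrable lebesgue (\<lambda>y. f0 y * (\<Sum>\<gamma>\<leftarrow>L. kern j \<gamma> (x - y)))"
      "(LINT y|lebesgue. f0 y * (\<Sum>\<gamma>\<leftarrow>L. kern j \<gamma> (x - y))) = (\<Sum>\<gamma>\<leftarrow>L. G j \<gamma> x)" if "x \<in> B" for x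
      using Cons that by auto
    have e: "f0 y * (\<Sum>\<gamma>\<leftarrow>\<gamma> # L. kern j \<gamma> (x - y)) = f0 y * kern j \<gamma> (x - y) + f0 y * (\<Sum>\<gamma>\<leftarrow>L. kern j \<gamma> (x - y))" for x y
      by (simp add: distrib_left)
    have "norm (f0 y * (\<Sum>\<gamma>\<leftarrow>\<gamma> # L. kern j \<gamma> (x - y))) \<le> (C + C') * D y" if "x \<in> B" for x y
      unfolding e distrib_right by (rule norm_triangle_mono) (use C C' that in auto)
    moreover have "integrable lebesgue (\<lambda>y. f0 y * (\<Sum>\<gamma>\<leftarrow>\<gamma> # L. kern j \<gamma> (x - y)))" if "x \<in> B" for x
      unfolding e by (rule Bochner_Integration.integrable_add[OF ki[OF that] IH(1)[OF that]])
    moreover have "(LINT y|lebesgue. f0 y * (\<Sum>\<gamma>\<leftarrow>\<gamma> # L. kern j \<gamma> (x - y))) = (\<Sum>\<gamma>\<leftarrow>\<gamma> # L. G j \<gamma> x)" if "x \<in> B" for x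
      unfolding e by (subst Bochner_Integration.integral_add[OF ki[OF that] IH(1)[OF that]]) (simp add: IH(2)[OF that] G_def)
    ultimately show ?case using C(1) C'(1) by (intro conjI exI[of _ "C + C'"]) auto
  qed (auto intro!: exI[of _ 0])
  have v'b: "\<exists>C\<ge>0. \<forall>x\<in>B. \<forall>y. norm (f0 y * v' i j \<beta> (x - y)) \<le> C * D y" for i j \<beta>
  proof -
    let ?a = "complex_of_real (kern_exp TYPE('n) j (length \<beta>))"
    obtain C where C: "C \<ge> 0" "\<forall>x\<in>B. \<forall>y. norm (f0 y * kern j (i # \<beta>) (x - y)) \<le> C * D y" using kb[of j "i # \<beta>"] by (elim exE conjE)
    obtain C' where C': "C' \<ge> 0" "\<forall>x\<in>B. \<forall>y. norm (f0 y * (\<Sum>\<gamma>\<leftarrow>del_one i \<beta>. kern (Suc j) \<gamma> (x - y))) \<le> C' * D y"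
      using conjunct1[OF lsum[of "Suc j" "del_one i \<beta>"]] by (elim exE conjE)
    have "norm (f0 y * v' i j \<beta> (x - y)) \<le> (C' + norm ?a * C) * D y" if "x \<in> B" for x y
    proof -
      have "f0 y * v' i j \<beta> (x - y) = f0 y * (\<Sum>\<gamma>\<leftarrow>del_one i \<beta>. kern (Suc j) \<gamma> (x - y)) + ?a * (f0 y * kern j (i # \<beta>) (x - y))"
        by (simp add: v'_def algebra_simps)
      also have "norm \<dots> \<le> C' * D y + norm ?a * (C * D y)"
      proof (rule norm_triangle_mono)
        show "norm (?a * (f0 y * kern j (i # \<beta>) (x - y))) \<le> norm ?a * (C * D y)"
          unfolding norm_mult[of ?a] using C that by (intro mult_left_mono) auto
      qed (use C' that in auto)
      finally show ?thesis by (simp add: algebra_simps)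
    qed
    then show ?thesis using C(1) C'(1) by (intro exI[of _ "C' + norm ?a * C"]) auto
  qed
  have v'i: "(LINT y|lebesgue. f0 y * v' i j \<beta> (x - y))
      = (\<Sum>\<gamma>\<leftarrow>del_one i \<beta>. G (Suc j) \<gamma> x) + of_real (kern_exp TYPE('n) j (length \<beta>)) * G j (i # \<beta>) x"
    and v'm: "(\<lambda>y. f0 y * v' i j \<beta> (x - y)) \<in> borel_measurable lebesgue" if x: "x \<in> B" for i j \<beta> x
  proof -
    let ?a = "complex_of_real (kern_exp TYPE('n) j (length \<beta>))"
    have e: "f0 y * v' i j \<beta> (x - y) = f0 y * (\<Sum>\<gamma>\<leftarrow>del_one i \<beta>. kern (Suc j) \<gamma> (x - y)) + ?a * (f0 y * kern j (i # \<beta>) (x - y))" for y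
      by (simp add: v'_def algebra_simps)
    have i1: "integrable lebesgue (\<lambda>y. f0 y * (\<Sum>\<gamma>\<leftarrow>del_one i \<beta>. kern (Suc j) \<gamma> (x - y)))"
      and s1: "(LINT y|lebesgue. f0 y * (\<Sum>\<gamma>\<leftarrow>del_one i \<beta>. kern (Suc j) \<gamma> (x - y))) = (\<Sum>\<gamma>\<leftarrow>del_one i \<beta>. G (Suc j) \<gamma> x)"
      using bspec[OF conjunct2[OF lsum[of "Suc j" "del_one i \<beta>"]] x] by auto
    have i2: "integrable lebesgue (\<lambda>y. ?a * (f0 y * kern j (i # \<beta>) (x - y)))" by (rule integrable_mult_right[OF ki[OF x]])
    show "(LINT y|lebesgue. f0 y * v' i j \<beta> (x - y)) = (\<Sum>\<gamma>\<leftarrow>del_one i \<beta>. G (Suc j) \<gamma> x) + ?a * G j (i # \<beta>) x"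
      unfolding e by (subst Bochner_Integration.integral_add[OF i1 i2]) (simp add: s1 G_def)
    show "(\<lambda>y. f0 y * v' i j \<beta> (x - y)) \<in> borel_measurable lebesgue"
      unfolding e by (rule borel_measurable_integrable[OF Bochner_Integration.integrable_add[OF i1 i2]])
  qed
  have pd: "(\<lambda>x. f0 y * kern j \<beta> (x - y)) differentiable (at x)"
    "pderiv_coord i (\<lambda>x. f0 y * kern j \<beta> (x - y)) x = f0 y * v' i j \<beta> (x - y)" if x: "x \<in> B" for i j \<beta> x y
  proof -
    have "(\<lambda>x. f0 y * kern j \<beta> (x - y)) differentiable (at x) \<and>
      pderiv_coord i (\<lambda>x. f0 y * kern j \<beta> (x - y)) x = f0 y * v' i j \<beta> (x - y)"
    proof (cases "f0 y = 0")
      case False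
      have nz: "x - y \<noteq> 0" using far(1)[OF x False] r(1) by auto
      have s: "smooth_on (- {y}) (\<lambda>x. kern j \<beta> (x - y))" by (rule smooth_on_translate[OF smooth_on_kern]) simp
      have d: "(\<lambda>x. kern j \<beta> (x - y)) differentiable (at x)" by (rule smooth_on_differentiable[OF s]) (use nz in auto)
      have "pderiv_coord i (\<lambda>x. kern j \<beta> (x - y)) x = pderivs [i] (kern j \<beta>) (x - y)"
        using pderivs_shift[of "[i]" "kern j \<beta>" y] by (simp add: pderivs_Cons)
      also have "\<dots> = v' i j \<beta> (x - y)" unfolding pderivs_Cons pderivs_Nil v'_def by (rule pderiv_coord_kern[OF nz])
      finally show ?thesis using d pderiv_coord_mult[OF differentiable_const d, of i "f0 y"]
        by (simp add: pderiv_coord_const differentiable_mult)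
    qed (simp add: pderiv_coord_const)
    then show "(\<lambda>x. f0 y * kern j \<beta> (x - y)) differentiable (at x)"
      "pderiv_coord i (\<lambda>x. f0 y * kern j \<beta> (x - y)) x = f0 y * v' i j \<beta> (x - y)" by auto
  qed
  have der: "(G j \<beta> has_derivative (\<lambda>v. \<Sum>i\<in>UNIV. of_real (v $ i) *
      ((\<Sum>\<gamma>\<leftarrow>del_one i \<beta>. G (Suc j) \<gamma> x) + of_real (kern_exp TYPE('n) j (length \<beta>)) * G j (i # \<beta>) x))) (at x)"
    if x: "x \<in> B" for j \<beta> x
  proof -
    obtain C where C: "\<And>i. C i \<ge> 0" "\<And>i x y. x \<in> B \<Longrightarrow> norm (f0 y * v' i j \<beta> (x - y)) \<le> C i * D y"
      using v'b[of _ j \<beta>] by metis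
    have "\<exists>e>0. ball x e \<subseteq> B" using bspec[OF open_contains_ball[THEN iffD1, OF oB] x] .
    then obtain e where e: "e > 0" "ball x e \<subseteq> B" by (elim exE conjE)
    have "((\<lambda>x. LINT y|lebesgue. f0 y * kern j \<beta> (x - y)) has_derivative
      (\<lambda>v. \<Sum>i\<in>UNIV. of_real (v $ i) * (LINT y|lebesgue. pderiv_coord i (\<lambda>x. f0 y * kern j \<beta> (x - y)) x))) (at x)"
    proof (rule has_derivative_integral[OF e(1), where D = "\<lambda>y. (\<Sum>i\<in>UNIV. C i) * D y"])
      show "integrable lebesgue (\<lambda>y. (\<Sum>i\<in>UNIV. C i) * D y)" by (rule integrable_mult_right[OF Di])
      show "(\<lambda>x. f0 y * kern j \<beta> (x - y)) differentiable (at z)" if "z \<in> ball x e" for y z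
        by (rule pd(1)) (use that e(2) in blast)
      show "integrable lebesgue (\<lambda>y. f0 y * kern j \<beta> (z - y))" if "z \<in> ball x e" for z
        by (rule ki) (use that e(2) in blast)
      show "(\<lambda>y. pderiv_coord i (\<lambda>x. f0 y * kern j \<beta> (x - y)) x) \<in> borel_measurable lebesgue" for i
        unfolding pd(2)[OF x] by (rule v'm[OF x])
      show "norm (pderiv_coord i (\<lambda>x. f0 y * kern j \<beta> (x - y)) z) \<le> (\<Sum>i\<in>UNIV. C i) * D y" if "z \<in> ball x e" for y z i
      proof -
        have z: "z \<in> B" using that e(2) by blast
        have "norm (pderiv_coord i (\<lambda>x. f0 y * kern j \<beta> (x - y)) z) \<le> C i * D y" unfolding pd(2)[OF z] by (rule C(2)[OF z])
        also have "\<dots> \<le> (\<Sum>i\<in>UNIV. C i) * D y"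
          by (intro mult_right_mono member_le_sum D0) (auto simp: C(1))
        finally show ?thesis .
      qed
    qed
    then show ?thesis unfolding pd(2)[OF x] v'i[OF x] G_def[symmetric] .
  qed
  have Gc: "continuous_on B (G j \<beta>)" for j \<beta>
    by (intro continuous_at_imp_continuous_on ballI has_derivative_continuous[OF der])
  have Gd: "((\<lambda>t. G j \<beta> (x + t *\<^sub>R axis i 1)) has_vector_derivative
       1 * ((\<Sum>\<gamma>\<leftarrow>del_one i \<beta>. G (Suc j) \<gamma> x) + of_real (kern_exp TYPE('n) j (length \<beta>)) * G j (i # \<beta>) x)) (at 0)"
    if x: "x \<in> B" for j \<beta> i x
  proof -
    define V where "V k = (\<Sum>\<gamma>\<leftarrow>del_one k \<beta>. G (Suc j) \<gamma> x) + of_real (kern_exp TYPE('n) j (length \<beta>)) * G j (k # \<beta>) x" for k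
    have 1: "((\<lambda>t. x + t *\<^sub>R axis i 1) has_derivative (\<lambda>t. t *\<^sub>R axis i 1)) (at 0)"
      by (auto intro!: derivative_eq_intros)
    have 2: "(G j \<beta> has_derivative (\<lambda>v. \<Sum>k\<in>UNIV. of_real (v $ k) * V k)) (at (x + 0 *\<^sub>R axis i 1))"
      using der[OF x] by (simp add: V_def)
    have "(\<Sum>k\<in>UNIV. complex_of_real ((t *\<^sub>R axis i 1) $ k) * V k) = t *\<^sub>R V i" for t
    proof -
      have "(\<Sum>k\<in>UNIV. complex_of_real ((t *\<^sub>R axis i 1) $ k) * V k) = (\<Sum>k\<in>UNIV. if k = i then of_real t * V k else 0)"
        by (intro sum.cong refl) (simp add: axis_def)
      then show ?thesis by (simp add: scaleR_conv_of_real)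
    qed
    then have "((\<lambda>t. G j \<beta> (x + t *\<^sub>R axis i 1)) has_vector_derivative V i) (at 0)"
      using diff_chain_at[OF 1 2] by (simp add: has_vector_derivative_def o_def)
    then show ?thesis by (simp add: V_def)
  qed
  have Gs: "(\<Sum>i\<in>UNIV. G j [i, i] x) = G (Suc j) [] x" if x: "x \<in> B" for j x
  proof -
    have "(\<Sum>i\<in>UNIV. G j [i, i] x) = (LINT y|lebesgue. (\<Sum>i\<in>UNIV. f0 y * kern j [i, i] (x - y)))"
      unfolding G_def by (rule Bochner_Integration.integral_sum[symmetric]) (rule ki[OF x])
    then show ?thesis by (simp add: G_def sum_distrib_left[symmetric] sum_kern_diagonal)
  qed
  have nG: "normal_op f x = 2 * G 0 [] x" for x
  proof -
    have "(LINT y|lebesgue. f y * kern 0 [] (x - y)) = (LINT y|lebesgue. f0 y * kern 0 [] (x - y))"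
    proof (rule integral_cong_AE)
      note [measurable] = kern_borel[of 0 "[] :: 'n list"]
      have "(\<lambda>y. kern 0 [] (x - y)) \<in> borel_measurable borel" by measurable
      then show "(\<lambda>y. f y * kern 0 [] (x - y)) \<in> borel_measurable lebesgue"
        by (intro borel_measurable_times fm borel_measurable_lebesgueI)
      show "AE y in lebesgue. f y * kern 0 [] (x - y) = f0 y * kern 0 [] (x - y)"
        using ff0 by (rule eventually_mono) simp
    qed (rule km)
    then show ?thesis by (simp add: normal_op_def convol_def ray_kernel_eq_kern G_def)
  qed
  have "AE x in lebesgue. x \<in> E \<inter> B \<longrightarrow> G 0 [] x = 0"
    using fE by (rule eventually_mono) (simp add: nG)
  then have ae: "AE x in lebesgue. x \<in> E \<inter> B \<longrightarrow> (\<forall>j \<beta>. G j \<beta> x = 0)"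
  proof (rule kern_functionals_vanish[where G = G and B = B and s = 1, OF n, rotated -1])
    show "(1 :: complex) \<noteq> 0" by simp
    show "(\<Sum>i\<in>UNIV. G j [i, i] x) = G (Suc j) [] x" if "x \<in> B" for j x by (rule Gs[OF that])
  qed (rule oB Gc Gd, assumption?)+
  have "\<exists>x0\<in>E \<inter> B. \<forall>j \<beta>. G j \<beta> x0 = 0"
    by (rule AE_ex_in_positive_measure[OF ae]) (use E(2) r(3) in \<open>auto simp: B_def\<close>)
  then obtain x0 where x0: "x0 \<in> B" "\<And>\<beta>. G 0 \<beta> x0 = 0" by blast
  have near: "f0 y = 0" if "norm (x0 - y) < r" for y using far(1)[OF x0(1), of y] that by force
  have "AE y in lebesgue. f0 y = 0"
  proof (rule AE_zero_if_moments_zero[OF f0m r(1) near _ x0(2)[unfolded G_def]])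
    have "f0 y = 0" if "norm (y - x0) < r" for y
      using near[of y] that by (simp add: norm_minus_commute)
    then have "integrable lebesgue (\<lambda>y. norm (f0 y) * norm (y - x0) powr ?b)"
      by (rule Lp_mult_kernel_integrable[OF n p f0Lp r(1)])
    then show "integrable lebesgue (\<lambda>y. norm (f0 y) * norm (x0 - y) powr ?b)"
      by (simp only: norm_minus_commute[of x0])
  qed
  with ff0 show ?thesis by eventually_elim simp
qed

theorem theoremB:
  fixes U E :: "(real^'n::finite) set"
  assumes "CARD('n) \<ge> 2"
    and "open U" and "U \<noteq> {}"
    and "E \<subseteq> U" and "E \<in> sets lebesgue" and "emeasure lebesgue E > 0"
  shows "(\<forall>f :: (real^'n \<Rightarrow> complex) \<Rightarrow> complex.
            compactly_supported_distribution f \<longrightarrow>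
            in_Hs (1/2) (normal_op_dist f) \<longrightarrow>
            dist_zero_on f U \<longrightarrow>
            dist_ae_zero_on (normal_op_dist f) E \<longrightarrow>
            dist_zero_on f UNIV)
       \<and> (\<forall>(p::real) (f :: real^'n \<Rightarrow> complex).
            1 \<le> p \<longrightarrow> p < real CARD('n) \<longrightarrow> in_Lp p f \<longrightarrow>
            in_Hs (1/2) (dist_of_fun (normal_op f)) \<longrightarrow>
            (AE x in lebesgue. x \<in> U \<longrightarrow> f x = 0) \<longrightarrow>
            (AE x in lebesgue. x \<in> E \<longrightarrow> normal_op f x = 0) \<longrightarrow>
            (AE x in lebesgue. f x = 0))"
  using compactly_supported_distribution_unique_continuation[OF assms(1,2,4-6)]
    Lp_unique_continuation[OF assms(1,2,4-6)]
  by blast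

end
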